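(* Let $\frac{\mathtt n}{\mathtt n+\epsilon}<p<1$. Let $f\in\Lambda_{\frac1p-1}(\mathcal X)$ (a function, not a class modulo constants) and $g\in\mathcal H^p(\mathcal X)$. Then the product $f\times g$ can be given a meaning as a distribution. That is, whenever $g=\sum_{i\ge1}\lambda_i\mathfrak a_i$ (in the sense of distributions) with $\sum_{i\ge1}|\lambda_i|^p<\infty$ and each $\mathfrak a_i$ a $(p,q)$-atom supported in a ball $B_i$, where $q\in(1,\infty]$, the two series $\sum_{i\ge1}\lambda_i(f-f_{B_i})\mathfrak a_i$ and $\sum_{i\ge1}\lambda_if_{B_i}\mathfrak a_i$ converge in the sense of distributions, and one puts $$f\times g:=\sum_{i\ge1}\lambda_i(f-f_{B_i})\mathfrak a_i+\sum_{i\ge1}\lambda_if_{B_i}\mathfrak a_i .$$ Moreover, $$f\times g\in L^1(\mathcal X)+\mathcal H^p(\mathcal X,d,\tau),\qquad\text{where } d\tau(x)=\frac{d\mu(x)}{\left(2K_0^2+K_0d(x_0,x)\right)^{(1-p)\mathtt n}} .$$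
   Context: Setting. $d$ is a quasimetric on $\mathcal X$: $d(x,y)=0$ iff $x=y$, $d(x,y)=d(y,x)$, and $d(x,y)\le K_0(d(x,z)+d(z,y))$ for a constant $K_0\ge1$. Balls are $B(x,r)=\{y\in\mathcal X:d(x,y)<r\}$, $r>0$; $r(B)$ is the radius of the ball $B$. $\mu$ is a positive Borel measure with all balls of finite positive measure and doubling: $\mu(B(x,2r))\le C_0\mu(B(x,r))$ for all $x,r$, $C_0$ being the smallest such constant; $\mathtt n=\log_2C_0$. All annuli are nonempty: $B(x,R)\setminus B(x,r)\ne\emptyset$ for all $x$ and $0<r<R<\infty$, and reverse doubling holds: there are constants $\kappa,c_\mu>0$ with $\mu(B)/\mu(\tilde B)\ge c_\mu (r(B)/r(\tilde B))^{\kappa}$ for all balls $\tilde B\subset B$. There is a positive nondecreasing function $\varphi$ on $[0,\infty)$ with $\mu(B(x,r))\sim\varphi(r)$ (two-sided bounds with constants independent of $x,r$). There are $A_0'>0$ and $0<\theta\le1$ with $|d(x,z)-d(y,z)|\le A_0'd(x,y)^\theta[d(x,z)+d(y,z)]^{1-\theta}$ for all $x,y,z$. Test functions and distributions. For $x_1\in\mathcal X$, $r>0$, $0<\beta\le1$, $\gamma>0$, $\mathcal G(x_1,r,\beta,\gamma)$ is the space of complex functions $\phi$ on $\mathcal X$ such that for some constant $C$: (i) $|\phi(x)|\le C\frac{1}{\mu(B(x,r+d(x,x_1)))}\left(\frac{r}{r+d(x_1,x)}\right)^\gamma$ for all $x$; (ii) $|\phi(x)-\phi(y)|\le C\left(\frac{d(x,y)}{r+d(x_1,x)}\right)^\beta\frac{1}{\mu(B(x,r+d(x,x_1)))}\left(\frac{r}{r+d(x_1,x)}\right)^\gamma$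 whenever $d(x,y)\le\frac{r+d(x_1,x)}{2K_0}$; normed by the infimum of such $C$. Fix $x_0\in\mathcal X$ and put $\mathcal G(\beta,\gamma)=\mathcal G(x_0,1,\beta,\gamma)$. Fix $\epsilon\in(0,\theta]$ and, for the given $p\in(\frac{\mathtt n}{\mathtt n+\epsilon},1]$, fix $\beta,\gamma$ with $\mathtt n(\frac1p-1)<\beta,\gamma<\epsilon$. $\mathcal G_0^\epsilon(\beta,\gamma)$ is the completion (closure) of $\mathcal G(\epsilon,\epsilon)$ in $\mathcal G(\beta,\gamma)$ with the norm of $\mathcal G(\beta,\gamma)$. Distributions are the elements of the dual $(\mathcal G_0^\epsilon(\beta,\gamma))'$; functions act by integration against $\mu$. The grand maximal function of a distribution $h$ is $$h^*(x)=\sup\{|\langle h,\phi\rangle|:\phi\in\mathcal G_0^\epsilon(\beta,\gamma),\ \|\phi\|_{\mathcal G(x,r,\beta,\gamma)}\le1\text{ for some }r>0\}.$$ Spaces. $L^1(\mathcal X)=L^1(\mathcal X,\mu)$. $\mathcal H^p(\mathcal X)$ is the set of distributions $h$ with $h^*\in L^p(\mathcal X,\mu)$; $\mathcal H^p(\mathcal X,d,\tau)$ is the set of distributions $h$ with $h^*\in L^p(\mathcal X,\tau)$. For $\gamma'>0$, $\Lambda_{\gamma'}(\mathcal X)$ is the set of functions $f$ on $\mathcal X$ for which there is a constant $A$ with $|f(x)-f(y)|\le A\,\mu(B)^{\gamma'}$ for all $x,y$ and every ball $B$ containing both $x$ and $y$. For a ball $B$, $f_B=\frac1{\mu(B)}\int_Bf\,d\mu$.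 Atoms. A $(p,q)$-atom supported in a ball $B$ is a function $\mathfrak a\in L^q(\mathcal X,\mu)$ supported in $B$ with $\|\mathfrak a\|_{L^q}\le\mu(B)^{\frac1q-\frac1p}$ (with $1/q=0$ if $q=\infty$) and $\int\mathfrak a\,d\mu=0$. It is known that, for each $q\in(1,\infty]$, a distribution $g$ lies in $\mathcal H^p(\mathcal X)$ iff it has a decomposition $g=\sum\lambda_i\mathfrak a_i$ into $(p,q)$-atoms with $\sum|\lambda_i|^p<\infty$, converging in the sense of distributions. *)

theory Defs
  imports "HOL-Analysis.Analysis" "HOL-Probability.Essential_Supremum"
begin

section \<open>Spaces of homogeneous type\<close>

text \<open>The underlying set is a whole type; it carries no topology or metric of its own.\<close>

definition qball :: "('a \<Rightarrow> 'a \<Rightarrow> real) \<Rightarrow> 'a \<Rightarrow> real \<Rightarrow> 'a set" where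
  "qball d x r = {y. d x y < r}"

definition qballs :: "('a \<Rightarrow> 'a \<Rightarrow> real) \<Rightarrow> 'a set set" where
  "qballs d = {qball d x r | x r. r > 0}"

definition qopen :: "('a \<Rightarrow> 'a \<Rightarrow> real) \<Rightarrow> 'a set \<Rightarrow> bool" where
  "qopen d U \<longleftrightarrow> (\<forall>x\<in>U. \<exists>r>0. qball d x r \<subseteq> U)"

definition doubling_with :: "('a \<Rightarrow> 'a \<Rightarrow> real) \<Rightarrow> 'a measure \<Rightarrow> real \<Rightarrow> bool" where
  "doubling_with d M C \<longleftrightarrow>
     (\<forall>x. \<forall>r>0. measure M (qball d x (2 * r)) \<le> C * measure M (qball d x r))"

text \<open>
  In \<open>volume\<close>, positivity of the growth function \<open>g\<close> is required on \<open>(0, \<infinity>)\<close> only: by reverse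
  doubling \<open>\<mu>(B(x, r)) \<rightarrow> 0\<close> as \<open>r \<rightarrow> 0\<close>, which forces \<open>g 0 = 0\<close>. The sigma-algebra is the Borel
  one of the topology induced by \<open>d\<close>; balls belong to it because \<open>regularity\<close> makes them open.
\<close>

locale homogeneous_space =
  fixes d :: "'a \<Rightarrow> 'a \<Rightarrow> real" and M :: "'a measure" and K0 C0 \<theta> :: real
  assumes dist_nonneg: "\<And>x y. 0 \<le> d x y"
    and dist_eq_0: "\<And>x y. d x y = 0 \<longleftrightarrow> x = y"
    and dist_sym: "\<And>x y. d x y = d y x"
    and K0_ge_1: "K0 \<ge> 1"
    and quasi_triangle: "\<And>x y z. d x y \<le> K0 * (d x z + d z y)"
    and space_M: "space M = UNIV"
    and borel_sets: "sets M = sigma_sets UNIV {U. qopen d U}"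
    and ball_measure: "\<And>x r. r > 0 \<Longrightarrow>
          0 < emeasure M (qball d x r) \<and> emeasure M (qball d x r) < \<infinity>"
    and doubling: "doubling_with d M C0"
    and doubling_least: "\<And>C. doubling_with d M C \<Longrightarrow> C0 \<le> C"
    and annuli_nonempty: "\<And>x r R. 0 < r \<Longrightarrow> r < R \<Longrightarrow> qball d x R - qball d x r \<noteq> {}"
    and reverse_doubling: "\<exists>\<kappa>>0. \<exists>c>0. \<forall>x y r s. 0 < r \<longrightarrow> 0 < s \<longrightarrow>
          qball d y s \<subseteq> qball d x r \<longrightarrow>
          measure M (qball d x r) / measure M (qball d y s) \<ge> c * (r / s) powr \<kappa>"
    and volume: "\<exists>g :: real \<Rightarrow> real. mono_on {0..} g \<and> (\<forall>r>0. 0 < g r) \<and> 0 \<le> g 0 \<and>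
          (\<exists>c>0. \<exists>C>0. \<forall>x. \<forall>r>0.
             c * g r \<le> measure M (qball d x r) \<and> measure M (qball d x r) \<le> C * g r)"
    and theta: "0 < \<theta>" "\<theta> \<le> 1"
    and regularity: "\<exists>A>0. \<forall>x y z.
          \<bar>d x z - d y z\<bar> \<le> A * d x y powr \<theta> * (d x z + d y z) powr (1 - \<theta>)"

definition hom_dim :: "real \<Rightarrow> real" where
  "hom_dim C0 = log 2 C0"

section \<open>Test functions and distributions\<close>

definition test_bound ::
  "('a \<Rightarrow> 'a \<Rightarrow> real) \<Rightarrow> 'a measure \<Rightarrow> real \<Rightarrow> 'a \<Rightarrow> real \<Rightarrow> real \<Rightarrow> real \<Rightarrow> ('a \<Rightarrow> complex) \<Rightarrow> real \<Rightarrow> bool"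
where
  "test_bound d M K0 x1 r \<beta> \<gamma> \<phi> C \<longleftrightarrow>
     (\<forall>x. cmod (\<phi> x) \<le>
        C * (1 / measure M (qball d x (r + d x x1))) * (r / (r + d x1 x)) powr \<gamma>) \<and>
     (\<forall>x y. d x y \<le> (r + d x1 x) / (2 * K0) \<longrightarrow>
        cmod (\<phi> x - \<phi> y) \<le>
          C * (d x y / (r + d x1 x)) powr \<beta>
            * (1 / measure M (qball d x (r + d x x1))) * (r / (r + d x1 x)) powr \<gamma>)"

definition test_space ::
  "('a \<Rightarrow> 'a \<Rightarrow> real) \<Rightarrow> 'a measure \<Rightarrow> real \<Rightarrow> 'a \<Rightarrow> real \<Rightarrow> real \<Rightarrow> real \<Rightarrow> ('a \<Rightarrow> complex) set"
where
  "test_space d M K0 x1 r \<beta> \<gamma> = {\<phi>. \<exists>C. test_bound d M K0 x1 r \<beta> \<gamma> \<phi> C}"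

definition test_norm ::
  "('a \<Rightarrow> 'a \<Rightarrow> real) \<Rightarrow> 'a measure \<Rightarrow> real \<Rightarrow> 'a \<Rightarrow> real \<Rightarrow> real \<Rightarrow> real \<Rightarrow> ('a \<Rightarrow> complex) \<Rightarrow> real"
where
  "test_norm d M K0 x1 r \<beta> \<gamma> \<phi> = Inf {C. test_bound d M K0 x1 r \<beta> \<gamma> \<phi> C}"

definition test_closure ::
  "('a \<Rightarrow> 'a \<Rightarrow> real) \<Rightarrow> 'a measure \<Rightarrow> real \<Rightarrow> 'a \<Rightarrow> real \<Rightarrow> real \<Rightarrow> real \<Rightarrow> ('a \<Rightarrow> complex) set"
where
  "test_closure d M K0 x0 \<epsilon> \<beta> \<gamma> =
     {\<phi> \<in> test_space d M K0 x0 1 \<beta> \<gamma>. \<forall>e>0. \<exists>\<psi> \<in> test_space d M K0 x0 1 \<epsilon> \<epsilon>.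
        test_norm d M K0 x0 1 \<beta> \<gamma> (\<lambda>x. \<phi> x - \<psi> x) < e}"

text \<open>
  A functional is a total function whose values off \<open>test_closure\<close> are irrelevant, so equality
  of distributions is equality on \<open>test_closure\<close>.
\<close>

definition distributions ::
  "('a \<Rightarrow> 'a \<Rightarrow> real) \<Rightarrow> 'a measure \<Rightarrow> real \<Rightarrow> 'a \<Rightarrow> real \<Rightarrow> real \<Rightarrow> real \<Rightarrow> (('a \<Rightarrow> complex) \<Rightarrow> complex) set"
where
  "distributions d M K0 x0 \<epsilon> \<beta> \<gamma> =
     {h. (\<forall>\<phi> \<in> test_closure d M K0 x0 \<epsilon> \<beta> \<gamma>. \<forall>\<psi> \<in> test_closure d M K0 x0 \<epsilon> \<beta> \<gamma>.
            h (\<lambda>x. \<phi> x + \<psi> x) = h \<phi> + h \<psi>) \<and>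
         (\<forall>c. \<forall>\<phi> \<in> test_closure d M K0 x0 \<epsilon> \<beta> \<gamma>. h (\<lambda>x. c * \<phi> x) = c * h \<phi>) \<and>
         (\<exists>C. \<forall>\<phi> \<in> test_closure d M K0 x0 \<epsilon> \<beta> \<gamma>.
            cmod (h \<phi>) \<le> C * test_norm d M K0 x0 1 \<beta> \<gamma> \<phi>)}"

definition dist_of_fun :: "'a measure \<Rightarrow> ('a \<Rightarrow> complex) \<Rightarrow> ('a \<Rightarrow> complex) \<Rightarrow> complex" where
  "dist_of_fun M u \<phi> = (LINT x|M. u x * \<phi> x)"

definition acts_as_distribution ::
  "('a \<Rightarrow> 'a \<Rightarrow> real) \<Rightarrow> 'a measure \<Rightarrow> real \<Rightarrow> 'a \<Rightarrow> real \<Rightarrow> real \<Rightarrow> real \<Rightarrow> ('a \<Rightarrow> complex) \<Rightarrow> bool"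
where
  "acts_as_distribution d M K0 x0 \<epsilon> \<beta> \<gamma> u \<longleftrightarrow>
     (\<forall>\<phi> \<in> test_closure d M K0 x0 \<epsilon> \<beta> \<gamma>. integrable M (\<lambda>x. u x * \<phi> x)) \<and>
     dist_of_fun M u \<in> distributions d M K0 x0 \<epsilon> \<beta> \<gamma>"

definition sums_in_distributions ::
  "('a \<Rightarrow> 'a \<Rightarrow> real) \<Rightarrow> 'a measure \<Rightarrow> real \<Rightarrow> 'a \<Rightarrow> real \<Rightarrow> real \<Rightarrow> real \<Rightarrow>
     (nat \<Rightarrow> 'a \<Rightarrow> complex) \<Rightarrow> (('a \<Rightarrow> complex) \<Rightarrow> complex) \<Rightarrow> bool"
where
  "sums_in_distributions d M K0 x0 \<epsilon> \<beta> \<gamma> u T \<longleftrightarrow>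
     (\<forall>i. acts_as_distribution d M K0 x0 \<epsilon> \<beta> \<gamma> (u i)) \<and>
     T \<in> distributions d M K0 x0 \<epsilon> \<beta> \<gamma> \<and>
     (\<forall>\<phi> \<in> test_closure d M K0 x0 \<epsilon> \<beta> \<gamma>. (\<lambda>i. dist_of_fun M (u i) \<phi>) sums T \<phi>)"

section \<open>Hardy spaces and Lipschitz spaces\<close>

definition grand_maximal ::
  "('a \<Rightarrow> 'a \<Rightarrow> real) \<Rightarrow> 'a measure \<Rightarrow> real \<Rightarrow> 'a \<Rightarrow> real \<Rightarrow> real \<Rightarrow> real \<Rightarrow>
     (('a \<Rightarrow> complex) \<Rightarrow> complex) \<Rightarrow> 'a \<Rightarrow> ennreal"
where
  "grand_maximal d M K0 x0 \<epsilon> \<beta> \<gamma> h x =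
     (SUP \<phi> \<in> {\<phi> \<in> test_closure d M K0 x0 \<epsilon> \<beta> \<gamma>.
                 \<exists>r>0. \<phi> \<in> test_space d M K0 x r \<beta> \<gamma> \<and> test_norm d M K0 x r \<beta> \<gamma> \<phi> \<le> 1}.
        ennreal (cmod (h \<phi>)))"

text \<open>
  Membership in \<open>L\<^sup>p(N)\<close> of a function with values in \<open>[0, \<infinity>]\<close>, expressed by a finite upper
  integral of its \<open>p\<close>-th power. The grand maximal function is a supremum of uncountably many
  functions and need not be Borel measurable; for measurable functions the definition is the usual
  one, see \<open>in_Lp_measurable_iff\<close> below.
\<close>

definition in_Lp :: "'a measure \<Rightarrow> real \<Rightarrow> ('a \<Rightarrow> ennreal) \<Rightarrow> bool" where
  "in_Lp N p F \<longleftrightarrow>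
     (\<exists>w :: 'a \<Rightarrow> real. w \<in> borel_measurable N \<and> (\<forall>x. 0 \<le> w x) \<and>
        (AE x in N. F x \<le> ennreal (w x)) \<and> integrable N (\<lambda>x. w x powr p))"

lemma in_Lp_measurable_iff:
  assumes "F \<in> borel_measurable N" "p > 0"
  shows "in_Lp N p F \<longleftrightarrow>
    (AE x in N. F x < \<infinity>) \<and> integrable N (\<lambda>x. enn2real (F x) powr p)"
proof
  assume "in_Lp N p F"
  then obtain w where w: "w \<in> borel_measurable N" "\<And>x. 0 \<le> w x"
    "AE x in N. F x \<le> ennreal (w x)" "integrable N (\<lambda>x. w x powr p)"
    unfolding in_Lp_def by auto
  have "AE x in N. F x < \<infinity>"
    using w(3) by eventually_elim (auto simp: less_top[symmetric] top_unique)
  moreover have "integrable N (\<lambda>x. enn2real (F x) powr p)"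
  proof (rule Bochner_Integration.integrable_bound[OF w(4)])
    show "(\<lambda>x. enn2real (F x) powr p) \<in> borel_measurable N"
      using assms(1) by measurable
    show "AE x in N. norm (enn2real (F x) powr p) \<le> norm (w x powr p)"
      using w(3)
    proof eventually_elim
      case (elim x)
      have "enn2real (F x) \<le> w x"
        using elim w(2) by (simp add: enn2real_leI)
      then show ?case using assms(2) by (simp add: powr_mono2)
    qed
  qed
  ultimately show "(AE x in N. F x < \<infinity>) \<and> integrable N (\<lambda>x. enn2real (F x) powr p)" ..
next
  assume a: "(AE x in N. F x < \<infinity>) \<and> integrable N (\<lambda>x. enn2real (F x) powr p)"
  have "(\<lambda>x. enn2real (F x)) \<in> borel_measurable N"
    using assms(1) by measurable
  moreover have "AE x in N. F x \<le> ennreal (enn2real (F x))"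
    using a by (auto elim!: eventually_mono)
  ultimately show "in_Lp N p F"
    using a unfolding in_Lp_def by (intro exI[of _ "\<lambda>x. enn2real (F x)"]) auto
qed

text \<open>
  \<open>N\<close> is the measure with respect to which the grand maximal function is \<open>p\<close>-integrable;
  distributions and their maximal functions are always taken with respect to \<open>M\<close>.
\<close>

definition Hardy_space ::
  "('a \<Rightarrow> 'a \<Rightarrow> real) \<Rightarrow> 'a measure \<Rightarrow> real \<Rightarrow> 'a \<Rightarrow> real \<Rightarrow> real \<Rightarrow> real \<Rightarrow> real \<Rightarrow> 'a measure \<Rightarrow>
     (('a \<Rightarrow> complex) \<Rightarrow> complex) set"
where
  "Hardy_space d M K0 x0 \<epsilon> \<beta> \<gamma> p N =
     {h \<in> distributions d M K0 x0 \<epsilon> \<beta> \<gamma>. in_Lp N p (grand_maximal d M K0 x0 \<epsilon> \<beta> \<gamma> h)}"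

definition tau :: "('a \<Rightarrow> 'a \<Rightarrow> real) \<Rightarrow> 'a measure \<Rightarrow> real \<Rightarrow> real \<Rightarrow> 'a \<Rightarrow> real \<Rightarrow> 'a measure" where
  "tau d M K0 C0 x0 p =
     density M (\<lambda>x. ennreal (1 / (2 * K0\<^sup>2 + K0 * d x0 x) powr ((1 - p) * hom_dim C0)))"

definition L1_plus_Hardy ::
  "('a \<Rightarrow> 'a \<Rightarrow> real) \<Rightarrow> 'a measure \<Rightarrow> real \<Rightarrow> 'a \<Rightarrow> real \<Rightarrow> real \<Rightarrow> real \<Rightarrow> real \<Rightarrow> 'a measure \<Rightarrow>
     (('a \<Rightarrow> complex) \<Rightarrow> complex) set"
where
  "L1_plus_Hardy d M K0 x0 \<epsilon> \<beta> \<gamma> p N =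
     {T \<in> distributions d M K0 x0 \<epsilon> \<beta> \<gamma>.
        \<exists>u v. integrable M u \<and> acts_as_distribution d M K0 x0 \<epsilon> \<beta> \<gamma> u \<and>
          v \<in> Hardy_space d M K0 x0 \<epsilon> \<beta> \<gamma> p N \<and>
          (\<forall>\<phi> \<in> test_closure d M K0 x0 \<epsilon> \<beta> \<gamma>. T \<phi> = dist_of_fun M u \<phi> + v \<phi>)}"

definition Lipschitz_space ::
  "('a \<Rightarrow> 'a \<Rightarrow> real) \<Rightarrow> 'a measure \<Rightarrow> real \<Rightarrow> ('a \<Rightarrow> complex) set"
where
  "Lipschitz_space d M s =
     {f. \<exists>A. \<forall>B \<in> qballs d. \<forall>x\<in>B. \<forall>y\<in>B. cmod (f x - f y) \<le> A * measure M B powr s}"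

section \<open>Atoms\<close>

definition mean :: "'a measure \<Rightarrow> 'a set \<Rightarrow> ('a \<Rightarrow> complex) \<Rightarrow> complex" where
  "mean M B f = (LINT y:B|M. f y) / complex_of_real (measure M B)"

definition in_Lq :: "'a measure \<Rightarrow> ereal \<Rightarrow> ('a \<Rightarrow> complex) \<Rightarrow> bool" where
  "in_Lq M q u \<longleftrightarrow> u \<in> borel_measurable M \<and>
     (if q = \<infinity> then esssup M (\<lambda>x. ereal (cmod (u x))) < \<infinity>
      else integrable M (\<lambda>x. cmod (u x) powr real_of_ereal q))"

definition Lq_norm :: "'a measure \<Rightarrow> ereal \<Rightarrow> ('a \<Rightarrow> complex) \<Rightarrow> real" where
  "Lq_norm M q u =
     (if q = \<infinity> then real_of_ereal (esssup M (\<lambda>x. ereal (cmod (u x))))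
      else (LINT x|M. cmod (u x) powr real_of_ereal q) powr (1 / real_of_ereal q))"

text \<open>For \<open>q = \<infinity>\<close> the extended-real quotient \<open>1 / q\<close> is \<open>0\<close>.\<close>

definition atom :: "'a measure \<Rightarrow> real \<Rightarrow> ereal \<Rightarrow> 'a set \<Rightarrow> ('a \<Rightarrow> complex) \<Rightarrow> bool" where
  "atom M p q B a \<longleftrightarrow> in_Lq M q a \<and> (\<forall>x. x \<notin> B \<longrightarrow> a x = 0) \<and>
     Lq_norm M q a \<le> measure M B powr (real_of_ereal (1 / q) - 1 / p) \<and>
     (LINT x|M. a x) = 0"

text \<open>Series over \<open>i \<ge> 1\<close> are indexed from \<open>0\<close>.\<close>

definition atomic_decomposition ::
  "('a \<Rightarrow> 'a \<Rightarrow> real) \<Rightarrow> 'a measure \<Rightarrow> real \<Rightarrow> 'a \<Rightarrow> real \<Rightarrow> real \<Rightarrow> real \<Rightarrow> real \<Rightarrow> ereal \<Rightarrow>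
     (nat \<Rightarrow> complex) \<Rightarrow> (nat \<Rightarrow> 'a \<Rightarrow> complex) \<Rightarrow> (nat \<Rightarrow> 'a set) \<Rightarrow>
     (('a \<Rightarrow> complex) \<Rightarrow> complex) \<Rightarrow> bool"
where
  "atomic_decomposition d M K0 x0 \<epsilon> \<beta> \<gamma> p q l a B g \<longleftrightarrow>
     (\<forall>i. B i \<in> qballs d \<and> atom M p q (B i) (a i)) \<and>
     summable (\<lambda>i. cmod (l i) powr p) \<and>
     sums_in_distributions d M K0 x0 \<epsilon> \<beta> \<gamma> (\<lambda>i x. l i * a i x) g"

end

theory Submission
  imports Defs
begin

text \<open>
  Write \<open>s = 1/p - 1\<close> and \<open>V r = \<mu>(B(x\<^sub>0, r))\<close>; all balls of radius \<open>r\<close> have volume comparable to \<open>V r\<close>.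
  The terms \<open>(f - f\<^sub>B) a\<close> are bounded in \<open>L\<^sup>1\<close>. If the radius of \<open>B\<close> is small compared with
  \<open>R = 1 + d(x\<^sub>0, z)\<close>, \<open>z\<close> the centre, then \<open>f\<^sub>B\<close> is at most a constant times \<open>V R powr s\<close>, which the cancellation of
  the atom against a test function compensates because \<open>n s < \<beta>\<close>; otherwise \<open>f a\<close> itself is bounded
  in \<open>L\<^sup>1\<close>. Putting the whole product into \<open>L\<^sup>1\<close> for the latter balls leaves for the Hardy space only
  atoms on small balls. There the maximal function is controlled near the ball by the
  weak type (1,1) maximal inequality and Kolmogorov's argument, which needs \<open>p < 1\<close> but no \<open>L\<^sup>q\<close> theory, and
  away from it by cancellation, where the average of the density of \<open>\<tau>\<close> over \<open>B(z, T)\<close> is at most a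
  constant times \<open>V R powr (p - 1)\<close> for every \<open>T\<close>.

  The sum at \<open>\<phi>\<close> is \<open>\<Sum> \<lambda>\<^sub>i \<integral> a\<^sub>i f \<phi>\<close>, and \<open>f \<phi>\<close> satisfies the Lipschitz condition of order \<open>s\<close> and
  vanishes at infinity, but is not a test function. Truncating its values and regularizing by
  sup-convolution approximates it uniformly by test functions with bounded Lipschitz constants;
  since atoms are uniformly bounded on Lipschitz functions, the sum is a limit of values of \<open>g\<close>, hence
  independent of the decomposition.
\<close>

section \<open>Series, dyadic scales and the Vitali selection\<close>

text \<open>The exponents match because \<open>s * p = 1 - p\<close>. On a small ball the mean of
  \<open>f\<close> contributes at most a constant times \<open>V R powr s\<close>, which becomes
  \<open>V R powr (1 - p)\<close> after taking p-th powers; the p-th power of the maximal function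
  of an atom has \<tau>-integral at most a constant times \<open>V R powr (p - 1)\<close>. The
  product is bounded uniformly in the atom, so summability of \<open>cmod (l i) powr p\<close>
  suffices. The grand maximal function is a supremum over uncountably many test functions and is
  never integrated itself. For each atom a measurable majorant bounds the pairings with all
  admissible test functions at once, and since p is below 1 the majorants of p-th powers can simply
  be added. Volumes are not powers of radii: doubling bounds their growth by the exponent
  \<open>n\<close>, reverse doubling gives decay with some exponent \<kappa>. Dyadic sums then have
  ratio \<open>2 powr - \<alpha>\<close>, where \<alpha> is \<open>\<gamma>\<close> for the tails of
  test functions, \<open>1 - p\<close> for level sets, \<open>\<kappa> * p\<close> for the weight
  near the base point and \<open>(\<beta> - n * s) * p\<close> for the far part of an atom.\<close>

lemma small_powr:
  fixes a b e :: real
  assumes "a > 0" "e > 0" "b \<ge> 0"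
  shows "\<exists>r>0. \<forall>t. 0 \<le> t \<longrightarrow> t < r \<longrightarrow> b * t powr a < e"
proof (intro exI conjI allI impI)
  \<comment> \<open>Dividing by \<open>b + 1\<close> keeps the radius meaningful for
    \<open>b = 0\<close>.\<close>
  let ?r = "(e / (b + 1)) powr (1 / a)"
  show "?r > 0" using assms by simp
  fix t :: real assume t: "0 \<le> t" "t < ?r"
  have "t powr a < ?r powr a"
    using t assms by (intro powr_less_mono2) auto
  also have "?r powr a = e / (b + 1)"
    using assms by (simp add: powr_powr)
  finally have "(b + 1) * t powr a < e"
    using assms by (simp add: field_simps)
  moreover have "b * t powr a \<le> (b + 1) * t powr a"
    by (simp add: mult_right_mono)
  ultimately show "b * t powr a < e" by linarith
qed

text \<open>Lets inequalities that are linear in a constant pass to the infimum of all admissible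
  constants; a vanishing weight is treated apart because it cannot be divided by.\<close>

lemma le_Inf_mult:
  fixes S :: "real set"
  assumes "S \<noteq> {}" "bdd_below S" "\<And>C. C \<in> S \<Longrightarrow> a \<le> C * w" "0 \<le> w"
  shows "a \<le> Inf S * w"
proof (cases "w = 0")
  case True
  then show ?thesis using assms by auto
next
  case False
  then have "w > 0" using assms by simp
  have "a / w \<le> Inf S"
    using assms \<open>w > 0\<close> by (intro cInf_greatest) (auto simp: pos_divide_le_eq)
  then show ?thesis using \<open>w > 0\<close> by (simp add: pos_divide_le_eq)
qed

text \<open>Young's inequality with second factor 1. It gives the L1 bound of an atom pointwise, in
  place of Holder's inequality.\<close>

lemma le_powr_convex:
  fixes t q :: real
  assumes "0 \<le> t" "1 < q"
  shows "t \<le> t powr q / q + (1 - 1 / q)"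
proof -
  have "1 / (q / (q - 1)) = 1 - 1 / q" using assms by (simp add: diff_divide_distrib)
  moreover have "1 < q / (q - 1)" using assms by (simp add: less_divide_eq)
  moreover have "1 / q + 1 / (q / (q - 1)) = 1" using calculation(1) by simp
  ultimately show ?thesis
    using Youngs_inequality[of q "q / (q - 1)" t 1] assms by simp
qed

lemma two_powr_neg_less: "0 < a \<Longrightarrow> (2::real) powr - a < 1"
  using powr_less_mono[of "- a" 0 2] by simp

lemma two_power_powr: "(2 ^ k) powr a = (2 powr a) ^ k" for a :: real
  by (simp add: powr_realpow[symmetric] powr_powr mult.commute)

lemma powr_geometric: "(1 / 2 ^ k) powr a = (2 powr - a) ^ k" for a :: real
  by (simp add: two_power_powr powr_divide powr_minus power_inverse divide_inverse inverse_powr)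

text \<open>Each term is at most \<open>S powr (1 / p)\<close>, with \<open>S\<close> the sum of the
  p-th powers. Writing \<open>t i = t i powr p * t i powr (1 - p)\<close> and bounding the second
  factor gives domination by a multiple of the p-th power; after summation the powers of
  \<open>S\<close> combine to \<open>1 / p\<close>.\<close>

lemma summable_powr_le_1:
  fixes t :: "nat \<Rightarrow> real" and p :: real
  assumes p_pos: "0 < p" and p_lt: "p < 1" and t: "\<And>i. 0 \<le> t i" and s: "summable (\<lambda>i. t i powr p)"
  shows "summable t" "(\<Sum>i. t i) \<le> (\<Sum>i. t i powr p) powr (1 / p)"
proof -
  define S where "S = (\<Sum>i. t i powr p)"
  have S0: "0 \<le> S" unfolding S_def by (rule suminf_nonneg[OF s]) simp
  have le: "t i \<le> t i powr p * (S powr (1 / p)) powr (1 - p)" for i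
  proof -
    have "t i powr p \<le> S"
      unfolding S_def using sum_le_suminf[OF s, of "{i}"] by simp
    then have "(t i powr p) powr (1 / p) \<le> S powr (1 / p)" using p_pos by (intro powr_mono2) auto
    then have "t i \<le> S powr (1 / p)" using p_pos t[of i] by (simp add: powr_powr)
    then have "t i powr (1 - p) \<le> (S powr (1 / p)) powr (1 - p)" using p_lt t by (intro powr_mono2) auto
    then have "t i powr p * t i powr (1 - p) \<le> t i powr p * (S powr (1 / p)) powr (1 - p)"
      by (rule mult_left_mono) simp
    moreover have "t i powr p * t i powr (1 - p) = t i" using t[of i] by (simp add: powr_add[symmetric])
    ultimately show ?thesis by simp
  qed
  show sm: "summable t"
    using le t by (intro summable_comparison_test'[OF summable_mult2[OF s, of "(S powr (1 / p)) powr (1 - p)"]]) auto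
  have "(\<Sum>i. t i) \<le> (\<Sum>i. t i powr p * (S powr (1 / p)) powr (1 - p))"
    by (intro suminf_le le sm summable_mult2 s)
  also have "\<dots> = S * (S powr (1 / p)) powr (1 - p)"
    using suminf_mult2[OF s] by (simp add: S_def)
  also have "\<dots> = S powr (1 / p)"
  proof (cases "S = 0")
    case False
    then have "S * (S powr (1 / p)) powr (1 - p) = S powr (1 + (1 / p) * (1 - p))"
      using S0 by (simp add: powr_powr powr_add)
    also have "1 + (1 / p) * (1 - p) = 1 / p" using p_pos by (simp add: field_simps)
    finally show ?thesis .
  qed simp
  finally show "(\<Sum>i. t i) \<le> (\<Sum>i. t i powr p) powr (1 / p)" unfolding S_def .
qed

lemma suminf_geometric_le:
  fixes g :: "nat \<Rightarrow> ennreal"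
  assumes "0 \<le> c" "0 < \<alpha>" "\<And>k. g k \<le> ennreal (c * (2 powr - \<alpha>) ^ k)"
  shows "(\<Sum>k. g k) \<le> ennreal (c / (1 - 2 powr - \<alpha>))"
proof -
  let ?q = "2 powr - \<alpha> :: real"
  have q: "0 < ?q" "?q < 1" using assms(2) powr_less_mono[of "- \<alpha>" 0 2] by auto
  have s: "(\<lambda>k. c * ?q ^ k) sums (c * (1 / (1 - ?q)))"
    using q by (intro sums_mult geometric_sums) auto
  have "(\<Sum>k. g k) \<le> (\<Sum>k. ennreal (c * ?q ^ k))"
    using assms(3) by (intro suminf_le) auto
  also have "\<dots> = ennreal (\<Sum>k. c * ?q ^ k)"
    using s q assms(1) by (intro suminf_ennreal2) (auto simp: sums_iff)
  also have "(\<Sum>k. c * ?q ^ k) = c / (1 - ?q)"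
    using s by (simp add: sums_iff)
  finally show ?thesis .
qed

lemma le_suminf_ennreal: "g k \<le> (\<Sum>k. g k :: ennreal)"
  using sum_le_suminf[of g "{k}"] by simp

text \<open>The least admissible \<open>k\<close> works: if it is positive, the preceding dyadic
  value is at most \<open>t\<close>; the summand \<open>\<rho>\<close> on the right covers
  \<open>k = 0\<close>.\<close>

lemma dyadic_above:
  fixes \<rho> t :: real
  assumes "0 < \<rho>" "0 \<le> t"
  shows "\<exists>k::nat. t < 2 ^ k * \<rho> \<and> 2 ^ k * \<rho> \<le> 2 * (\<rho> + t)"
proof -
  have ex: "\<exists>k. t < 2 ^ k * \<rho>"
    using real_arch_pow[of 2 "t / \<rho>"] assms by (auto simp: pos_divide_less_eq)
  define k where "k = (LEAST k. t < 2 ^ k * \<rho>)"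
  have k: "t < 2 ^ k * \<rho>" unfolding k_def by (rule LeastI_ex[OF ex])
  moreover have "2 ^ k * \<rho> \<le> 2 * (\<rho> + t)"
  proof (cases k)
    case 0
    then show ?thesis using assms by simp
  next
    case (Suc j)
    then have "\<not> t < 2 ^ j * \<rho>" using not_less_Least[of j "\<lambda>k. t < 2 ^ k * \<rho>"] by (simp add: k_def)
    then show ?thesis using Suc assms by simp
  qed
  ultimately show ?thesis by blast
qed

lemma dyadic_below:
  fixes h T :: real
  assumes "0 < h" "h < T"
  shows "\<exists>k::nat. h \<le> T / 2 ^ k \<and> T / 2 ^ k \<le> 2 * h"
proof -
  define k where "k = (LEAST k::nat. T < 2 ^ Suc k * h)"
  have ex: "\<exists>k::nat. T < 2 ^ Suc k * h"
  proof -
    obtain k where "T / h < 2 ^ k" using real_arch_pow[of 2 "T / h"] by auto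
    then have "T < 2 ^ k * h" using assms by (simp add: pos_divide_less_eq)
    also have "\<dots> \<le> 2 ^ Suc k * h" using assms by simp
    finally show ?thesis by blast
  qed
  have k: "T < 2 ^ Suc k * h" unfolding k_def by (rule LeastI_ex[OF ex])
  have "2 ^ k * h \<le> T"
  proof (cases k)
    case 0
    then show ?thesis using assms by simp
  next
    case (Suc j)
    then show ?thesis using not_less_Least[of j "\<lambda>k. T < 2 ^ Suc k * h"] by (simp add: k_def)
  qed
  then have "h \<le> T / 2 ^ k" by (simp add: pos_le_divide_eq mult.commute)
  moreover have "T / 2 ^ k \<le> 2 * h" using k by (simp add: pos_divide_le_eq mult_ac)
  ultimately show ?thesis by blast
qed

text \<open>Zorn's lemma replaces a greedy choice by size, which would need a largest radius. The
  factor 2 is the price for choosing a radius above half of a supremum that may not be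
  attained.\<close>

lemma vitali_selection:
  fixes S :: "'i \<Rightarrow> 'b set" and r :: "'i \<Rightarrow> real"
  assumes r: "\<And>i. i \<in> F \<Longrightarrow> 0 < r i" "\<And>i. i \<in> F \<Longrightarrow> r i \<le> R" and ne: "\<And>i. i \<in> F \<Longrightarrow> S i \<noteq> {}"
  shows "\<exists>W\<subseteq>F. pairwise (\<lambda>i j. disjnt (S i) (S j)) W \<and>
    (\<forall>i\<in>F. \<exists>j\<in>W. \<not> disjnt (S i) (S j) \<and> r i \<le> 2 * r j)"
proof -
  \<comment> \<open>The invariant constrains only indices that already meet \<open>W\<close>. Hence
    the empty family has it and it survives unions of chains, while maximality will force every
    index to meet \<open>W\<close>.\<close>
  define P where "P = {W. W \<subseteq> F \<and> pairwise (\<lambda>i j. disjnt (S i) (S j)) W \<and>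
    (\<forall>i\<in>F. (\<exists>j\<in>W. \<not> disjnt (S i) (S j)) \<longrightarrow> (\<exists>j\<in>W. \<not> disjnt (S i) (S j) \<and> r i \<le> 2 * r j))}"
  have "{} \<in> P" by (simp add: P_def)
  moreover have "\<Union>\<C> \<in> P" if "\<C> \<noteq> {}" "subset.chain P \<C>" for \<C>
  proof -
    have sub: "\<C> \<subseteq> P" and chain: "\<And>X Y. X \<in> \<C> \<Longrightarrow> Y \<in> \<C> \<Longrightarrow> X \<subseteq> Y \<or> Y \<subseteq> X"
      using that(2) by (auto simp: subset.chain_def)
    have "pairwise (\<lambda>i j. disjnt (S i) (S j)) (\<Union>\<C>)"
    proof (rule pairwiseI)
      fix i j assume "i \<in> \<Union>\<C>" "j \<in> \<Union>\<C>" "i \<noteq> j"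
      then obtain X Y where XY: "X \<in> \<C>" "i \<in> X" "Y \<in> \<C>" "j \<in> Y" by blast
      have "\<exists>X\<in>\<C>. i \<in> X \<and> j \<in> X"
      proof (cases "X \<subseteq> Y")
        case False
        then have "Y \<subseteq> X" using chain[OF XY(1,3)] by blast
        then show ?thesis using XY by blast
      qed (use XY in blast)
      then obtain X where "X \<in> \<C>" "i \<in> X" "j \<in> X" by blast
      then show "disjnt (S i) (S j)"
        using sub \<open>i \<noteq> j\<close> by (auto simp: P_def pairwise_def)
    qed
    moreover have "\<exists>j\<in>\<Union>\<C>. \<not> disjnt (S i) (S j) \<and> r i \<le> 2 * r j"
      if i: "i \<in> F" "j' \<in> \<Union>\<C>" "\<not> disjnt (S i) (S j')" for i j'
    proof -
      obtain X where X: "X \<in> \<C>" "j' \<in> X" using i(2) by blast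
      then have "X \<in> P" using sub by blast
      then have "\<exists>j\<in>X. \<not> disjnt (S i) (S j) \<and> r i \<le> 2 * r j"
        using i X(2) unfolding P_def by blast
      then show ?thesis using X(1) by blast
    qed
    moreover have "\<Union>\<C> \<subseteq> F" using sub by (auto simp: P_def)
    ultimately show ?thesis unfolding P_def by blast
  qed
  ultimately obtain W where W: "W \<in> P" and max: "\<And>X. X \<in> P \<Longrightarrow> W \<subseteq> X \<Longrightarrow> X = W"
    using subset_Zorn_nonempty[of P] by blast
  have meet: "\<exists>j\<in>W. \<not> disjnt (S i) (S j)" if "i \<in> F" for i
  proof (rule ccontr)
    assume no: "\<not> (\<exists>j\<in>W. \<not> disjnt (S i) (S j))"
    \<comment> \<open>\<open>N\<close> collects the indices that miss all of \<open>W\<close>. One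
      of them with radius above half the supremum over \<open>N\<close> can be added without
      breaking the invariant, since every other member of \<open>N\<close> has at most twice its
      radius. By maximality it was in \<open>W\<close> already, so its set is disjoint from itself,
      hence empty.\<close>
    define N where "N = {i \<in> F. \<forall>j\<in>W. disjnt (S i) (S j)}"
    have "i \<in> N" using no that by (simp add: N_def)
    have bdd: "bdd_above (r ` N)" using r(2) by (intro bdd_aboveI[of _ R]) (auto simp: N_def)
    have "r i \<le> Sup (r ` N)" using \<open>i \<in> N\<close> bdd by (intro cSup_upper) auto
    then have "Sup (r ` N) / 2 < Sup (r ` N)" using r(1)[OF that] by simp
    moreover have "r ` N \<noteq> {}" using \<open>i \<in> N\<close> by auto
    ultimately have "\<exists>y\<in>r ` N. Sup (r ` N) / 2 < y" by (intro less_cSupD)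
    then obtain k where k: "k \<in> N" "Sup (r ` N) / 2 < r k" by blast
    have half: "r i' \<le> 2 * r k" if "i' \<in> N" for i'
    proof -
      have "r i' \<le> Sup (r ` N)" using that bdd by (intro cSup_upper) auto
      then show ?thesis using k(2) by linarith
    qed
    have "insert k W \<in> P"
      unfolding P_def
    proof (intro CollectI conjI ballI impI)
      show "insert k W \<subseteq> F" using W k(1) by (auto simp: P_def N_def)
      show "pairwise (\<lambda>i j. disjnt (S i) (S j)) (insert k W)"
        using W k(1) by (auto simp: P_def N_def pairwise_insert disjnt_sym)
      fix i' assume i': "i' \<in> F" "\<exists>j\<in>insert k W. \<not> disjnt (S i') (S j)"
      show "\<exists>j\<in>insert k W. \<not> disjnt (S i') (S j) \<and> r i' \<le> 2 * r j"
      proof (cases "i' \<in> N")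
        case True
        then have "\<not> disjnt (S i') (S k)" using i'(2) by (auto simp: N_def)
        then show ?thesis using half[OF True] by blast
      next
        case False
        then have "\<exists>j\<in>W. \<not> disjnt (S i') (S j)" using i'(1) by (auto simp: N_def)
        then show ?thesis using W i'(1) by (auto simp: P_def)
      qed
    qed
    then have "k \<in> W" using max[of "insert k W"] by blast
    then have "S k = {}" using k(1) by (auto simp: N_def disjnt_def)
    then show False using ne k(1) by (auto simp: N_def)
  qed
  show ?thesis
  proof (intro exI conjI ballI)
    show "W \<subseteq> F" "pairwise (\<lambda>i j. disjnt (S i) (S j)) W" using W by (auto simp: P_def)
    show "\<exists>j\<in>W. \<not> disjnt (S i) (S j) \<and> r i \<le> 2 * r j" if "i \<in> F" for i
      using W meet[OF that] that by (simp add: P_def)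
  qed
qed

section \<open>Geometry of balls\<close>

context homogeneous_space
begin

lemma dist_self [simp]: "d x x = 0"
  by (simp add: dist_eq_0)

lemma dist_pos: "x \<noteq> y \<Longrightarrow> 0 < d x y"
  using dist_nonneg[of x y] dist_eq_0[of x y] by linarith

lemma mem_qball [simp]: "y \<in> qball d x r \<longleftrightarrow> d x y < r"
  by (simp add: qball_def)

abbreviation vol :: "'a \<Rightarrow> real \<Rightarrow> real" where "vol x r \<equiv> measure M (qball d x r)"

lemma ball_measure_pos: "r > 0 \<Longrightarrow> 0 < vol x r"
  using ball_measure[of r x] by (simp add: measure_def enn2real_positive_iff less_top)

lemma emeasure_ball: "r > 0 \<Longrightarrow> emeasure M (qball d x r) = ennreal (vol x r)"
  using ball_measure[of r x] by (simp add: emeasure_eq_ennreal_measure less_top)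

lemma regularity_constant:
  obtains A where "A > 0" and "\<And>x y z R. d x z \<le> R \<Longrightarrow> d y z \<le> R \<Longrightarrow>
    \<bar>d x z - d y z\<bar> \<le> A * d x y powr \<theta> * (2 * R) powr (1 - \<theta>)"
proof -
  obtain A where A: "A > 0" "\<And>x y z. \<bar>d x z - d y z\<bar> \<le> A * d x y powr \<theta> * (d x z + d y z) powr (1 - \<theta>)"
    using regularity by blast
  show thesis
  proof (rule that[OF A(1)])
    fix x y z R assume R: "d x z \<le> R" "d y z \<le> R"
    have "(d x z + d y z) powr (1 - \<theta>) \<le> (2 * R) powr (1 - \<theta>)"
      using R theta dist_nonneg by (intro powr_mono2) auto
    then show "\<bar>d x z - d y z\<bar> \<le> A * d x y powr \<theta> * (2 * R) powr (1 - \<theta>)"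
      using A(1) by (intro order_trans[OF A(2)] mult_left_mono) auto
  qed
qed

section \<open>Measurability of functions continuous with respect to \<open>d\<close>, and of
  balls\<close>

lemma qopen_superlevel:
  assumes "\<And>x e. e > 0 \<Longrightarrow> \<exists>r>0. \<forall>y. d x y < r \<longrightarrow> dist (h x) (h y) < e" and "open (S :: 'b::metric_space set)"
  shows "qopen d (h -` S)"
  unfolding qopen_def
proof
  fix x assume "x \<in> h -` S"
  then obtain e where "e > 0" "ball (h x) e \<subseteq> S"
    using \<open>open S\<close> openE by blast
  moreover obtain r where "r > 0" "\<forall>y. d x y < r \<longrightarrow> dist (h x) (h y) < e"
    using assms(1) \<open>e > 0\<close> by blast
  ultimately show "\<exists>r>0. qball d x r \<subseteq> h -` S"
    by (intro exI[of _ r]) (auto simp: subset_iff)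
qed

lemma qopen_sets: "qopen d U \<Longrightarrow> U \<in> sets M"
  by (simp add: borel_sets sigma_sets.Basic)

lemma continuous_measurable:
  fixes h :: "'a \<Rightarrow> 'b::metric_space"
  assumes "\<And>x e. e > 0 \<Longrightarrow> \<exists>r>0. \<forall>y. d x y < r \<longrightarrow> dist (h x) (h y) < e"
  shows "h \<in> borel_measurable M"
proof (rule borel_measurableI)
  fix S :: "'b set" assume "open S"
  then have "qopen d (h -` S)" by (intro qopen_superlevel assms) auto
  then show "h -` S \<inter> space M \<in> sets M"
    by (simp add: space_M qopen_sets)
qed

text \<open>The quasi-triangle inequality alone does not make \<open>d x\<close> continuous; the
  regularity condition does, by a local Holder estimate of order \<open>\<theta>\<close>.
  Measurability of balls rests on this.\<close>

lemma dist_measurable [measurable]: "d x \<in> borel_measurable M"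
proof (rule continuous_measurable)
  fix y and e :: real assume e: "e > 0"
  obtain A where A: "A > 0" "\<And>x y z R. d x z \<le> R \<Longrightarrow> d y z \<le> R \<Longrightarrow>
    \<bar>d x z - d y z\<bar> \<le> A * d x y powr \<theta> * (2 * R) powr (1 - \<theta>)"
    using regularity_constant by blast
  \<comment> \<open>Bounds the distances of \<open>y\<close> and \<open>z\<close> from
    \<open>x\<close> simultaneously while \<open>z\<close> stays within distance 1 of
    \<open>y\<close>.\<close>
  define R where "R = K0 * (1 + d y x)"
  obtain r where r: "r > 0" "\<And>t. 0 \<le> t \<Longrightarrow> t < r \<Longrightarrow> (A * (2 * R) powr (1 - \<theta>)) * t powr \<theta> < e"
    using small_powr[of \<theta> e "A * (2 * R) powr (1 - \<theta>)"] theta A e by auto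
  show "\<exists>r>0. \<forall>z. d y z < r \<longrightarrow> dist (d x y) (d x z) < e"
  proof (intro exI conjI allI impI)
    show "min r 1 > 0" using r by simp
    fix z assume z: "d y z < min r 1"
    have "d z x \<le> K0 * (d z y + d y x)" by (rule quasi_triangle)
    also have "\<dots> \<le> R" unfolding R_def using z K0_ge_1 by (intro mult_left_mono) (auto simp: dist_sym)
    finally have 1: "d z x \<le> R" .
    have "1 * d y x \<le> R" unfolding R_def using K0_ge_1 dist_nonneg[of y x] by (intro mult_mono) auto
    then have 2: "d y x \<le> R" by simp
    have "\<bar>d y x - d z x\<bar> \<le> A * d y z powr \<theta> * (2 * R) powr (1 - \<theta>)"
      by (rule A(2)[OF 2 1])
    also have "\<dots> < e" using r(2)[of "d y z"] z dist_nonneg[of y z] by (simp add: mult_ac)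
    finally show "dist (d x y) (d x z) < e"
      by (simp add: dist_real_def dist_sym)
  qed
qed

lemma qball_sets [measurable]: "qball d x r \<in> sets M"
proof -
  have "{y \<in> space M. d x y < r} \<in> sets M" by measurable
  then show ?thesis by (simp add: qball_def space_M)
qed

lemma ball_measure_mono: "0 < R \<Longrightarrow> qball d x r \<subseteq> qball d y R \<Longrightarrow> vol x r \<le> vol y R"
  using ball_measure[of R y] by (intro measure_mono_fmeasurable) (auto simp: fmeasurable_def)

lemma ball_measure_mono_radius: "r \<le> R \<Longrightarrow> vol x r \<le> vol x R"
proof (cases "R > 0")
  case True
  then show "r \<le> R \<Longrightarrow> ?thesis" by (intro ball_measure_mono) (auto simp: qball_def)
next
  case False
  then have "r \<le> R \<Longrightarrow> qball d x r = {}"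
    by (auto simp: qball_def not_less intro: order_trans[OF _ dist_nonneg])
  then show "r \<le> R \<Longrightarrow> ?thesis" by simp
qed

lemma qball_triangle: "d x y < r \<Longrightarrow> d x z < r \<Longrightarrow> d y z < 2 * K0 * r"
proof -
  assume a: "d x y < r" "d x z < r"
  have "d y z \<le> K0 * (d y x + d x z)" by (rule quasi_triangle)
  also have "\<dots> < K0 * (r + r)" using a K0_ge_1 by (intro mult_strict_left_mono) (auto simp: dist_sym)
  finally show ?thesis by simp
qed

lemma C0_ge_1: "1 \<le> C0"
proof -
  have "vol undefined 1 \<le> vol undefined (2 * 1)"
    by (rule ball_measure_mono_radius) simp
  also have "\<dots> \<le> C0 * vol undefined 1"
    using doubling unfolding doubling_with_def by (meson zero_less_one)
  finally show ?thesis using ball_measure_pos[of 1 undefined] by simp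
qed

lemma hom_dim_nonneg: "0 \<le> hom_dim C0"
  using C0_ge_1 by (simp add: hom_dim_def)

text \<open>Iterated doubling: with \<open>k\<close> the integer part of
  \<open>log 2 (R / r)\<close>, the factor \<open>C0 ^ k\<close> equals
  \<open>(2 ^ k) powr hom_dim C0\<close>, and one further \<open>C0\<close> pays for rounding up to
  \<open>R\<close>.\<close>

lemma measure_growth:
  assumes "0 < r" "r \<le> R"
  shows "vol x R \<le> C0 * (R / r) powr hom_dim C0 * vol x r"
proof -
  obtain k where k: "of_nat k \<le> log 2 (R / r)" "log 2 (R / r) < of_nat (Suc k)"
  proof -
    have "0 \<le> log 2 (R / r)" using assms by simp
    then show thesis
      by (intro that[of "nat \<lfloor>log 2 (R / r)\<rfloor>"]) (auto simp: nat_floor_neg, linarith)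
  qed
  have it: "vol x (2 ^ j * r) \<le> C0 ^ j * vol x r" for j
  proof (induction j)
    case (Suc j)
    have "vol x (2 ^ Suc j * r) = vol x (2 * (2 ^ j * r))"
      by (simp add: mult_ac)
    also have "\<dots> \<le> C0 * vol x (2 ^ j * r)"
      using doubling assms(1) unfolding doubling_with_def by (metis mult_pos_pos zero_less_numeral zero_less_power)
    also have "\<dots> \<le> C0 * (C0 ^ j * vol x r)"
      using Suc C0_ge_1 by (intro mult_left_mono) auto
    finally show ?case by (simp add: mult_ac)
  qed simp
  have "R / r < 2 powr (of_nat (Suc k))"
    using k(2) assms by (simp add: log_less_iff)
  then have "R \<le> 2 ^ Suc k * r"
    using assms by (subst (asm) powr_realpow) (auto simp: field_simps)
  then have "vol x R \<le> C0 ^ Suc k * vol x r"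
    using it[of "Suc k"] ball_measure_mono_radius by (meson order_trans)
  also have "C0 ^ k \<le> (R / r) powr hom_dim C0"
  proof -
    have "C0 ^ k = (2 powr hom_dim C0) powr of_nat k"
      using C0_ge_1 by (simp add: hom_dim_def powr_realpow)
    also have "\<dots> = (2 powr of_nat k) powr hom_dim C0"
      by (simp add: powr_powr mult.commute)
    also have "\<dots> \<le> (R / r) powr hom_dim C0"
      using k(1) assms hom_dim_nonneg by (intro powr_mono2) (auto simp: le_log_iff)
    finally show ?thesis .
  qed
  then have "C0 ^ Suc k * vol x r \<le> C0 * (R / r) powr hom_dim C0 * vol x r"
    using C0_ge_1 by (intro mult_right_mono) auto
  finally show ?thesis .
qed

end

section \<open>Fixed constants and the volume function of the base point\<close>

locale based_space = homogeneous_space d M K0 C0 \<theta>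
  for d :: "'a \<Rightarrow> 'a \<Rightarrow> real" and M :: "'a measure" and K0 C0 \<theta> :: real +
  fixes x0 :: 'a and cv \<kappa> cr Ar :: real
  assumes cv_ge_1: "1 \<le> cv"
    and comparable: "\<And>x y r. measure M (qball d x r) \<le> cv * measure M (qball d y r)"
    and kappa_pos: "0 < \<kappa>" and cr_pos: "0 < cr"
    and reverse: "\<And>r R. 0 < r \<Longrightarrow> r \<le> R \<Longrightarrow>
      measure M (qball d x0 r) \<le> cr * (r / R) powr \<kappa> * measure M (qball d x0 R)"
    and Ar_pos: "0 < Ar"
    and dist_holder: "\<And>x y z R. d x z \<le> R \<Longrightarrow> d y z \<le> R \<Longrightarrow>
      \<bar>d x z - d y z\<bar> \<le> Ar * d x y powr \<theta> * (2 * R) powr (1 - \<theta>)"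

text \<open>Volumes of equal radii are compared through the growth function, whose two-sided bounds
  give the ratio \<open>C / c\<close>; the maximum with 1 serves \<open>cv_ge_1\<close>. Nonpositive
  radii are included because both balls are then empty.\<close>

lemma (in homogeneous_space) based_space_exists:
  "\<exists>cv \<kappa> cr Ar. based_space d M K0 C0 \<theta> x0 cv \<kappa> cr Ar"
proof -
  obtain g :: "real \<Rightarrow> real" and c C where g: "\<forall>r>0. 0 < g r" and c: "c > 0" "C > 0"
    and gb: "\<And>x r. r > 0 \<Longrightarrow> c * g r \<le> vol x r \<and> vol x r \<le> C * g r"
    using volume by blast
  have cmp: "vol x r \<le> max 1 (C / c) * vol y r" for x y r
  proof (cases "r > 0")
    case True
    have "vol x r \<le> (C / c) * (c * g r)"
      using gb[OF True, of x] c by simp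
    also have "\<dots> \<le> max 1 (C / c) * vol y r"
    proof (intro mult_mono)
      show "c * g r \<le> vol y r" using gb[OF True, of y] by simp
      show "0 \<le> c * g r" using c(1) g True by (intro mult_nonneg_nonneg) (auto intro: less_imp_le)
    qed auto
    finally show ?thesis .
  next
    case False
    then have "qball d x r = {}" by (auto simp: qball_def not_less intro: order_trans[OF _ dist_nonneg])
    then show ?thesis by simp
  qed
  obtain \<kappa> cc where k: "\<kappa> > 0" "cc > 0" and rd: "\<And>x y r s. 0 < r \<Longrightarrow> 0 < s \<Longrightarrow>
          qball d y s \<subseteq> qball d x r \<Longrightarrow>
          vol x r / vol y s \<ge> cc * (r / s) powr \<kappa>"
    using reverse_doubling by blast
  have rev: "vol x0 r \<le> (1 / cc) * (r / R) powr \<kappa> * vol x0 R"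
    if r: "0 < r" "r \<le> R" for r R
  proof -
    have "cc * (R / r) powr \<kappa> \<le> vol x0 R / vol x0 r"
      using r by (intro rd) (auto simp: qball_def)
    then have "cc * (R / r) powr \<kappa> * vol x0 r \<le> vol x0 R"
      using ball_measure_pos[OF r(1)] by (simp add: pos_le_divide_eq)
    then have "vol x0 r \<le> vol x0 R / (cc * (R / r) powr \<kappa>)"
      using k r by (subst pos_le_divide_eq) (auto simp: mult_ac)
    also have "1 / (R / r) powr \<kappa> = (r / R) powr \<kappa>"
      using r by (simp add: powr_divide)
    then have "vol x0 R / (cc * (R / r) powr \<kappa>) = (1 / cc) * (r / R) powr \<kappa> * vol x0 R"
      by (metis (no_types) divide_divide_eq_left times_divide_eq_left mult.commute mult_1 times_divide_times_eq mult.right_neutral)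
    finally show ?thesis .
  qed
  obtain A where A: "A > 0" "\<And>x y z R. d x z \<le> R \<Longrightarrow> d y z \<le> R \<Longrightarrow>
    \<bar>d x z - d y z\<bar> \<le> A * d x y powr \<theta> * (2 * R) powr (1 - \<theta>)"
    using regularity_constant by blast
  have "based_space d M K0 C0 \<theta> x0 (max 1 (C / c)) \<kappa> (1 / cc) A"
    by unfold_locales (use cmp rev A k in auto)
  then show ?thesis by blast
qed

context based_space
begin

definition V :: "real \<Rightarrow> real" where "V r = vol x0 r"

lemma V_pos: "r > 0 \<Longrightarrow> 0 < V r"
  by (simp add: V_def ball_measure_pos)

lemma V_nonneg [simp]: "0 \<le> V r"
  by (simp add: V_def)

lemma V_nonpos [simp]: "r \<le> 0 \<Longrightarrow> V r = 0"
proof -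
  assume "r \<le> 0"
  then have "qball d x0 r = {}" by (auto simp: qball_def not_less intro: order_trans[OF _ dist_nonneg])
  then show ?thesis by (simp add: V_def)
qed

lemma V_mono: "r \<le> R \<Longrightarrow> V r \<le> V R"
  unfolding V_def by (rule ball_measure_mono_radius)

lemma ball_le_V: "vol x r \<le> cv * V r"
  unfolding V_def by (rule comparable)

lemma V_le_ball: "V r \<le> cv * vol x r"
  unfolding V_def by (rule comparable)

lemma V_growth: "0 < r \<Longrightarrow> r \<le> R \<Longrightarrow> V R \<le> C0 * (R / r) powr hom_dim C0 * V r"
  unfolding V_def by (rule measure_growth)

lemma V_reverse: "0 < r \<Longrightarrow> r \<le> R \<Longrightarrow> V r \<le> cr * (r / R) powr \<kappa> * V R"
  unfolding V_def by (rule reverse)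

lemma V_scale: "1 \<le> l \<Longrightarrow> V (l * r) \<le> C0 * l powr hom_dim C0 * V r"
  using V_growth[of r "l * r"] by (cases "r > 0") (auto simp: not_less mult_nonneg_nonpos)

lemma cv_pos: "0 < cv" using cv_ge_1 by simp

lemma inverse_ball_le: "r > 0 \<Longrightarrow> 1 / vol x r \<le> cv / V r"
  using V_le_ball[of r x] V_pos[of r] ball_measure_pos[of r x] by (simp add: field_simps)

end

section \<open>Test functions and distributions\<close>

locale hardy_setting = based_space +
  fixes \<epsilon> \<beta> \<gamma> p :: real
  assumes eps: "0 < \<epsilon>" "\<epsilon> \<le> \<theta>"
    and p_gt: "hom_dim C0 / (hom_dim C0 + \<epsilon>) < p" and p_lt: "p < 1"
    and beta: "hom_dim C0 * (1 / p - 1) < \<beta>" "\<beta> < \<epsilon>"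
    and gamma: "hom_dim C0 * (1 / p - 1) < \<gamma>" "\<gamma> < \<epsilon>"
begin

abbreviation n :: real where "n \<equiv> hom_dim C0"

definition s :: real where "s = 1 / p - 1"

abbreviation "TC \<equiv> test_closure d M K0 x0 \<epsilon> \<beta> \<gamma>"
abbreviation "act \<equiv> dist_of_fun M"
abbreviation "dists \<equiv> distributions d M K0 x0 \<epsilon> \<beta> \<gamma>"
abbreviation "gmax \<equiv> grand_maximal d M K0 x0 \<epsilon> \<beta> \<gamma>"
abbreviation "product_space \<equiv> L1_plus_Hardy d M K0 x0 \<epsilon> \<beta> \<gamma> p (tau d M K0 C0 x0 p)"
abbreviation "dsums \<equiv> sums_in_distributions d M K0 x0 \<epsilon> \<beta> \<gamma>"
abbreviation "unit_test x \<rho> \<phi> \<equiv> test_bound d M K0 x \<rho> \<beta> \<gamma> \<phi> 1"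
abbreviation "nrm \<equiv> test_norm d M K0 x0 1 \<beta> \<gamma>"

definition rad :: "'a \<Rightarrow> real" where "rad x = 1 + d x0 x"

lemma p_pos: "0 < p"
  using p_gt hom_dim_nonneg eps by (metis add_nonneg_pos divide_nonneg_pos le_less_trans)

lemma s_pos: "0 < s"
  using p_pos p_lt by (simp add: s_def field_simps)

lemma ns_nonneg: "0 \<le> n * s" and ns_beta: "n * s < \<beta>" and ns_gamma: "n * s < \<gamma>"
  using beta gamma hom_dim_nonneg s_pos by (auto simp: s_def)

lemma beta_pos: "0 < \<beta>" and gamma_pos: "0 < \<gamma>" and ns_lt_theta: "n * s < \<theta>" and beta_lt_1: "\<beta> < 1"
  using ns_nonneg ns_beta ns_gamma beta eps theta by linarith+

lemma rad_ge_1: "1 \<le> rad x"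
  using dist_nonneg by (simp add: rad_def)

lemma rad_pos: "0 < rad x"
  using rad_ge_1[of x] by linarith

section \<open>Norms and pointwise bounds of test functions\<close>

lemma test_bound_nonneg:
  assumes "r > 0" "test_bound d M K0 x1 r b g \<phi> C"
  shows "0 \<le> C"
proof -
  have "cmod (\<phi> x1) \<le> C * (1 / vol x1 r)"
    using assms unfolding test_bound_def by (auto dest: spec[of _ x1])
  then have "0 \<le> C * (1 / vol x1 r)"
    using norm_ge_zero order_trans by blast
  then show ?thesis
    using ball_measure_pos[OF assms(1), of x1] by (simp add: zero_le_divide_iff)
qed

text \<open>All defining inequalities are linear in the constant with nonnegative weights, and the
  constants are bounded below by 0, so the infimum is itself admissible.\<close>

lemma test_norm_attained:
  assumes "r > 0" "\<phi> \<in> test_space d M K0 x1 r b g"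
  shows "test_bound d M K0 x1 r b g \<phi> (test_norm d M K0 x1 r b g \<phi>)"
proof -
  let ?S = "{C. test_bound d M K0 x1 r b g \<phi> C}"
  have S: "?S \<noteq> {}" "bdd_below ?S"
    using assms test_bound_nonneg by (auto simp: test_space_def intro!: bdd_belowI[of _ 0])
  show ?thesis
    unfolding test_norm_def
  proof (subst test_bound_def, unfold mult.assoc, intro conjI allI impI)
    fix x
    show "cmod (\<phi> x) \<le> Inf ?S * (1 / vol x (r + d x x1) * (r / (r + d x1 x)) powr g)"
      using S by (intro le_Inf_mult) (auto simp: test_bound_def mult.assoc)
    fix y assume "d x y \<le> (r + d x1 x) / (2 * K0)"
    then show "cmod (\<phi> x - \<phi> y) \<le> Inf ?S * ((d x y / (r + d x1 x)) powr b *
      (1 / vol x (r + d x x1) * (r / (r + d x1 x)) powr g))"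
      using S by (intro le_Inf_mult) (auto simp: test_bound_def mult.assoc)
  qed
qed

lemma test_norm_nonneg:
  "r > 0 \<Longrightarrow> \<phi> \<in> test_space d M K0 x1 r b g \<Longrightarrow> 0 \<le> test_norm d M K0 x1 r b g \<phi>"
  using test_bound_nonneg test_norm_attained by blast

lemma closure_test_space: "\<phi> \<in> TC \<Longrightarrow> \<phi> \<in> test_space d M K0 x0 1 \<beta> \<gamma>"
  by (simp add: test_closure_def)

lemma nrm_nonneg: "\<phi> \<in> TC \<Longrightarrow> 0 \<le> nrm \<phi>"
  using closure_test_space test_norm_nonneg by simp

lemma test_decay:
  assumes "\<phi> \<in> TC"
  shows "cmod (\<phi> x) \<le> nrm \<phi> * (cv / V (rad x)) * rad x powr - \<gamma>"
proof -
  have "cmod (\<phi> x) \<le> nrm \<phi> * (1 / vol x (rad x)) * (1 / rad x) powr \<gamma>"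
    using test_norm_attained[OF _ closure_test_space[OF assms], unfolded test_bound_def, THEN conjunct1, rule_format, of x]
    by (simp add: rad_def dist_sym[of x x0])
  also have "\<dots> \<le> nrm \<phi> * (cv / V (rad x)) * (1 / rad x) powr \<gamma>"
    using inverse_ball_le rad_pos nrm_nonneg[OF assms] by (intro mult_right_mono mult_left_mono) auto
  also have "(1 / rad x) powr \<gamma> = rad x powr - \<gamma>"
    using rad_pos[of x] by (simp add: powr_divide powr_minus_divide)
  finally show ?thesis .
qed

text \<open>The decay factor of order \<open>\<gamma>\<close> is discarded: where oscillation is
  used, the gain of order \<open>\<beta>\<close> is what compensates the growth of
  \<open>f\<close>.\<close>

lemma test_oscillation:
  assumes "\<phi> \<in> TC" "d x y \<le> rad x / (2 * K0)"
  shows "cmod (\<phi> x - \<phi> y) \<le> nrm \<phi> * (cv / V (rad x)) * (d x y / rad x) powr \<beta>"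
proof -
  have "cmod (\<phi> x - \<phi> y) \<le> nrm \<phi> * (d x y / rad x) powr \<beta> *
      (1 / vol x (rad x)) * (1 / rad x) powr \<gamma>"
    using test_norm_attained[OF _ closure_test_space[OF assms(1)], unfolded test_bound_def, THEN conjunct2, rule_format, of x y] assms(2)
    by (simp add: rad_def dist_sym[of x x0])
  also have "\<dots> \<le> nrm \<phi> * (d x y / rad x) powr \<beta> * (cv / V (rad x)) * 1"
  proof (intro mult_mono mult_left_mono)
    show "1 / vol x (rad x) \<le> cv / V (rad x)"
      by (rule inverse_ball_le[OF rad_pos])
    show "(1 / rad x) powr \<gamma> \<le> 1"
      using rad_ge_1[of x] gamma_pos by (intro powr_le1) auto
  qed (use nrm_nonneg[OF assms(1)] cv_pos in auto)
  finally show ?thesis by (simp add: mult_ac)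
qed

lemma cv_div_V_le: "cv / V (rad x) \<le> cv / V 1"
  using V_mono[OF rad_ge_1] V_pos[of 1] cv_pos by (intro divide_left_mono) (auto intro: mult_pos_pos less_le_trans)

lemma test_sup:
  assumes "\<phi> \<in> TC"
  shows "cmod (\<phi> x) \<le> nrm \<phi> * (cv / V 1)"
proof -
  have "cmod (\<phi> x) \<le> nrm \<phi> * (cv / V (rad x)) * rad x powr - \<gamma>"
    by (rule test_decay[OF assms])
  also have "\<dots> \<le> nrm \<phi> * (cv / V 1) * 1"
  proof (intro mult_mono)
    show "cv / V (rad x) \<le> cv / V 1" by (rule cv_div_V_le)
    show "rad x powr - \<gamma> \<le> 1"
      using powr_mono[of "- \<gamma>" 0 "rad x"] rad_ge_1[of x] gamma_pos by simp
  qed (use nrm_nonneg[OF assms] cv_pos in auto)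
  finally show ?thesis by simp
qed

lemma test_measurable:
  assumes "\<phi> \<in> TC"
  shows "\<phi> \<in> borel_measurable M"
proof (rule continuous_measurable)
  fix x and e :: real assume "e > 0"
  let ?b = "nrm \<phi> * (cv / V (rad x)) / rad x powr \<beta>"
  obtain r where r: "r > 0" "\<And>t. 0 \<le> t \<Longrightarrow> t < r \<Longrightarrow> ?b * t powr \<beta> < e"
    using small_powr[OF beta_pos \<open>e > 0\<close>, of ?b] nrm_nonneg[OF assms] cv_pos by auto
  show "\<exists>r>0. \<forall>y. d x y < r \<longrightarrow> dist (\<phi> x) (\<phi> y) < e"
  proof (intro exI conjI allI impI)
    show "min r (rad x / (2 * K0)) > 0" using r rad_pos[of x] K0_ge_1 by simp
    fix y assume y: "d x y < min r (rad x / (2 * K0))"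
    have "cmod (\<phi> x - \<phi> y) \<le> ?b * d x y powr \<beta>"
      using test_oscillation[OF assms, of x y] y rad_pos[of x] by (simp add: powr_divide dist_nonneg)
    also have "\<dots> < e" using r(2) y dist_nonneg by simp
    finally show "dist (\<phi> x) (\<phi> y) < e" by (simp add: dist_norm)
  qed
qed

section \<open>Integrable functions and series of them as distributions\<close>

lemma integrable_mult_test:
  assumes "integrable M u" "\<phi> \<in> TC"
  shows "integrable M (\<lambda>x. u x * \<phi> x)"
proof (rule Bochner_Integration.integrable_bound)
  show "integrable M (\<lambda>x. (nrm \<phi> * (cv / V 1)) *\<^sub>R u x)" using assms(1) by simp
  show "(\<lambda>x. u x * \<phi> x) \<in> borel_measurable M"
    using assms test_measurable by (intro borel_measurable_times) auto
  show "AE x in M. norm (u x * \<phi> x) \<le> norm ((nrm \<phi> * (cv / V 1)) *\<^sub>R u x)"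
  proof (rule AE_I2)
    fix x
    have "cmod (\<phi> x) * cmod (u x) \<le> \<bar>nrm \<phi> * (cv / V 1)\<bar> * cmod (u x)"
      using test_sup[OF assms(2), of x] by (intro mult_right_mono order_trans[OF _ abs_ge_self]) auto
    then show "norm (u x * \<phi> x) \<le> norm ((nrm \<phi> * (cv / V 1)) *\<^sub>R u x)"
      by (simp add: norm_mult mult.commute)
  qed
qed

lemma dist_of_fun_bound:
  assumes "integrable M u" "\<phi> \<in> TC"
  shows "cmod (act u \<phi>) \<le> cv / V 1 * (LINT x|M. cmod (u x)) * nrm \<phi>"
proof -
  have "cmod (act u \<phi>) \<le> (LINT x|M. cmod (u x * \<phi> x))"
    unfolding dist_of_fun_def by (rule integral_norm_bound)
  also have "\<dots> \<le> (LINT x|M. cmod (u x) * (nrm \<phi> * (cv / V 1)))"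
  proof (rule integral_mono)
    show "integrable M (\<lambda>x. cmod (u x * \<phi> x))"
      using integrable_mult_test[OF assms] by (rule integrable_norm)
    show "cmod (u x * \<phi> x) \<le> cmod (u x) * (nrm \<phi> * (cv / V 1))" for x
      unfolding norm_mult by (intro mult_left_mono test_sup assms norm_ge_zero)
  qed (use assms(1) in simp)
  finally show ?thesis by (simp add: mult_ac)
qed

lemma integrable_acts:
  assumes "integrable M u"
  shows "acts_as_distribution d M K0 x0 \<epsilon> \<beta> \<gamma> u"
  unfolding acts_as_distribution_def distributions_def
proof (intro conjI ballI CollectI allI)
  show "integrable M (\<lambda>x. u x * \<phi> x)" if "\<phi> \<in> TC" for \<phi>
    by (rule integrable_mult_test[OF assms that])
  show "act u (\<lambda>x. \<phi> x + \<psi> x) = act u \<phi> + act u \<psi>"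
    if "\<phi> \<in> TC" "\<psi> \<in> TC" for \<phi> \<psi>
    using integrable_mult_test[OF assms] that by (simp add: dist_of_fun_def distrib_left)
  show "act u (\<lambda>x. c * \<phi> x) = c * act u \<phi>" if "\<phi> \<in> TC" for \<phi> c
    using integrable_mult_test[OF assms that] by (simp add: dist_of_fun_def mult.left_commute[of _ c])
  show "\<exists>C. \<forall>\<phi>\<in>TC. cmod (act u \<phi>) \<le> C * nrm \<phi>"
    using dist_of_fun_bound[OF assms] by blast
qed

text \<open>Bounds \<open>K i * nrm \<phi>\<close> with summable \<open>K\<close> give absolute
  convergence and continuity of the sum at the same time, so no uniform boundedness principle is
  invoked.\<close>

lemma distribution_sum:
  assumes u: "\<And>i. integrable M (u i)"
    and K: "\<And>i \<phi>. \<phi> \<in> TC \<Longrightarrow> cmod (act (u i) \<phi>) \<le> K i * nrm \<phi>" "summable K"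
  shows "dsums u (\<lambda>\<phi>. \<Sum>i. act (u i) \<phi>)"
proof -
  let ?T = "\<lambda>\<phi>. \<Sum>i. act (u i) \<phi>"
  have s: "summable (\<lambda>i. cmod (act (u i) \<phi>))" if "\<phi> \<in> TC" for \<phi>
    using K(1)[OF that] by (intro summable_comparison_test'[OF summable_mult2[OF K(2), of "nrm \<phi>"]]) auto
  have sums: "(\<lambda>i. act (u i) \<phi>) sums ?T \<phi>" if "\<phi> \<in> TC" for \<phi>
    by (rule summable_sums[OF summable_norm_cancel[OF s[OF that]]])
  have acts: "act (u i) \<in> dists" for i
    using integrable_acts[OF u] by (simp add: acts_as_distribution_def)
  have "?T \<in> dists"
    unfolding distributions_def
  proof (intro CollectI conjI ballI allI)
    fix \<phi> \<psi> assume a: "\<phi> \<in> TC" "\<psi> \<in> TC"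
    then have "(\<lambda>i. act (u i) (\<lambda>x. \<phi> x + \<psi> x)) = (\<lambda>i. act (u i) \<phi> + act (u i) \<psi>)"
      using acts by (auto simp: distributions_def)
    then show "?T (\<lambda>x. \<phi> x + \<psi> x) = ?T \<phi> + ?T \<psi>"
      using sums_add[OF sums[OF a(1)] sums[OF a(2)]] by (simp add: sums_iff)
  next
    fix c \<phi> assume a: "\<phi> \<in> TC"
    then have "(\<lambda>i. act (u i) (\<lambda>x. c * \<phi> x)) = (\<lambda>i. c * act (u i) \<phi>)"
      using acts by (auto simp: distributions_def)
    then show "?T (\<lambda>x. c * \<phi> x) = c * ?T \<phi>"
      using sums_mult[OF sums[OF a], of c] by (simp add: sums_iff)
  next
    show "\<exists>C. \<forall>\<phi>\<in>TC. cmod (?T \<phi>) \<le> C * nrm \<phi>"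
    proof (intro exI ballI)
      fix \<phi> assume a: "\<phi> \<in> TC"
      have "cmod (?T \<phi>) \<le> (\<Sum>i. cmod (act (u i) \<phi>))"
        by (rule summable_norm[OF s[OF a]])
      also have "\<dots> \<le> (\<Sum>i. K i * nrm \<phi>)"
        by (intro suminf_le K a s summable_mult2)
      finally show "cmod (?T \<phi>) \<le> (\<Sum>i. K i) * nrm \<phi>"
        using suminf_mult2[OF K(2)] by simp
    qed
  qed
  then show ?thesis
    unfolding sums_in_distributions_def using integrable_acts[OF u] sums by blast
qed

text \<open>After division by the height \<open>K = m powr - (1 / p)\<close>, Young's inequality
  bounds the atom on its ball by \<open>1 / r'\<close> times its \<open>r'\<close>-th power plus
  \<open>1 - 1 / r'\<close>. The normalization of the atom makes the two integrals add up to at most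
  \<open>m\<close>, and \<open>K * m = m powr - s\<close>. The bound does not depend on
  \<open>q\<close>, which is why different \<open>q\<close> can be mixed later.\<close>

lemma atom_L1:
  assumes a: "atom M p q B a" and q: "1 < q" and B: "B = qball d z r" "r > 0"
  shows "integrable M a" "(LINT x|M. cmod (a x)) \<le> measure M B powr - s"
proof -
  define m where "m = measure M B"
  have m: "m > 0" using B ball_measure_pos by (simp add: m_def)
  have [measurable]: "a \<in> borel_measurable M" "B \<in> sets M"
    using a B by (auto simp: atom_def in_Lq_def)
  have fin: "emeasure M B < \<infinity>" using B ball_measure by simp
  have supp: "\<And>x. x \<notin> B \<Longrightarrow> a x = 0" using a by (simp add: atom_def)
  \<comment> \<open>The essential supremum allowed to an atom for \<open>q = \<infinity>\<close>; it
    serves as reference height for every \<open>q\<close>.\<close>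
  define K where "K = m powr (- (1 / p))"
  have Kpos: "K > 0" using m by (simp add: K_def)
  have iB: "integrable M (indicator B :: 'a \<Rightarrow> real)"
    using fin by (simp add: integrable_indicator_iff)
  have Ks: "K * m = m powr - s"
    using m powr_add[of m "- (1 / p)" 1] by (simp add: K_def s_def)
  have "\<exists>h. integrable M h \<and> (AE x in M. cmod (a x) \<le> h x) \<and> (LINT x|M. h x) \<le> K * m"
  proof (cases "q = \<infinity>")
    case True
    let ?e = "esssup M (\<lambda>x. ereal (cmod (a x)))"
    have "?e < \<infinity>" "real_of_ereal ?e \<le> K"
      using a True m by (auto simp: atom_def in_Lq_def Lq_norm_def K_def m_def)
    moreover have "AE x in M. ereal (cmod (a x)) \<le> ?e" by (rule esssup_AE)
    ultimately have "AE x in M. cmod (a x) \<le> K * indicator B x"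
    proof -
      assume e: "?e < \<infinity>" "real_of_ereal ?e \<le> K" and ae: "AE x in M. ereal (cmod (a x)) \<le> ?e"
      show ?thesis
        using ae
      proof eventually_elim
        case (elim x)
        have "cmod (a x) \<le> real_of_ereal ?e"
          using elim e(1) by (cases ?e) auto
        then show ?case using e(2) supp by (cases "x \<in> B") auto
      qed
    qed
    then show ?thesis
      using iB by (intro exI[of _ "\<lambda>x. K * indicator B x"]) (auto simp: m_def)
  next
    case False
    then obtain r' where r': "q = ereal r'" "1 < r'"
      using q by (cases q) auto
    have int: "integrable M (\<lambda>x. cmod (a x) powr r')"
      and N: "(LINT x|M. cmod (a x) powr r') powr (1 / r') \<le> m powr (1 / r' - 1 / p)"
      using a r' by (auto simp: atom_def in_Lq_def Lq_norm_def m_def one_ereal_def)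
    let ?I = "LINT x|M. cmod (a x) powr r'"
    have I0: "0 \<le> ?I" by simp
    have "?I = (?I powr (1 / r')) powr r'" using r' I0 by (simp add: powr_powr)
    also have "\<dots> \<le> (m powr (1 / r' - 1 / p)) powr r'"
      using N r' by (intro powr_mono2) auto
    also have "\<dots> = m * K powr r'"
      using r' m by (simp add: powr_powr K_def powr_add[symmetric] powr_mult_base algebra_simps)
    finally have I: "?I \<le> m * K powr r'" .
    let ?h = "\<lambda>x. K * (cmod (a x) powr r' / K powr r' / r' + (1 - 1 / r') * indicator B x)"
    have "cmod (a x) \<le> ?h x" for x
    proof (cases "x \<in> B")
      case True
      have "cmod (a x) = K * (cmod (a x) / K)" using Kpos by simp
      also have "\<dots> \<le> K * ((cmod (a x) / K) powr r' / r' + (1 - 1 / r'))"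
        using Kpos r' by (intro mult_left_mono le_powr_convex) auto
      also have "\<dots> = ?h x" using True Kpos by (simp add: powr_divide)
      finally show ?thesis .
    qed (simp add: supp)
    moreover have "integrable M ?h" using int iB by (intro integrable_mult_right Bochner_Integration.integrable_add) auto
    moreover have "(LINT x|M. ?h x) \<le> K * m"
    proof -
      have "(LINT x|M. ?h x) = K * (?I / K powr r' / r' + (1 - 1 / r') * m)"
        using int iB by (simp add: m_def)
      also have "\<dots> \<le> K * (m / r' + (1 - 1 / r') * m)"
        using I Kpos r' by (intro mult_left_mono add_right_mono divide_right_mono) (auto simp: pos_divide_le_eq)
      also have "\<dots> = K * m" using r' by (simp add: field_simps)
      finally show ?thesis .
    qed
    ultimately show ?thesis by (intro exI[of _ ?h]) auto
  qed
  then obtain h where h: "integrable M h" "AE x in M. cmod (a x) \<le> h x" "(LINT x|M. h x) \<le> K * m"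
    by blast
  show int: "integrable M a"
    using h by (intro Bochner_Integration.integrable_bound[OF h(1)]) auto
  have "(LINT x|M. cmod (a x)) \<le> (LINT x|M. h x)"
    using h int by (intro integral_mono_AE) auto
  then show "(LINT x|M. cmod (a x)) \<le> measure M B powr - s"
    using h(3) Ks by (simp add: m_def)
qed

end

section \<open>Products of Lipschitz functions with atoms\<close>

context hardy_setting
begin

text \<open>By comparability of ball volumes this is the condition of \<open>Lipschitz_space\<close> for the
  exponent \<open>s\<close>; note that \<open>V 0 = 0\<close>.\<close>

definition lip :: "('a \<Rightarrow> 'b::real_normed_vector) \<Rightarrow> real \<Rightarrow> bool" where
  "lip \<psi> A \<longleftrightarrow> (\<forall>x y. norm (\<psi> x - \<psi> y) \<le> A * V (d x y) powr s)"

text \<open>The doubling factor of \<open>V r powr s\<close> when the radius is multiplied by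
  \<open>l\<close>.\<close>

definition kap :: "real \<Rightarrow> real" where "kap l = (C0 * l powr n) powr s"

lemma kap_pos: "0 < l \<Longrightarrow> 0 < kap l"
  using C0_ge_1 by (simp add: kap_def)

lemma V_powr_mono: "r \<le> R \<Longrightarrow> V r powr s \<le> V R powr s"
  using V_mono s_pos by (intro powr_mono2) auto

lemma V_powr_scale: "1 \<le> l \<Longrightarrow> V (l * r) powr s \<le> kap l * V r powr s"
proof -
  assume "1 \<le> l"
  then have "V (l * r) powr s \<le> (C0 * l powr n * V r) powr s"
    using V_scale s_pos by (intro powr_mono2) auto
  also have "\<dots> = kap l * V r powr s"
    unfolding kap_def using C0_ge_1 by (subst powr_mult) auto
  finally show ?thesis .
qed

lemma V_powr_le: "1 \<le> l \<Longrightarrow> R \<le> l * r \<Longrightarrow> V R powr s \<le> kap l * V r powr s"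
  using V_powr_scale V_powr_mono order_trans by blast

lemma kap_eq: "0 < l \<Longrightarrow> kap l = C0 powr s * l powr (n * s)"
  using C0_ge_1 by (simp add: kap_def powr_mult powr_powr)

text \<open>The oscillation of a Lipschitz function on a ball is of size \<open>V r powr s\<close>,
  the L1 norm of an atom there at most \<open>vol z r powr - s\<close>. Their product stays bounded:
  this is the duality between atoms and the Lipschitz space.\<close>

lemma V_ball_powr: "r > 0 \<Longrightarrow> V r powr s * vol z r powr - s \<le> cv powr s"
proof -
  assume r: "r > 0"
  have "V r powr s \<le> (cv * vol z r) powr s"
    using V_le_ball s_pos by (intro powr_mono2) auto
  also have "\<dots> = cv powr s * vol z r powr s"
    using cv_pos by (simp add: powr_mult)
  finally show ?thesis
    using ball_measure_pos[OF r, of z] by (simp add: powr_minus field_simps)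
qed

text \<open>Reverse doubling makes \<open>V (d x y)\<close> tend to 0 like a power of the distance,
  so the condition implies continuity.\<close>

lemma lip_measurable:
  fixes \<psi> :: "'a \<Rightarrow> 'b::real_normed_vector"
  assumes "lip \<psi> A"
  shows "\<psi> \<in> borel_measurable M"
proof (rule continuous_measurable)
  fix x and e :: real assume "e > 0"
  let ?b = "\<bar>A\<bar> * (cr * V 1) powr s"
  obtain r where r: "r > 0" "\<And>t. 0 \<le> t \<Longrightarrow> t < r \<Longrightarrow> ?b * t powr (\<kappa> * s) < e"
    using small_powr[of "\<kappa> * s" e ?b] kappa_pos s_pos \<open>e > 0\<close> by auto
  show "\<exists>r>0. \<forall>y. d x y < r \<longrightarrow> dist (\<psi> x) (\<psi> y) < e"
  proof (intro exI conjI allI impI)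
    show "min r 1 > 0" using r by simp
    fix y assume y: "d x y < min r 1"
    have "V (d x y) \<le> cr * V 1 * d x y powr \<kappa>"
      using V_reverse[of "d x y" 1] y dist_nonneg[of x y] by (cases "d x y = 0") (auto simp: mult_ac)
    then have "V (d x y) powr s \<le> (cr * V 1 * d x y powr \<kappa>) powr s"
      using s_pos by (intro powr_mono2) auto
    also have "\<dots> = (cr * V 1) powr s * d x y powr (\<kappa> * s)"
      using cr_pos by (subst powr_mult) (auto simp: powr_powr)
    finally have V: "V (d x y) powr s \<le> (cr * V 1) powr s * d x y powr (\<kappa> * s)" .
    have "norm (\<psi> x - \<psi> y) \<le> A * V (d x y) powr s" using assms by (simp add: lip_def)
    also have "\<dots> \<le> \<bar>A\<bar> * V (d x y) powr s" by (intro mult_right_mono) auto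
    also have "\<dots> \<le> \<bar>A\<bar> * ((cr * V 1) powr s * d x y powr (\<kappa> * s))"
      by (intro mult_left_mono V) auto
    also have "\<dots> = ?b * d x y powr (\<kappa> * s)" by (simp only: mult.assoc)
    also have "\<dots> < e" using r(2) y dist_nonneg by simp
    finally show "dist (\<psi> x) (\<psi> y) < e" by (simp add: dist_norm)
  qed
qed

lemma lip_ball:
  assumes "lip \<psi> A" "0 \<le> A" "d z x < r" "d z y < r"
  shows "norm (\<psi> x - \<psi> y) \<le> A * kap (2 * K0) * V r powr s"
proof -
  have "norm (\<psi> x - \<psi> y) \<le> A * V (d x y) powr s" using assms by (simp add: lip_def)
  also have "\<dots> \<le> A * (kap (2 * K0) * V r powr s)"
    using qball_triangle[OF assms(3,4)] K0_ge_1 assms(2) by (intro mult_left_mono V_powr_le) auto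
  finally show ?thesis by (simp add: mult.assoc)
qed

lemma Lipschitz_space_lip:
  assumes "f \<in> Lipschitz_space d M s"
  shows "\<exists>A\<ge>0. lip f A"
proof -
  obtain A where A: "\<And>B x y. B \<in> qballs d \<Longrightarrow> x \<in> B \<Longrightarrow> y \<in> B \<Longrightarrow> cmod (f x - f y) \<le> A * measure M B powr s"
    using assms by (auto simp: Lipschitz_space_def)
  define A' where "A' = max A 0"
  have "lip f (A' * (cv powr s * kap 2))"
    unfolding lip_def
  proof (intro allI)
    fix x y
    show "cmod (f x - f y) \<le> A' * (cv powr s * kap 2) * V (d x y) powr s"
    proof (cases "x = y")
      case True
      then show ?thesis by simp
    next
      case False
      then have pos: "d x y > 0" by (rule dist_pos)
      \<comment> \<open>Balls are open, so a radius larger than \<open>d x y\<close> is needed for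
        \<open>y\<close> to belong.\<close>
      let ?B = "qball d x (2 * d x y)"
      have "?B \<in> qballs d" using pos by (auto simp: qballs_def intro!: exI[of _ x] exI[of _ "2 * d x y"])
      then have "cmod (f x - f y) \<le> A * measure M ?B powr s"
        using pos by (intro A) auto
      also have "\<dots> \<le> A' * measure M ?B powr s" by (intro mult_right_mono) (auto simp: A'_def)
      also have "\<dots> \<le> A' * (cv * V (2 * d x y)) powr s"
        using ball_le_V s_pos by (intro mult_left_mono powr_mono2) (auto simp: A'_def)
      also have "\<dots> = A' * (cv powr s * V (2 * d x y) powr s)"
        using cv_pos by (simp add: powr_mult)
      also have "\<dots> \<le> A' * (cv powr s * (kap 2 * V (d x y) powr s))"
        by (intro mult_left_mono V_powr_scale) (auto simp: A'_def)
      finally show ?thesis by (simp add: mult_ac)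
    qed
  qed
  moreover have "0 \<le> A' * (cv powr s * kap 2)" using kap_pos[of 2] by (simp add: A'_def)
  ultimately show ?thesis by blast
qed

lemma atom_mult_bound:
  assumes a: "atom M p q (qball d z r) a" "1 < q" "r > 0"
    and h: "h \<in> borel_measurable M" "\<And>x. d z x < r \<Longrightarrow> cmod (h x) \<le> K" "0 \<le> K"
  shows "integrable M (\<lambda>x. h x * a x)"
    and "(LINT x|M. cmod (h x * a x)) \<le> K * vol z r powr - s"
proof -
  note aL = atom_L1[OF a(1,2) refl a(3)]
  have supp: "a x = 0" if "\<not> d z x < r" for x using a(1) that by (auto simp: atom_def)
  have le: "cmod (h x * a x) \<le> K * cmod (a x)" for x
    using h(2)[of x] supp[of x] by (cases "d z x < r") (auto simp: norm_mult intro: mult_right_mono)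
  show int: "integrable M (\<lambda>x. h x * a x)"
  proof (rule Bochner_Integration.integrable_bound)
    show "integrable M (\<lambda>x. K * cmod (a x))" using aL by simp
    show "(\<lambda>x. h x * a x) \<in> borel_measurable M" using aL(1) h(1) by measurable
    show "AE x in M. norm (h x * a x) \<le> norm (K * cmod (a x))"
      using le h(3) by simp
  qed
  have "(LINT x|M. cmod (h x * a x)) \<le> (LINT x|M. K * cmod (a x))"
    using int aL le by (intro integral_mono) auto
  also have "\<dots> \<le> K * vol z r powr - s"
    using aL(2) h(3) by (simp add: mult_left_mono)
  finally show "(LINT x|M. cmod (h x * a x)) \<le> K * vol z r powr - s" .
qed

text \<open>The vanishing integral of the atom allows \<open>h z\<close> to be subtracted, so that
  only the oscillation of \<open>h\<close> on the ball enters and not its size.\<close>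

lemma atom_cancel:
  assumes a: "atom M p q (qball d z r) a" "1 < q" "r > 0"
    and h: "h \<in> borel_measurable M" "\<And>x. d z x < r \<Longrightarrow> cmod (h z - h x) \<le> K" "0 \<le> K"
  shows "cmod (LINT x|M. a x * h x) \<le> K * vol z r powr - s"
proof -
  note aL = atom_L1[OF a(1,2) refl a(3)]
  have h': "(\<lambda>x. h x - h z) \<in> borel_measurable M" "\<And>x. d z x < r \<Longrightarrow> cmod (h x - h z) \<le> K"
    using h(1,2) by (auto simp: norm_minus_commute)
  note b = atom_mult_bound[OF a h' h(3)]
  have "(LINT x|M. a x * h x) = (LINT x|M. (h x - h z) * a x + h z * a x)"
    by (simp add: algebra_simps)
  also have "\<dots> = (LINT x|M. (h x - h z) * a x) + (LINT x|M. h z * a x)"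
    using b(1) aL(1) by (intro Bochner_Integration.integral_add) auto
  also have "(LINT x|M. h z * a x) = 0" using a(1) by (simp add: atom_def)
  finally have "cmod (LINT x|M. a x * h x) \<le> (LINT x|M. cmod ((h x - h z) * a x))"
    using integral_norm_bound by simp
  with b(2) show ?thesis by linarith
qed

text \<open>A ball is called small if its radius is small compared with the distance of its centre from
  the base point; on small balls the cancellation of atoms is exploited, on the other ones their size.\<close>

definition small :: "'a \<Rightarrow> real \<Rightarrow> bool" where "small z r \<longleftrightarrow> 4 * K0\<^sup>2 * r \<le> rad z"

lemma small_le: "small z r \<Longrightarrow> r > 0 \<Longrightarrow> r \<le> rad z / (2 * K0)"
proof -
  assume a: "small z r" "r > 0"
  have "2 * K0 * r \<le> 4 * K0\<^sup>2 * r"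
    using a(2) K0_ge_1 by (intro mult_right_mono) (auto simp: power2_eq_square)
  also have "\<dots> \<le> rad z" using a(1) by (simp only: small_def)
  finally have "2 * K0 * r \<le> rad z" .
  then show ?thesis using K0_ge_1 by (simp add: field_simps)
qed

lemma small_le_rad: "small z r \<Longrightarrow> r > 0 \<Longrightarrow> r \<le> rad z"
proof -
  assume "small z r" "r > 0"
  then have "r \<le> rad z / (2 * K0)" by (rule small_le)
  also have "\<dots> \<le> rad z" using K0_ge_1 rad_pos[of z] by (simp add: field_simps)
  finally show ?thesis .
qed

text \<open>Passing from radius \<open>r\<close> to \<open>R\<close> costs
  \<open>(R / r) powr (n * s)\<close> by doubling, and the factor
  \<open>(r / R) powr \<beta>\<close> outweighs this because \<open>n * s < \<beta>\<close>.\<close>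

lemma small_V:
  assumes "0 < r" "r \<le> R"
  shows "(r / R) powr \<beta> * V R powr s \<le> C0 powr s * V r powr s"
proof -
  have R: "0 < R" using assms by linarith
  have "(r / R) powr \<beta> * kap (R / r) = C0 powr s * ((r / R) powr \<beta> * (R / r) powr (n * s))"
    using assms R by (simp add: kap_eq)
  also have "(R / r) powr (n * s) = (r / R) powr (- (n * s))"
    using assms R by (simp add: powr_minus powr_divide field_simps)
  also have "(r / R) powr \<beta> * (r / R) powr (- (n * s)) = (r / R) powr (\<beta> - n * s)"
    by (simp flip: powr_add)
  also have "C0 powr s * (r / R) powr (\<beta> - n * s) \<le> C0 powr s * 1"
    using assms R ns_beta by (intro mult_left_mono powr_le1) auto
  finally have k: "(r / R) powr \<beta> * kap (R / r) \<le> C0 powr s" by simp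
  have "(r / R) powr \<beta> * V R powr s \<le> (r / R) powr \<beta> * (kap (R / r) * V r powr s)"
    using assms by (intro mult_left_mono V_powr_le) auto
  also have "\<dots> \<le> C0 powr s * V r powr s"
    unfolding mult.assoc[symmetric] by (intro mult_right_mono k) auto
  finally show ?thesis .
qed

text \<open>The cancellation of the atom gains \<open>(r / rad z) powr \<beta>\<close>, which by
  \<open>small_V\<close> pays for \<open>V (rad z) powr s\<close>, the possible size of the mean of
  \<open>f\<close>.\<close>

lemma small_atom_pairing:
  assumes a: "atom M p q (qball d z r) a" "1 < q" "r > 0" and sm: "small z r" and \<phi>: "\<phi> \<in> TC"
  shows "V (rad z) powr s * cmod (act a \<phi>) \<le> cv / V 1 * (C0 * cv) powr s * nrm \<phi>"
proof -
  let ?K = "nrm \<phi> * (cv / V (rad z)) * (r / rad z) powr \<beta>"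
  have "cmod (act a \<phi>) \<le> ?K * vol z r powr - s"
    unfolding dist_of_fun_def
  proof (rule atom_cancel[OF a test_measurable[OF \<phi>]])
    fix x assume x: "d z x < r"
    have "cmod (\<phi> z - \<phi> x) \<le> nrm \<phi> * (cv / V (rad z)) * (d z x / rad z) powr \<beta>"
      using small_le[OF sm a(3)] x by (intro test_oscillation[OF \<phi>]) auto
    also have "\<dots> \<le> ?K"
      using x rad_pos[of z] beta_pos nrm_nonneg[OF \<phi>] cv_pos dist_nonneg
      by (intro mult_left_mono powr_mono2 divide_right_mono) auto
    finally show "cmod (\<phi> z - \<phi> x) \<le> ?K" .
  qed (use nrm_nonneg[OF \<phi>] cv_pos in auto)
  then have "V (rad z) powr s * cmod (act a \<phi>) \<le> V (rad z) powr s * (?K * vol z r powr - s)"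
    by (intro mult_left_mono) auto
  also have "\<dots> = nrm \<phi> * (cv / V (rad z)) * ((r / rad z) powr \<beta> * V (rad z) powr s) * vol z r powr - s"
    by (simp add: mult_ac)
  also have "\<dots> \<le> nrm \<phi> * (cv / V 1) * (C0 powr s * V r powr s) * vol z r powr - s"
    using nrm_nonneg[OF \<phi>] cv_pos
    by (intro mult_right_mono mult_mono[OF mult_left_mono[OF cv_div_V_le] small_V[OF a(3) small_le_rad[OF sm a(3)]]]) auto
  also have "\<dots> = nrm \<phi> * (cv / V 1) * C0 powr s * (V r powr s * vol z r powr - s)"
    by (simp add: mult_ac)
  also have "\<dots> \<le> nrm \<phi> * (cv / V 1) * C0 powr s * cv powr s"
    using nrm_nonneg[OF \<phi>] cv_pos by (intro mult_left_mono V_ball_powr a(3)) auto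
  also have "\<dots> = cv / V 1 * (C0 * cv) powr s * nrm \<phi>"
    using C0_ge_1 cv_pos by (simp add: powr_mult mult_ac)
  finally show ?thesis .
qed

lemma mean_dist:
  assumes f: "f \<in> borel_measurable M" and r: "r > 0" and K: "\<And>y. d z y < r \<Longrightarrow> cmod (c - f y) \<le> K"
  shows "cmod (c - mean M (qball d z r) f) \<le> K"
proof -
  let ?B = "qball d z r"
  have B: "emeasure M ?B < \<infinity>" "measure M ?B > 0" using ball_measure[OF r] ball_measure_pos[OF r] by auto
  have iB: "integrable M (indicator ?B :: 'a \<Rightarrow> real)" using B by (simp add: integrable_indicator_iff)
  have le: "norm (indicator ?B y *\<^sub>R (c - f y)) \<le> K * indicator ?B y" for y
    using K[of y] by (auto simp: indicator_def)
  \<comment> \<open>The function \<open>c - f\<close> is bounded on the ball; integrability of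
    \<open>f\<close> there is inferred from it, by writing \<open>f\<close> as
    \<open>c - (c - f)\<close>.\<close>
  have i1: "integrable M (\<lambda>y. indicator ?B y *\<^sub>R (c - f y))"
  proof (rule Bochner_Integration.integrable_bound)
    show "integrable M (\<lambda>y. K * indicator ?B y)" using iB by simp
    show "(\<lambda>y. indicator ?B y *\<^sub>R (c - f y)) \<in> borel_measurable M" using f by measurable
    show "AE y in M. norm (indicator ?B y *\<^sub>R (c - f y)) \<le> norm (K * indicator ?B y)"
      using le by (intro AE_I2) (metis abs_ge_self order_trans real_norm_def)
  qed
  have i2: "integrable M (\<lambda>y. indicator ?B y *\<^sub>R c)" using iB by simp
  have "(LINT y|M. indicator ?B y *\<^sub>R f y) = (LINT y|M. indicator ?B y *\<^sub>R c - indicator ?B y *\<^sub>R (c - f y))"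
    by (simp add: scaleR_diff_right)
  also have "\<dots> = measure M ?B *\<^sub>R c - (LINT y|M. indicator ?B y *\<^sub>R (c - f y))"
    using i1 i2 iB by (subst Bochner_Integration.integral_diff) auto
  finally have eq: "c - mean M ?B f = (LINT y|M. indicator ?B y *\<^sub>R (c - f y)) / measure M ?B"
    using B by (simp add: mean_def set_lebesgue_integral_def field_simps scaleR_conv_of_real)
  have "cmod (LINT y|M. indicator ?B y *\<^sub>R (c - f y)) \<le> (LINT y|M. norm (indicator ?B y *\<^sub>R (c - f y)))"
    by (rule integral_norm_bound)
  also have "\<dots> \<le> (LINT y|M. K * indicator ?B y)"
    using iB by (intro integral_mono[OF integrable_norm[OF i1]] le) auto
  also have "\<dots> = K * measure M ?B" by simp
  finally show ?thesis
    unfolding eq using B by (simp add: norm_divide pos_divide_le_eq)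
qed

end

section \<open>A fixed Lipschitz function against a single atom\<close>

locale lip_setting = hardy_setting +
  fixes f :: "'a \<Rightarrow> complex" and A :: real
  assumes f_lip: "lip f A" and A_nonneg: "0 \<le> A"
begin

text \<open>The quotient absorbs the value at \<open>x0\<close> into
  \<open>V (rad x) powr s\<close>, since \<open>rad x\<close> is at least 1.\<close>

definition F :: real where "F = cmod (f x0) / V 1 powr s + A"

lemma F_nonneg: "0 \<le> F"
  using A_nonneg by (simp add: F_def)

lemma f_measurable [measurable]: "f \<in> borel_measurable M"
  by (rule lip_measurable[OF f_lip])

lemma f_growth: "cmod (f x) \<le> F * V (rad x) powr s"
proof -
  have "cmod (f x) \<le> cmod (f x0) + cmod (f x0 - f x)"
    by (metis norm_minus_commute norm_triangle_sub)
  also have "\<dots> \<le> cmod (f x0) + A * V (d x0 x) powr s"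
    using f_lip by (simp add: lip_def)
  also have "\<dots> \<le> cmod (f x0) / V 1 powr s * V (rad x) powr s + A * V (rad x) powr s"
  proof (intro add_mono mult_left_mono V_powr_mono A_nonneg)
    have "cmod (f x0) / V 1 powr s * V 1 powr s \<le> cmod (f x0) / V 1 powr s * V (rad x) powr s"
      by (intro mult_left_mono V_powr_mono rad_ge_1) auto
    then show "cmod (f x0) \<le> cmod (f x0) / V 1 powr s * V (rad x) powr s"
      using V_pos[of 1] by simp
  qed (simp add: rad_def)
  finally show ?thesis by (simp add: F_def distrib_right)
qed

text \<open>Relative to \<open>V r powr s\<close>, \<open>A1\<close> measures the oscillation of
  \<open>f\<close> on a ball, and \<open>F1\<close> below the size of \<open>f\<close> and of its
  mean on a ball that is not small.\<close>

definition A1 :: real where "A1 = A * kap (2 * K0)"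
definition F1 :: real where "F1 = F * kap (4 * K0\<^sup>2) + A1"

lemma A1_nonneg: "0 \<le> A1" and F1_nonneg: "0 \<le> F1"
  using A_nonneg F_nonneg kap_pos[of "2 * K0"] kap_pos[of "4 * K0\<^sup>2"] K0_ge_1 by (auto simp: A1_def F1_def)

lemma f_ball: "d z x < r \<Longrightarrow> d z y < r \<Longrightarrow> cmod (f x - f y) \<le> A1 * V r powr s"
  unfolding A1_def using lip_ball[OF f_lip A_nonneg] by blast

lemma mean_ball: "r > 0 \<Longrightarrow> d z x < r \<Longrightarrow> cmod (f x - mean M (qball d z r) f) \<le> A1 * V r powr s"
  by (intro mean_dist f_measurable f_ball)

lemma mean_small: "r > 0 \<Longrightarrow> small z r \<Longrightarrow> cmod (mean M (qball d z r) f) \<le> (F + A1) * V (rad z) powr s"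
proof -
  assume r: "r > 0" "small z r"
  have "cmod (mean M (qball d z r) f) \<le> cmod (f z) + cmod (f z - mean M (qball d z r) f)"
    by (metis norm_minus_commute norm_triangle_sub)
  also have "\<dots> \<le> F * V (rad z) powr s + A1 * V r powr s"
    using r by (intro add_mono f_growth mean_ball) auto
  also have "\<dots> \<le> F * V (rad z) powr s + A1 * V (rad z) powr s"
    by (intro add_left_mono mult_left_mono V_powr_mono small_le_rad r A1_nonneg)
  finally show ?thesis by (simp add: distrib_right)
qed

text \<open>On such a ball \<open>rad z\<close> is at most a multiple of \<open>r\<close>, so the
  global growth of \<open>f\<close> is no worse than its local oscillation. The number
  \<open>c\<close> stands for a value of \<open>f\<close> on the ball or for the mean.\<close>

lemma big_bound:
  assumes r: "r > 0" and "\<not> small z r" and c: "cmod (f z - c) \<le> A1 * V r powr s"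
  shows "cmod c \<le> F1 * V r powr s"
proof -
  have le: "rad z \<le> 4 * K0\<^sup>2 * r" using assms by (simp add: small_def)
  have "1 \<le> K0\<^sup>2" using K0_ge_1 by simp
  then have K: "1 \<le> 4 * K0\<^sup>2" by linarith
  have "cmod c \<le> cmod (f z) + cmod (f z - c)"
    by (metis norm_minus_commute norm_triangle_sub)
  also have "\<dots> \<le> F * V (rad z) powr s + A1 * V r powr s"
    by (intro add_mono f_growth c)
  also have "\<dots> \<le> F * (kap (4 * K0\<^sup>2) * V r powr s) + A1 * V r powr s"
    using le K by (intro add_right_mono mult_left_mono V_powr_le F_nonneg)
  finally show ?thesis by (simp add: F1_def algebra_simps)
qed

context
  fixes q :: ereal and z r a
  assumes a: "atom M p q (qball d z r) a" "1 < q" "r > 0"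
begin

lemma local_product:
  "integrable M (\<lambda>x. (f x - mean M (qball d z r) f) * a x)"
  "(LINT x|M. cmod ((f x - mean M (qball d z r) f) * a x)) \<le> A1 * cv powr s"
proof -
  let ?h = "\<lambda>x. f x - mean M (qball d z r) f"
  have h: "?h \<in> borel_measurable M" "\<And>x. d z x < r \<Longrightarrow> cmod (?h x) \<le> A1 * V r powr s" "0 \<le> A1 * V r powr s"
    using mean_ball[OF a(3)] A1_nonneg by (auto intro: mult_nonneg_nonneg)
  show "integrable M (\<lambda>x. ?h x * a x)"
    by (rule atom_mult_bound(1)[OF a h])
  have "(LINT x|M. cmod (?h x * a x)) \<le> A1 * V r powr s * vol z r powr - s"
    by (rule atom_mult_bound(2)[OF a h])
  also have "\<dots> \<le> A1 * cv powr s"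
    using V_ball_powr[OF a(3), of z] A1_nonneg by (simp add: mult.assoc mult_left_mono)
  finally show "(LINT x|M. cmod (?h x * a x)) \<le> A1 * cv powr s" .
qed

lemma big_product:
  assumes "\<not> small z r"
  shows "integrable M (\<lambda>x. f x * a x)" "(LINT x|M. cmod (f x * a x)) \<le> F1 * cv powr s"
proof -
  have h: "\<And>x. d z x < r \<Longrightarrow> cmod (f x) \<le> F1 * V r powr s" "0 \<le> F1 * V r powr s"
    using F1_nonneg a(3) by (auto intro!: big_bound[OF a(3) assms] f_ball[where z = z])
  show "integrable M (\<lambda>x. f x * a x)"
    by (rule atom_mult_bound(1)[OF a f_measurable h])
  have "(LINT x|M. cmod (f x * a x)) \<le> F1 * V r powr s * vol z r powr - s"
    by (rule atom_mult_bound(2)[OF a f_measurable h])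
  also have "\<dots> \<le> F1 * cv powr s"
    using V_ball_powr[OF a(3), of z] F1_nonneg by (simp add: mult.assoc mult_left_mono)
  finally show "(LINT x|M. cmod (f x * a x)) \<le> F1 * cv powr s" .
qed

text \<open>On a small ball the cancellation of the atom compensates the mean; otherwise the mean is
  of size \<open>V r powr s\<close> and the L1 norm of the atom suffices. The two constants are
  added, so the bound is uniform over all atoms.\<close>

lemma mean_pairing:
  assumes \<phi>: "\<phi> \<in> TC"
  shows "cmod (mean M (qball d z r) f) * cmod (act a \<phi>)
    \<le> ((F + A1) * (cv / V 1 * (C0 * cv) powr s) + cv / V 1 * (F1 * cv powr s)) * nrm \<phi>"
proof (cases "small z r")
  case True
  have "cmod (mean M (qball d z r) f) * cmod (act a \<phi>)
    \<le> (F + A1) * V (rad z) powr s * cmod (act a \<phi>)"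
    by (intro mult_right_mono mean_small True a(3)) auto
  also have "\<dots> \<le> (F + A1) * (cv / V 1 * (C0 * cv) powr s * nrm \<phi>)"
    using small_atom_pairing[OF a True \<phi>] F_nonneg A1_nonneg unfolding mult.assoc by (intro mult_left_mono) auto
  also have "\<dots> \<le> (F + A1) * (cv / V 1 * (C0 * cv) powr s * nrm \<phi>) + cv / V 1 * (F1 * cv powr s) * nrm \<phi>"
    using F1_nonneg nrm_nonneg[OF \<phi>] cv_pos by simp
  finally show ?thesis by (simp add: algebra_simps)
next
  case False
  note aL = atom_L1[OF a(1,2) refl a(3)]
  have m: "cmod (mean M (qball d z r) f) \<le> F1 * V r powr s"
    using a(3) by (intro big_bound[OF a(3) False] mean_ball) auto
  have "cmod (mean M (qball d z r) f) * cmod (act a \<phi>)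
    \<le> (F1 * V r powr s) * (cv / V 1 * (LINT x|M. cmod (a x)) * nrm \<phi>)"
    using F1_nonneg by (intro mult_mono m dist_of_fun_bound aL(1) \<phi>) auto
  also have "\<dots> \<le> (F1 * V r powr s) * (cv / V 1 * vol z r powr - s * nrm \<phi>)"
    using F1_nonneg nrm_nonneg[OF \<phi>] cv_pos by (intro mult_left_mono mult_right_mono aL(2)) auto
  also have "\<dots> = (V r powr s * vol z r powr - s) * (F1 * (cv / V 1) * nrm \<phi>)"
    by (simp add: mult_ac)
  also have "\<dots> \<le> cv powr s * (F1 * (cv / V 1) * nrm \<phi>)"
    using F1_nonneg nrm_nonneg[OF \<phi>] cv_pos by (intro mult_right_mono V_ball_powr a(3)) auto
  also have "\<dots> \<le> (F + A1) * (cv / V 1 * (C0 * cv) powr s * nrm \<phi>) + cv powr s * (F1 * (cv / V 1) * nrm \<phi>)"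
    using F_nonneg A1_nonneg nrm_nonneg[OF \<phi>] cv_pos by simp
  finally show ?thesis by (simp add: algebra_simps)
qed

end

end

section \<open>The maximal inequality\<close>

context based_space
begin

lemma ball_growth: "1 \<le> l \<Longrightarrow> r > 0 \<Longrightarrow> vol y (l * r) \<le> C0 * l powr hom_dim C0 * vol y r"
  using measure_growth[of r "l * r" y] by simp

text \<open>The exceptional set \<open>E\<close> is a countable union of dilated balls instead of a
  superlevel set of the maximal function, so that its measurability is immediate.\<close>

lemma weak_type:
  fixes u :: "'a \<Rightarrow> real"
  assumes u: "integrable M u" "\<And>x. 0 \<le> u x" and t: "t > 0"
  shows "\<exists>E\<in>sets M. emeasure M E \<le> ennreal (C0 * (3 * K0) powr hom_dim C0 * ((LINT x|M. u x) / t)) \<and>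
    (\<forall>x. x \<notin> E \<longrightarrow> (\<forall>\<rho>>0. (LINT y|M. indicator (qball d x \<rho>) y * u y) \<le> t * vol x \<rho>))"
proof -
  define I where "I = (\<lambda>j :: 'a \<times> real. LINT y|M. indicator (qball d (fst j) (snd j)) y * u y)"
  define m where "m = (\<lambda>j :: 'a \<times> real. measure M (qball d (fst j) (snd j)))"
  define S where "S = (\<lambda>j :: 'a \<times> real. qball d (fst j) (snd j))"
  define N where "N = (LINT x|M. u x)"
  define Q where "Q = {j. 0 < snd j \<and> t * m j < I j}"
  have iu: "integrable M (\<lambda>y. indicator (S j) y * u y)" for j
    using integrable_mult_indicator[OF _ u(1), of "S j"] by (simp add: S_def)
  have I_le: "I j \<le> N" for j
    unfolding I_def N_def using iu[of j] u
    by (intro integral_mono) (auto simp: S_def indicator_def)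
  have N0: "0 \<le> N" unfolding N_def using u(2) by simp
  have Sx: "fst j \<in> S j" if "j \<in> Q" for j using that by (simp add: S_def Q_def)
  \<comment> \<open>Balls in \<open>Q\<close> have measure at most \<open>N / t\<close>. Solving the
    reverse doubling inequality for the radius gives this bound, which the Vitali selection
    requires.\<close>
  define R where "R = max 1 ((cr * cv * N / (t * V 1)) powr (1 / \<kappa>))"
  have rad: "snd j \<le> R" if "j \<in> Q" for j
  proof (cases "snd j \<le> 1")
    case False
    then have j: "1 \<le> snd j" by simp
    have "t * m j \<le> N" using that I_le[of j] by (simp add: Q_def)
    then have mj: "m j \<le> N / t" using t by (simp add: pos_le_divide_eq mult.commute)
    have "V 1 \<le> cr * (1 / snd j) powr \<kappa> * V (snd j)" by (rule V_reverse) (use j in auto)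
    also have "\<dots> \<le> cr * (1 / snd j) powr \<kappa> * (cv * (N / t))"
    proof -
      have "V (snd j) \<le> cv * m j" unfolding m_def by (rule V_le_ball)
      also have "\<dots> \<le> cv * (N / t)" using mj cv_pos by (intro mult_left_mono) auto
      finally show ?thesis using cr_pos by (intro mult_left_mono) auto
    qed
    also have "(1 / snd j) powr \<kappa> = 1 / snd j powr \<kappa>" using j by (simp add: powr_divide)
    finally have "V 1 \<le> cr * (cv * (N / t)) / snd j powr \<kappa>" by (simp add: mult_ac)
    moreover have "0 < snd j powr \<kappa>" using j by simp
    ultimately have "snd j powr \<kappa> * V 1 \<le> cr * (cv * (N / t))"
      by (simp only: pos_le_divide_eq mult.commute)
    then have "snd j powr \<kappa> \<le> cr * cv * N / (t * V 1)"
      using t V_pos[of 1] by (simp add: field_simps)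
    then have "(snd j powr \<kappa>) powr (1 / \<kappa>) \<le> (cr * cv * N / (t * V 1)) powr (1 / \<kappa>)"
      using kappa_pos by (intro powr_mono2) auto
    then show ?thesis using kappa_pos j by (simp add: powr_powr R_def)
  qed (simp add: R_def)
  obtain W where W: "W \<subseteq> Q" "pairwise (\<lambda>i j. disjnt (S i) (S j)) W"
    "\<And>i. i \<in> Q \<Longrightarrow> \<exists>j\<in>W. \<not> disjnt (S i) (S j) \<and> snd i \<le> 2 * snd j"
  proof -
    have "\<exists>W\<subseteq>Q. pairwise (\<lambda>i j. disjnt (S i) (S j)) W \<and>
      (\<forall>i\<in>Q. \<exists>j\<in>W. \<not> disjnt (S i) (S j) \<and> snd i \<le> 2 * snd j)"
    proof (rule vitali_selection)
      show "0 < snd i" "snd i \<le> R" "S i \<noteq> {}" if "i \<in> Q" for i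
        using rad[OF that] Sx[OF that] that by (auto simp: Q_def)
    qed
    then show thesis using that by blast
  qed
  have fin: "(\<Sum>j\<in>J. m j) \<le> N / t" if J: "finite J" "J \<subseteq> W" for J
  proof -
    have disj: "disjoint_family_on S J"
      unfolding disjoint_family_on_def
    proof (intro ballI impI)
      fix i j assume "i \<in> J" "j \<in> J" "i \<noteq> j"
      then have "disjnt (S i) (S j)" using W(2) J(2) by (meson pairwiseD subsetD)
      then show "S i \<inter> S j = {}" by (simp add: disjnt_def)
    qed
    have "(\<Sum>j\<in>J. t * m j) \<le> (\<Sum>j\<in>J. I j)"
      using J(2) W(1) by (intro sum_mono) (auto simp: Q_def less_imp_le)
    also have "\<dots> = (LINT y|M. (\<Sum>j\<in>J. indicator (S j) y * u y))"
      unfolding I_def using iu by (subst Bochner_Integration.integral_sum) (auto simp: S_def)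
    also have "\<dots> \<le> N"
      unfolding N_def
    proof (rule integral_mono)
      show "integrable M (\<lambda>y. \<Sum>j\<in>J. indicator (S j) y * u y)"
        by (intro Bochner_Integration.integrable_sum iu)
      show "(\<Sum>j\<in>J. indicator (S j) y * u y) \<le> u y" for y
      proof -
        have "(\<Sum>j\<in>J. indicator (S j) y * u y) = indicator (\<Union>(S ` J)) y * u y"
          unfolding sum_distrib_right[symmetric] by (simp only: indicator_UN_disjoint[OF J(1) disj])
        then show ?thesis using u(2)[of y] by (simp add: indicator_def)
      qed
    qed (rule u(1))
    finally show ?thesis using t by (simp add: sum_distrib_left[symmetric] pos_le_divide_eq mult.commute)
  qed
  have m_pos: "m j > 0" if "j \<in> W" for j
    using that W(1) ball_measure_pos by (auto simp: m_def Q_def)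
  \<comment> \<open>Disjoint balls in \<open>W\<close> have positive measures with bounded finite
    sums, which only countably many can have.\<close>
  have cW: "countable W"
  proof -
    have "m summable_on W"
      using fin m_pos by (intro nonneg_bdd_above_summable_on) (auto simp: less_imp_le intro!: bdd_aboveI[of _ "N / t"])
    then have "countable {j \<in> W. m j \<noteq> 0}" by (rule summable_countable_real)
    moreover have "{j \<in> W. m j \<noteq> 0} = W" using m_pos by (auto simp: less_imp_neq[symmetric])
    ultimately show ?thesis by simp
  qed
  \<comment> \<open>Only the centre of a ball in \<open>Q\<close> has to be covered. If that ball
    meets \<open>S j\<close> and its radius is at most twice \<open>snd j\<close>, the centre lies
    within \<open>K0 * (snd j + 2 * snd j)\<close> of \<open>fst j\<close>; hence the dilation
    factor \<open>3 * K0\<close>.\<close>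
  define D where "D = C0 * (3 * K0) powr hom_dim C0"
  have D0: "0 \<le> D" using C0_ge_1 by (simp add: D_def)
  define T where "T = (\<lambda>j :: 'a \<times> real. qball d (fst j) (3 * K0 * snd j))"
  have T_sets: "T j \<in> sets M" for j by (simp add: T_def)
  have T_meas: "emeasure M (T j) \<le> ennreal (D * m j)" if "j \<in> W" for j
  proof -
    have j: "0 < snd j" using that W(1) by (auto simp: Q_def)
    then have "emeasure M (T j) = ennreal (measure M (T j))"
      unfolding T_def using K0_ge_1 by (intro emeasure_ball) simp
    also have "measure M (T j) \<le> D * m j"
      unfolding T_def D_def m_def using K0_ge_1 j by (intro ball_growth) auto
    finally show ?thesis by (simp add: ennreal_leI)
  qed
  have T_fin: "emeasure M (\<Union>j\<in>J. T j) \<le> ennreal (D * (N / t))" if J: "finite J" "J \<subseteq> W" for J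
  proof -
    have "emeasure M (\<Union>j\<in>J. T j) \<le> (\<Sum>j\<in>J. emeasure M (T j))"
      using J T_sets by (intro emeasure_subadditive_finite) auto
    also have "\<dots> \<le> (\<Sum>j\<in>J. ennreal (D * m j))"
      using J T_meas by (intro sum_mono) auto
    also have "\<dots> = ennreal (\<Sum>j\<in>J. D * m j)"
      using D0 by (intro sum_ennreal) (simp add: m_def)
    also have "\<dots> \<le> ennreal (D * (N / t))"
      unfolding sum_distrib_left[symmetric] by (intro ennreal_leI mult_left_mono fin[OF J] D0)
    finally show ?thesis .
  qed
  let ?E = "\<Union>j\<in>W. T j"
  have E_meas: "emeasure M ?E \<le> ennreal (D * (N / t))"
  proof (cases "W = {}")
    case False
    let ?e = "from_nat_into W"
    have rng: "range ?e = W" using False cW by (rule range_from_nat_into)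
    have "?E = (\<Union>n. T (?e n))" using rng by (metis image_image)
    also have "\<dots> = (\<Union>n. \<Union>j\<in>?e ` {..n}. T j)" by auto
    finally have "?E = (\<Union>n. \<Union>j\<in>?e ` {..n}. T j)" .
    then have "emeasure M ?E = (SUP n. emeasure M (\<Union>j\<in>?e ` {..n}. T j))"
    proof (simp only:, intro SUP_emeasure_incseq[symmetric])
      show "range (\<lambda>n. \<Union>j\<in>?e ` {..n}. T j) \<subseteq> sets M" by (intro image_subsetI sets.finite_UN T_sets) auto
      show "incseq (\<lambda>n. \<Union>j\<in>?e ` {..n}. T j)" unfolding incseq_def by (intro allI impI UN_mono image_mono) auto
    qed
    also have "\<dots> \<le> ennreal (D * (N / t))"
      using rng by (intro SUP_least T_fin) auto
    finally show ?thesis .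
  qed simp
  have "(LINT y|M. indicator (qball d x \<rho>) y * u y) \<le> t * vol x \<rho>"
    if x: "x \<notin> ?E" "\<rho> > 0" for x \<rho>
  proof (rule ccontr)
    assume "\<not> ?thesis"
    then have Q: "(x, \<rho>) \<in> Q" using x(2) by (simp add: Q_def I_def m_def)
    obtain j where j: "j \<in> W" "\<not> disjnt (S (x, \<rho>)) (S j)" "\<rho> \<le> 2 * snd j"
      using W(3)[OF Q] by auto
    obtain w where w: "d x w < \<rho>" "d (fst j) w < snd j"
      using j(2) by (auto simp: disjnt_def S_def)
    have "d (fst j) x \<le> K0 * (d (fst j) w + d w x)" by (rule quasi_triangle)
    also have "\<dots> < K0 * (3 * snd j)"
      using w j(3) K0_ge_1 by (intro mult_strict_left_mono) (auto simp: dist_sym[of w x])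
    finally have "x \<in> T j" by (simp add: T_def mult_ac)
    then show False using x(1) j(1) by blast
  qed
  then show ?thesis
    using E_meas unfolding D_def N_def
    by (intro bexI[of _ ?E] conjI allI impI) (use cW T_sets in \<open>auto intro!: sets.countable_UN' simp del: split_paired_All\<close>)
qed

end

section \<open>Pairings of an atom with test functions centred near its ball and far from it\<close>

context hardy_setting
begin

definition Cn :: real where
  "Cn = C0 * 2 powr n * cv * 2 powr \<gamma> * cv / (1 - 2 powr - \<gamma>)"

lemma Cn_pos: "0 < Cn"
proof -
  have "(2::real) powr - \<gamma> < 1" using gamma_pos powr_less_mono[of "- \<gamma>" 0 2] by simp
  then show ?thesis using C0_ge_1 cv_pos by (simp add: Cn_def)
qed

text \<open>On the ball of radius \<open>2 ^ k * \<rho>\<close> about \<open>x\<close>, off the previous one, the test function is at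
  most a constant times \<open>2 powr (- \<gamma> * k)\<close> over the volume of that ball.\<close>

lemma near_pairing:
  assumes a: "integrable M a" and \<phi>: "\<phi> \<in> TC" "unit_test x \<rho> \<phi>" and \<rho>: "\<rho> > 0" and t: "0 \<le> t"
    and avg: "\<And>\<sigma>. \<sigma> > 0 \<Longrightarrow> (LINT y|M. indicator (qball d x \<sigma>) y * cmod (a y)) \<le> t * vol x \<sigma>"
  shows "cmod (act a \<phi>) \<le> Cn * t"
proof -
  define T where "T k = 2 ^ k * \<rho>" for k :: nat
  define c where "c k = C0 * 2 powr n * cv * 2 powr \<gamma> * (2 powr - \<gamma>) ^ k / V (T k)" for k
  have T: "T k > 0" for k using \<rho> by (simp add: T_def)
  have c0: "0 \<le> c k" for k using C0_ge_1 cv_pos by (simp add: c_def)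
  have ptw: "\<exists>k. d x y < T k \<and> cmod (\<phi> y) \<le> c k" for y
  proof -
    let ?R = "\<rho> + d x y"
    have R: "?R > 0" using \<rho> dist_nonneg[of x y] by linarith
    obtain k where k: "d x y < T k" "T k \<le> 2 * ?R"
      using dyadic_above[OF \<rho> dist_nonneg[of x y]] unfolding T_def by blast
    have "cmod (\<phi> y) \<le> 1 / vol y ?R * (\<rho> / ?R) powr \<gamma>"
      using \<phi>(2)[unfolded test_bound_def, THEN conjunct1, rule_format, of y] by (simp add: dist_sym[of y x])
    also have "\<dots> \<le> (cv * (C0 * 2 powr n) / V (T k)) * (2 * (1 / 2 ^ k)) powr \<gamma>"
    proof (intro mult_mono powr_mono2)
      have "V (T k) \<le> C0 * 2 powr n * V ?R"
        using V_mono[OF k(2)] V_scale[of 2 ?R] by simp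
      then have "1 / V ?R \<le> C0 * 2 powr n / V (T k)"
        using V_pos[OF R] V_pos[OF T[of k]] by (simp add: field_simps)
      then have "cv * (1 / V ?R) \<le> cv * (C0 * 2 powr n / V (T k))" using cv_pos by (intro mult_left_mono) auto
      then show "1 / vol y ?R \<le> cv * (C0 * 2 powr n) / V (T k)"
        using inverse_ball_le[OF R, of y] by simp
      show "\<rho> / ?R \<le> 2 * (1 / 2 ^ k)"
        using k(2) R by (simp add: T_def field_simps)
    qed (use gamma_pos R \<rho> cv_pos C0_ge_1 in auto)
    also have "(2 * (1 / 2 ^ k)) powr \<gamma> = 2 powr \<gamma> * (2 powr - \<gamma>) ^ k"
      unfolding powr_geometric[symmetric] by (simp add: powr_mult[symmetric])
    finally have "cmod (\<phi> y) \<le> c k" by (simp add: c_def mult_ac)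
    with k(1) show ?thesis by blast
  qed
  have int: "integrable M (\<lambda>y. a y * \<phi> y)" by (rule integrable_mult_test[OF a \<phi>(1)])
  have ia: "integrable M (\<lambda>y. indicator (qball d x (T k)) y * cmod (a y))" for k
    using integrable_mult_indicator[OF _ integrable_norm[OF a], of "qball d x (T k)"] by simp
  have [measurable]: "a \<in> borel_measurable M" using a by simp
  \<comment> \<open>Summing over all balls that contain \<open>y\<close>, not only over its own
    shell, overcounts harmlessly and avoids a partition into shells.\<close>
  let ?g = "\<lambda>k y. ennreal (c k * (indicator (qball d x (T k)) y * cmod (a y)))"
  have "ennreal (cmod (act a \<phi>)) \<le> (\<integral>\<^sup>+ y. norm (a y * \<phi> y) \<partial>M)"
    unfolding dist_of_fun_def by (rule integral_norm_bound_ennreal[OF int])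
  also have "\<dots> \<le> (\<integral>\<^sup>+ y. (\<Sum>k. ?g k y) \<partial>M)"
  proof (rule nn_integral_mono)
    fix y
    obtain k where k: "d x y < T k" "cmod (\<phi> y) \<le> c k" using ptw by blast
    have "ennreal (norm (a y * \<phi> y)) \<le> ?g k y"
      using k by (intro ennreal_leI) (simp add: norm_mult mult.commute mult_right_mono)
    also have "\<dots> \<le> (\<Sum>k. ?g k y)"
      by (rule le_suminf_ennreal)
    finally show "ennreal (norm (a y * \<phi> y)) \<le> (\<Sum>k. ?g k y)" .
  qed
  also have "\<dots> = (\<Sum>k. \<integral>\<^sup>+ y. ?g k y \<partial>M)"
    by (rule nn_integral_suminf) measurable
  also have "\<dots> \<le> ennreal ((C0 * 2 powr n * cv * 2 powr \<gamma> * cv * t) / (1 - 2 powr - \<gamma>))"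
  proof (rule suminf_geometric_le)
    fix k
    have "(\<integral>\<^sup>+ y. ?g k y \<partial>M)
      = ennreal (LINT y|M. c k * (indicator (qball d x (T k)) y * cmod (a y)))"
      using ia[of k] c0 by (intro nn_integral_eq_integral) auto
    also have "(LINT y|M. c k * (indicator (qball d x (T k)) y * cmod (a y))) \<le> c k * (t * (cv * V (T k)))"
    proof -
      have "(LINT y|M. indicator (qball d x (T k)) y * cmod (a y)) \<le> t * vol x (T k)"
        by (rule avg[OF T])
      also have "\<dots> \<le> t * (cv * V (T k))" by (intro mult_left_mono ball_le_V t)
      finally show ?thesis using c0 by (simp add: mult_left_mono)
    qed
    also have "\<dots> = C0 * 2 powr n * cv * 2 powr \<gamma> * cv * t * (2 powr - \<gamma>) ^ k"
      using V_pos[OF T[of k]] by (simp add: c_def)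
    finally show "(\<integral>\<^sup>+ y. ?g k y \<partial>M)
      \<le> ennreal (C0 * 2 powr n * cv * 2 powr \<gamma> * cv * t * (2 powr - \<gamma>) ^ k)" by (simp add: ennreal_leI)
  qed (use C0_ge_1 cv_pos t gamma_pos in auto)
  also have "(C0 * 2 powr n * cv * 2 powr \<gamma> * cv * t) / (1 - 2 powr - \<gamma>) = Cn * t"
    by (simp add: Cn_def)
  finally show ?thesis using Cn_pos t by (simp add: ennreal_le_iff)
qed

text \<open>Far from the ball the second condition on test functions applies at \<open>z\<close>.
  Uniformity in the scale \<open>\<rho>\<close> holds because enlarging \<open>d z x\<close> to
  \<open>\<rho> + d z x\<close> only decreases the first two factors, and the decay factor is at
  most 1.\<close>

lemma far_pairing:
  assumes a: "atom M p q (qball d z r) a" "1 < q" "r > 0"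
    and \<phi>: "\<phi> \<in> TC" "unit_test x \<rho> \<phi>" and \<rho>: "\<rho> > 0"
    and far: "2 * K0 * r \<le> d z x"
  shows "cmod (act a \<phi>) \<le> cv / V (d z x) * (r / d z x) powr \<beta> * vol z r powr - s"
  unfolding dist_of_fun_def
proof (rule atom_cancel[OF a test_measurable[OF \<phi>(1)]])
  let ?\<delta> = "d z x"
  have "0 < 2 * K0 * r" using a(3) K0_ge_1 by simp
  then have \<delta>: "?\<delta> > 0" using far by linarith
  fix y assume y: "d z y < r"
  have "r \<le> ?\<delta> / (2 * K0)" using far K0_ge_1 by (simp add: field_simps)
  also have "\<dots> \<le> (\<rho> + ?\<delta>) / (2 * K0)" using \<rho> K0_ge_1 by (intro divide_right_mono) auto
  finally have "d z y \<le> (\<rho> + d x z) / (2 * K0)" using y by (simp add: dist_sym[of x z])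
  then have "cmod (\<phi> z - \<phi> y) \<le> (d z y / (\<rho> + ?\<delta>)) powr \<beta>
      * (1 / vol z (\<rho> + ?\<delta>)) * (\<rho> / (\<rho> + ?\<delta>)) powr \<gamma>"
    using \<phi>(2)[unfolded test_bound_def, THEN conjunct2, rule_format, of z y] by (simp add: dist_sym[of x z])
  also have "\<dots> \<le> (r / ?\<delta>) powr \<beta> * (cv / V ?\<delta>) * 1"
  proof (intro mult_mono[OF mult_mono])
    show "(d z y / (\<rho> + ?\<delta>)) powr \<beta> \<le> (r / ?\<delta>) powr \<beta>"
      using y \<rho> \<delta> beta_pos dist_nonneg[of z y] by (intro powr_mono2 frac_le) auto
    have "1 / vol z (\<rho> + ?\<delta>) \<le> 1 / vol z ?\<delta>"
      using ball_measure_mono_radius[of ?\<delta> "\<rho> + ?\<delta>" z] \<rho> ball_measure_pos[OF \<delta>, of z]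
      by (intro divide_left_mono) (auto intro: mult_pos_pos less_le_trans)
    also have "\<dots> \<le> cv / V ?\<delta>" by (rule inverse_ball_le[OF \<delta>])
    finally show "1 / vol z (\<rho> + ?\<delta>) \<le> cv / V ?\<delta>" .
    show "(\<rho> / (\<rho> + ?\<delta>)) powr \<gamma> \<le> 1" using \<rho> \<delta> gamma_pos by (intro powr_le1) auto
  qed (use cv_pos in auto)
  finally show "cmod (\<phi> z - \<phi> y) \<le> cv / V ?\<delta> * (r / ?\<delta>) powr \<beta>" by (simp add: mult.commute)
qed (use cv_pos in auto)

end

section \<open>Maximal functions of atoms in the weighted space\<close>

context hardy_setting
begin

section \<open>Integrals of the density of \<open>tau\<close> over balls\<close>

definition ht :: "'a \<Rightarrow> real" where "ht x = 2 * K0\<^sup>2 + K0 * d x0 x"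

definition wt :: "'a \<Rightarrow> real" where "wt x = 1 / ht x powr ((1 - p) * n)"

abbreviation wint :: "('a \<Rightarrow> ennreal) \<Rightarrow> ennreal" where "wint G \<equiv> \<integral>\<^sup>+ x. ennreal (wt x) * G x \<partial>M"

lemma tau_eq: "tau d M K0 C0 x0 p = density M (\<lambda>x. ennreal (wt x))"
  by (simp add: tau_def wt_def ht_def)

lemma ht_measurable [measurable]: "ht \<in> borel_measurable M"
  unfolding ht_def by measurable

lemma wt_measurable [measurable]: "wt \<in> borel_measurable M"
  unfolding wt_def by measurable

lemma wt_nonneg: "0 \<le> wt x"
  by (simp add: wt_def)

lemma ht_ge_1: "1 \<le> ht x"
proof -
  have "1 \<le> K0\<^sup>2" using K0_ge_1 by simp
  moreover have "0 \<le> K0 * d x0 x" using K0_ge_1 dist_nonneg[of x0 x] by simp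
  ultimately show ?thesis unfolding ht_def by linarith
qed

lemma ht_gt: "d x0 x < ht x"
proof -
  have "1 * d x0 x \<le> K0 * d x0 x" by (intro mult_right_mono K0_ge_1 dist_nonneg)
  moreover have "0 < K0\<^sup>2" using K0_ge_1 by simp
  ultimately show ?thesis unfolding ht_def by linarith
qed

lemma powr_neg_le:
  fixes x y c :: real
  assumes "0 < x" "0 < y" "x powr (1 - p) \<le> c * y powr (1 - p)"
  shows "y powr (p - 1) \<le> c * x powr (p - 1)"
proof -
  have "w powr (p - 1) = inverse (w powr (1 - p))" for w :: real
    using powr_minus[of w "1 - p"] by simp
  then show ?thesis using assms by (simp add: field_simps)
qed

text \<open>As \<open>p - 1\<close> is negative, this is monotonicity for \<open>R \<le> r\<close>,
  and doubling extends it to \<open>R\<close> up to \<open>l * r\<close>.\<close>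

lemma V_neg_powr:
  assumes "1 \<le> l" "0 < R" "R \<le> l * r"
  shows "V r powr (p - 1) \<le> (C0 * l powr n) powr (1 - p) * V R powr (p - 1)"
proof -
  have r: "0 < r" using assms by (smt (verit) mult_nonneg_nonpos)
  have "V R \<le> C0 * l powr n * V r"
    using V_mono[OF assms(3)] V_scale[OF assms(1), of r] by linarith
  then have "V R powr (1 - p) \<le> (C0 * l powr n) powr (1 - p) * V r powr (1 - p)"
    using p_lt C0_ge_1 by (subst powr_mult[symmetric]) (auto intro: powr_mono2)
  then show ?thesis
    by (rule powr_neg_le[OF V_pos[OF assms(2)] V_pos[OF r]])
qed

definition Ct :: real where "Ct = (C0 * V 1) powr (1 - p) * (C0 * 2 powr n) powr (1 - p)"

lemma Ct_nonneg: "0 \<le> Ct"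
  by (simp add: Ct_def)

text \<open>Doubling from radius 1 bounds \<open>V (ht x)\<close> by a multiple of
  \<open>ht x powr n\<close>. This explains the exponent \<open>(1 - p) * n\<close> of the weight:
  it puts the density below a multiple of \<open>V (ht x) powr (p - 1)\<close>.\<close>

lemma wt_le:
  assumes "0 < R" "R \<le> 2 * ht x"
  shows "wt x \<le> Ct * V R powr (p - 1)"
proof -
  have h: "0 < ht x" using ht_ge_1[of x] by linarith
  have "V (ht x) \<le> C0 * V 1 * ht x powr n"
    using V_scale[OF ht_ge_1, of x 1] by (simp add: mult_ac)
  then have "V (ht x) powr (1 - p) \<le> (C0 * V 1 * ht x powr n) powr (1 - p)"
    using p_lt by (intro powr_mono2) auto
  also have "\<dots> = (C0 * V 1) powr (1 - p) * ht x powr ((1 - p) * n)"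
    using C0_ge_1 by (simp add: powr_mult powr_powr mult.commute)
  finally have "1 / ht x powr ((1 - p) * n) \<le> (C0 * V 1) powr (1 - p) / V (ht x) powr (1 - p)"
    using h V_pos[OF h] by (simp add: pos_divide_le_eq pos_le_divide_eq mult.commute)
  moreover have "V (ht x) powr (p - 1) = 1 / V (ht x) powr (1 - p)"
    using powr_minus_divide[of "V (ht x)" "1 - p"] by simp
  ultimately have "wt x \<le> (C0 * V 1) powr (1 - p) * V (ht x) powr (p - 1)"
    by (simp add: wt_def)
  also have "\<dots> \<le> (C0 * V 1) powr (1 - p) * ((C0 * 2 powr n) powr (1 - p) * V R powr (p - 1))"
    by (intro mult_left_mono V_neg_powr assms) auto
  finally show ?thesis by (simp add: Ct_def mult_ac)
qed

lemma wt_near: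
  assumes "2 * K0 * T \<le> rad z" "d z x < T"
  shows "wt x \<le> Ct * V (rad z) powr (p - 1)"
proof (rule wt_le[OF rad_pos])
  have "d x0 z \<le> K0 * (d x0 x + d x z)" by (rule quasi_triangle)
  also have "\<dots> \<le> K0 * (d x0 x + T)"
    using assms(2) K0_ge_1 by (intro mult_left_mono) (auto simp: dist_sym[of x z])
  finally have "d x0 z \<le> K0 * d x0 x + K0 * T" by (simp add: distrib_left)
  moreover have "2 * (K0 * T) \<le> 1 + d x0 z" using assms(1) by (simp add: rad_def mult.assoc)
  moreover have "1 \<le> K0\<^sup>2" using K0_ge_1 by simp
  ultimately show "rad z \<le> 2 * ht x" unfolding ht_def rad_def distrib_left by linarith
qed

definition Co :: real where "Co = Ct * cr powr p / (1 - 2 powr - (\<kappa> * p))"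

lemma Co_nonneg: "0 \<le> Co"
  using two_powr_neg_less[of "\<kappa> * p"] kappa_pos p_pos Ct_nonneg by (simp add: Co_def)

lemma V_powr_p: "r > 0 \<Longrightarrow> V r powr (p - 1) * V r = V r powr p"
  using V_pos[of r] powr_add[of "V r" "p - 1" 1] by simp

lemma nn_integral_ball: "(\<integral>\<^sup>+ x. ennreal c * indicator (qball d z r) x \<partial>M) = ennreal c * emeasure M (qball d z r)"
  by (simp add: nn_integral_cmult_indicator)

text \<open>On dyadic balls about \<open>x0\<close> of radius comparable to \<open>ht x\<close>, the
  density is at most a multiple of \<open>V (R k) powr (p - 1)\<close>, so each ball contributes
  \<open>V (R k) powr p\<close>. Reverse doubling makes these contributions decay
  geometrically.\<close>

lemma wt_origin:
  assumes T: "T > 0"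
  shows "wint (indicator (qball d x0 T)) \<le> ennreal (Co * V T powr p)"
proof -
  define R where "R k = T / 2 ^ k" for k :: nat
  have R: "R k > 0" for k using T by (simp add: R_def)
  let ?g = "\<lambda>k x. ennreal (Ct * V (R k) powr (p - 1)) * indicator (qball d x0 (R k)) x"
  have "wint (indicator (qball d x0 T))
    \<le> (\<integral>\<^sup>+ x. (\<Sum>k. ?g k x) \<partial>M)"
  proof (rule nn_integral_mono)
    fix x
    show "ennreal (wt x) * indicator (qball d x0 T) x
      \<le> (\<Sum>k. ?g k x)"
    proof (cases "d x0 x < T")
      case True
      \<comment> \<open>\<open>ht\<close> acts as a distance from \<open>x0\<close> that is bounded
        below by 1. If it is less than \<open>T\<close>, some dyadic radius lies between
        \<open>ht x\<close> and twice it; otherwise \<open>T\<close> itself serves.\<close>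
      have "\<exists>k. d x0 x < R k \<and> R k \<le> 2 * ht x"
      proof (cases "ht x < T")
        case True
        then obtain k where "ht x \<le> R k" "R k \<le> 2 * ht x"
          using dyadic_below[of "ht x" T] ht_ge_1[of x] by (auto simp: R_def)
        then show ?thesis using ht_gt[of x] by (intro exI[of _ k]) auto
      next
        case False
        then show ?thesis using \<open>d x0 x < T\<close> ht_ge_1[of x] by (intro exI[of _ 0]) (auto simp: R_def)
      qed
      then obtain k where k: "d x0 x < R k" "R k \<le> 2 * ht x" by blast
      have "ennreal (wt x) * indicator (qball d x0 T) x \<le> ?g k x"
        using wt_le[OF R k(2)] k(1) True by (simp add: ennreal_leI)
      also have "\<dots> \<le> (\<Sum>k. ?g k x)"
        by (rule le_suminf_ennreal)
      finally show ?thesis .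
    qed simp
  qed
  also have "\<dots> = (\<Sum>k. \<integral>\<^sup>+ x. ?g k x \<partial>M)"
    by (rule nn_integral_suminf) measurable
  also have "\<dots> \<le> ennreal ((Ct * cr powr p * V T powr p) / (1 - 2 powr - (\<kappa> * p)))"
  proof (rule suminf_geometric_le)
    fix k
    have "(\<integral>\<^sup>+ x. ?g k x \<partial>M)
      = ennreal (Ct * V (R k) powr (p - 1)) * ennreal (V (R k))"
      unfolding nn_integral_ball emeasure_ball[OF R] V_def ..
    also have "\<dots> = ennreal (Ct * V (R k) powr p)"
      using Ct_nonneg V_powr_p[OF R, of k] by (simp add: ennreal_mult[symmetric] mult.assoc)
    also have "Ct * V (R k) powr p \<le> Ct * (cr powr p * V T powr p * (2 powr - (\<kappa> * p)) ^ k)"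
    proof (intro mult_left_mono Ct_nonneg)
      have "R k \<le> T" using T by (simp add: R_def divide_le_eq)
      then have "V (R k) \<le> cr * (1 / 2 ^ k) powr \<kappa> * V T"
        using V_reverse[OF R, of k T] T by (simp add: R_def)
      then have "V (R k) powr p \<le> (cr * (1 / 2 ^ k) powr \<kappa> * V T) powr p"
        using p_pos by (intro powr_mono2) auto
      also have "\<dots> = cr powr p * V T powr p * (1 / 2 ^ k) powr (\<kappa> * p)"
        using cr_pos by (simp add: powr_mult powr_powr mult_ac)
      finally show "V (R k) powr p \<le> cr powr p * V T powr p * (2 powr - (\<kappa> * p)) ^ k"
        unfolding powr_geometric .
    qed
    finally show "(\<integral>\<^sup>+ x. ?g k x \<partial>M)
      \<le> ennreal (Ct * cr powr p * V T powr p * (2 powr - (\<kappa> * p)) ^ k)"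
      by (simp add: ennreal_leI mult.assoc)
  qed (use Ct_nonneg kappa_pos p_pos in auto)
  also have "(Ct * cr powr p * V T powr p) / (1 - 2 powr - (\<kappa> * p)) = Co * V T powr p"
    by (simp add: Co_def)
  finally show ?thesis .
qed

definition Cb :: real where
  "Cb = Ct * cv + Co * (C0 * (3 * K0\<^sup>2) powr n) powr p * (C0 * (2 * K0) powr n) powr (1 - p)"

text \<open>If the ball is small compared with \<open>rad z\<close>, the density is bounded on it by
  its size at \<open>z\<close>. Otherwise the ball lies in a comparable ball about
  \<open>x0\<close>, and \<open>V T powr p = V T * V T powr (p - 1)\<close> is compared with
  \<open>V (rad z) powr (p - 1)\<close>, which is possible as \<open>rad z\<close> is then at most a
  multiple of \<open>T\<close>.\<close>

lemma wt_ball: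
  assumes T: "T > 0"
  shows "wint (indicator (qball d z T)) \<le> ennreal (Cb * (V T * V (rad z) powr (p - 1)))"
proof (cases "2 * K0 * T \<le> rad z")
  case True
  let ?X = "V T * V (rad z) powr (p - 1)"
  have "wint (indicator (qball d z T))
    \<le> (\<integral>\<^sup>+ x. ennreal (Ct * V (rad z) powr (p - 1)) * indicator (qball d z T) x \<partial>M)"
    using wt_near[OF True] by (intro nn_integral_mono) (auto simp: indicator_def intro: ennreal_leI)
  also have "\<dots> = ennreal (Ct * V (rad z) powr (p - 1) * vol z T)"
    unfolding nn_integral_ball emeasure_ball[OF T] using Ct_nonneg by (simp add: ennreal_mult)
  also have "Ct * V (rad z) powr (p - 1) * vol z T \<le> Ct * V (rad z) powr (p - 1) * (cv * V T)"
    using Ct_nonneg by (intro mult_left_mono ball_le_V) auto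
  also have "\<dots> \<le> Cb * ?X"
  proof -
    have "Ct * cv * ?X \<le> Cb * ?X"
      using Co_nonneg by (intro mult_right_mono) (auto simp: Cb_def)
    then show ?thesis by (simp add: mult_ac)
  qed
  finally show ?thesis by (simp add: ennreal_leI)
next
  case False
  let ?X = "V T * V (rad z) powr (p - 1)"
  \<comment> \<open>From \<open>K0 * (2 * K0 * T + T) \<le> 3 * K0\<^sup>2 * T\<close>.\<close>
  let ?T = "3 * K0\<^sup>2 * T"
  have K: "1 \<le> 3 * K0\<^sup>2" using one_le_power[OF K0_ge_1, of 2] by linarith
  have sub: "qball d z T \<subseteq> qball d x0 ?T"
  proof
    fix x assume "x \<in> qball d z T"
    then have "d z x < T" by simp
    have "d x0 x \<le> K0 * (d x0 z + d z x)" by (rule quasi_triangle)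
    also have "\<dots> < K0 * (2 * K0 * T + T)"
      using False \<open>d z x < T\<close> K0_ge_1 by (intro mult_strict_left_mono) (auto simp: rad_def)
    also have "\<dots> \<le> ?T" using T K0_ge_1 by (simp add: power2_eq_square algebra_simps)
    finally show "x \<in> qball d x0 ?T" by simp
  qed
  have "wint (indicator (qball d z T))
    \<le> wint (indicator (qball d x0 ?T))"
    using sub by (intro nn_integral_mono mult_left_mono) (auto simp: indicator_def)
  also have "\<dots> \<le> ennreal (Co * V ?T powr p)"
    using T K0_ge_1 by (intro wt_origin) simp
  also have "Co * V ?T powr p \<le> Cb * ?X"
  proof -
    let ?a = "(C0 * (3 * K0\<^sup>2) powr n) powr p" and ?b = "(C0 * (2 * K0) powr n) powr (1 - p)"
    have "V ?T powr p \<le> (C0 * (3 * K0\<^sup>2) powr n * V T) powr p"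
      using V_scale[OF K, of T] p_pos by (intro powr_mono2) auto
    also have "\<dots> = ?a * V T powr p" using C0_ge_1 by (simp add: powr_mult)
    also have "V T powr p = V T * V T powr (p - 1)" using V_powr_p[OF T] by (simp add: mult.commute)
    also have "\<dots> \<le> V T * (?b * V (rad z) powr (p - 1))"
      using False K0_ge_1 rad_pos[of z] by (intro mult_left_mono V_neg_powr) auto
    finally have "V ?T powr p \<le> ?a * (V T * (?b * V (rad z) powr (p - 1)))"
      by (simp add: mult_left_mono)
    then have "Co * V ?T powr p \<le> Co * (?a * (V T * (?b * V (rad z) powr (p - 1))))"
      by (intro mult_left_mono Co_nonneg)
    also have "\<dots> = (Co * ?a * ?b) * ?X" by (simp add: mult_ac)
    also have "\<dots> \<le> Cb * ?X"
      using Ct_nonneg cv_pos by (intro mult_right_mono) (auto simp: Cb_def)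
    finally show ?thesis .
  qed
  finally show ?thesis by (simp add: ennreal_leI)
qed

lemma Cb_nonneg: "0 \<le> Cb"
  using Ct_nonneg Co_nonneg cv_pos by (simp add: Cb_def)

section \<open>Majorants for the maximal function of one atom\<close>

definition Dw :: real where "Dw = C0 * (3 * K0) powr n"

definition Cnear :: real where
  "Cnear = Ct * Cn powr p * (C0 * (2 * K0) powr n + 2 powr p * Dw / (1 - 2 powr - (1 - p)))"

text \<open>Kolmogorov's argument by levels: off the exceptional set \<open>E k\<close> of level
  \<open>2 ^ k * t0\<close> all pairings are at most \<open>Cn * (2 ^ k * t0)\<close>, while
  \<open>E k\<close> has measure of order \<open>m / 2 ^ k\<close>. The p-th powers thus contribute
  a geometric series of ratio \<open>2 powr - (1 - p)\<close>. The majorant is independent of the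
  test function and its scale.\<close>

lemma near_majorant:
  assumes a: "atom M p q (qball d z r) a" "1 < q" "r > 0" and sm: "small z r"
  shows "\<exists>G\<in>borel_measurable M.
    (\<forall>x \<phi> \<rho>. d z x < 2 * K0 * r \<longrightarrow> 0 < \<rho> \<longrightarrow> \<phi> \<in> TC \<longrightarrow> unit_test x \<rho> \<phi> \<longrightarrow>
      ennreal (cmod (act a \<phi>) powr p) \<le> G x) \<and>
    wint G \<le> ennreal (Cnear * V (rad z) powr (p - 1))"
proof -
  let ?N = "qball d z (2 * K0 * r)"
  define m where "m = vol z r"
  have m: "m > 0" using ball_measure_pos[OF a(3)] by (simp add: m_def)
  \<comment> \<open>With this level the L1 norm of the atom is at most \<open>m * t0\<close>, and
    \<open>t0 powr p * m = 1\<close>, so the final bound is free of \<open>m\<close>.\<close>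
  define t0 where "t0 = m powr - (1 / p)"
  have t0: "t0 > 0" using m by (simp add: t0_def)
  note aL = atom_L1[OF a(1,2) refl a(3)]
  have Dw0: "0 \<le> Dw" using C0_ge_1 by (simp add: Dw_def)
  define Q where "Q k E \<longleftrightarrow> E \<in> sets M \<and> emeasure M E \<le> ennreal (Dw * ((LINT x|M. cmod (a x)) / (2 ^ k * t0))) \<and>
    (\<forall>x. x \<notin> E \<longrightarrow> (\<forall>\<rho>>0. (LINT y|M. indicator (qball d x \<rho>) y * cmod (a y)) \<le> 2 ^ k * t0 * vol x \<rho>))"
    for k :: nat and E
  have "\<exists>E. Q k E" for k
    using weak_type[OF integrable_norm[OF aL(1)], of "2 ^ k * t0"] t0 unfolding Q_def Dw_def by auto
  then have "\<exists>E. \<forall>k. Q k (E k)" by (intro choice allI)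
  then obtain E where E: "\<And>k. E k \<in> sets M"
    "\<And>k. emeasure M (E k) \<le> ennreal (Dw * ((LINT x|M. cmod (a x)) / (2 ^ k * t0)))"
    and avg: "\<And>k x \<rho>. x \<notin> E k \<Longrightarrow> \<rho> > 0 \<Longrightarrow>
      (LINT y|M. indicator (qball d x \<rho>) y * cmod (a y)) \<le> 2 ^ k * t0 * vol x \<rho>"
    unfolding Q_def by blast
  note [measurable] = E(1)
  have E': "emeasure M (E k) \<le> ennreal (Dw * m * (1 / 2 ^ k))" for k
  proof -
    have "(LINT x|M. cmod (a x)) \<le> m powr - s" using aL(2) by (simp add: m_def)
    also have "m powr - s = m * t0"
      using m powr_add[of m 1 "- (1 / p)"] by (simp add: t0_def s_def)
    finally have "(LINT x|M. cmod (a x)) / (2 ^ k * t0) \<le> m * t0 / (2 ^ k * t0)"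
      using t0 by (intro divide_right_mono) auto
    also have "\<dots> = m * (1 / 2 ^ k)" using t0 by simp
    finally have "Dw * ((LINT x|M. cmod (a x)) / (2 ^ k * t0)) \<le> Dw * (m * (1 / 2 ^ k))"
      using Dw0 by (rule mult_left_mono)
    then show ?thesis
      using E(2)[of k] by (metis ennreal_leI mult.assoc order_trans)
  qed
  have pair: "cmod (act a \<phi>) \<le> Cn * (2 ^ k * t0)"
    if "x \<notin> E k" "0 < \<rho>" "\<phi> \<in> TC" "unit_test x \<rho> \<phi>" for x k \<phi> \<rho>
    using t0 by (intro near_pairing[OF aL(1) that(3,4,2)] avg that(1)) auto
  let ?q = "2 powr - (1 - p)"
  let ?b = "2 powr p"
  define c where "c = (Cn * t0) powr p"
  have c0: "0 \<le> c" by (simp add: c_def)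
  define G where "G x = ennreal c * (indicator ?N x + (\<Sum>k. ennreal (?b ^ Suc k) * indicator (E k \<inter> ?N) x))" for x
  have Gm: "G \<in> borel_measurable M" unfolding G_def by measurable
  have scale: "(Cn * (2 ^ k * t0)) powr p = c * ?b ^ k" for k
  proof -
    have "(Cn * (2 ^ k * t0)) powr p = (Cn * t0 * 2 ^ k) powr p" by (simp add: mult_ac)
    also have "\<dots> = c * (2 ^ k) powr p" using Cn_pos t0 by (simp add: c_def powr_mult)
    finally show ?thesis by (simp only: two_power_powr)
  qed
  have maj: "ennreal (cmod (act a \<phi>) powr p) \<le> G x"
    if x: "d z x < 2 * K0 * r" and \<phi>: "0 < \<rho>" "\<phi> \<in> TC" "unit_test x \<rho> \<phi>" for x \<phi> \<rho>
  proof (cases "x \<in> E 0")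
    case False
    have "cmod (act a \<phi>) powr p \<le> (Cn * (2 ^ 0 * t0)) powr p"
      using p_pos by (intro powr_mono2 pair[OF False \<phi>]) auto
    then have "ennreal (cmod (act a \<phi>) powr p) \<le> ennreal c * 1"
      unfolding scale by (simp add: ennreal_leI)
    also have "\<dots> \<le> G x"
      unfolding G_def using x by (intro mult_left_mono) auto
    finally show ?thesis .
  next
    case True
    let ?P = "cmod (act a \<phi>)"
    \<comment> \<open>The sets \<open>E k\<close> are chosen separately and need not be nested, so
      the least level whose set misses \<open>x\<close> is taken. It is positive since
      \<open>x\<close> lies in \<open>E 0\<close>, and the set one level below contains
      \<open>x\<close>.\<close>
    have "\<exists>k. x \<in> E k \<and> ?P \<le> Cn * (2 ^ Suc k * t0)"
    proof (cases "\<exists>k. x \<notin> E k")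
      case True
      define j where "j = (LEAST k. x \<notin> E k)"
      have j: "x \<notin> E j" unfolding j_def by (rule LeastI_ex[OF True])
      then obtain k where k: "j = Suc k" using \<open>x \<in> E 0\<close> by (cases j) auto
      then have "x \<in> E k" using not_less_Least[of k "\<lambda>k. x \<notin> E k"] by (auto simp: j_def)
      then show ?thesis using pair[OF j \<phi>] k by blast
    next
      case False
      \<comment> \<open>If \<open>x\<close> lies in every \<open>E k\<close>, the weak type bound
        says nothing at \<open>x\<close>; but the pairing is a finite number, and any sufficiently
        high level exceeds it.\<close>
      obtain k where "?P / (Cn * t0) < 2 ^ k" using real_arch_pow[of 2] by auto
      then have "?P < 2 ^ k * (Cn * t0)" using Cn_pos t0 by (simp add: pos_divide_less_eq)
      also have "\<dots> \<le> Cn * (2 ^ Suc k * t0)" using Cn_pos t0 by simp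
      finally show ?thesis using False by (intro exI[of _ k]) auto
    qed
    then obtain k where k: "x \<in> E k" "?P \<le> Cn * (2 ^ Suc k * t0)" by blast
    have "?P powr p \<le> (Cn * (2 ^ Suc k * t0)) powr p"
      using p_pos k(2) by (intro powr_mono2) auto
    then have "ennreal (?P powr p) \<le> ennreal c * ennreal (?b ^ Suc k)"
      unfolding scale using c0 by (subst ennreal_mult[symmetric]) (auto intro: ennreal_leI simp del: power_Suc)
    also have "\<dots> = ennreal c * (ennreal (?b ^ Suc k) * indicator (E k \<inter> ?N) x)"
      using k(1) x by simp
    also have "\<dots> \<le> ennreal c * (\<Sum>k. ennreal (?b ^ Suc k) * indicator (E k \<inter> ?N) x)"
      by (intro mult_left_mono le_suminf_ennreal) auto
    also have "\<dots> \<le> G x" unfolding G_def by (intro mult_left_mono) auto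
    finally show ?thesis .
  qed
  have Kr: "0 < 2 * K0 * r" using K0_ge_1 a(3) by simp
  let ?\<omega> = "Ct * V (rad z) powr (p - 1)"
  have \<omega>: "0 \<le> ?\<omega>" using Ct_nonneg by simp
  let ?e = "C0 * (2 * K0) powr n"
  have "wint G \<le> (\<integral>\<^sup>+ x. ennreal ?\<omega> * G x \<partial>M)"
  proof (rule nn_integral_mono)
    fix x
    show "ennreal (wt x) * G x \<le> ennreal ?\<omega> * G x"
    proof (cases "d z x < 2 * K0 * r")
      case True
      \<comment> \<open>Here the factor \<open>4 * K0\<^sup>2\<close> of \<open>small\<close> is
        spent: the enlarged ball of radius \<open>2 * K0 * r\<close> satisfies the hypothesis of
        \<open>wt_near\<close>, so a single bound on the density serves on all of it.\<close>
      have "2 * K0 * (2 * K0 * r) \<le> rad z" using sm by (simp add: small_def power2_eq_square mult_ac)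
      then show ?thesis using True by (intro mult_right_mono ennreal_leI wt_near) auto
    next
      case False
      then have "G x = 0" by (simp add: G_def)
      then show ?thesis by simp
    qed
  qed
  also have "\<dots> = ennreal ?\<omega> * (\<integral>\<^sup>+ x. G x \<partial>M)"
    by (rule nn_integral_cmult[OF Gm])
  also have "(\<integral>\<^sup>+ x. G x \<partial>M) = ennreal c * (emeasure M ?N + (\<Sum>k. ennreal (?b ^ Suc k) * emeasure M (E k \<inter> ?N)))"
    unfolding G_def by (simp add: nn_integral_cmult nn_integral_add nn_integral_suminf nn_integral_cmult_indicator)
  also have "\<dots> \<le> ennreal c * (ennreal (?e * m) + ennreal (?b * Dw * m / (1 - ?q)))"
  proof (intro mult_left_mono add_mono)
    show "emeasure M ?N \<le> ennreal (?e * m)"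
      unfolding emeasure_ball[OF Kr] m_def using K0_ge_1 a(3) by (intro ennreal_leI ball_growth) auto
    show "(\<Sum>k. ennreal (?b ^ Suc k) * emeasure M (E k \<inter> ?N)) \<le> ennreal (?b * Dw * m / (1 - ?q))"
    proof (rule suminf_geometric_le)
      fix k
      have "emeasure M (E k \<inter> ?N) \<le> emeasure M (E k)" by (intro emeasure_mono) auto
      also have "\<dots> \<le> ennreal (Dw * m * (1 / 2 ^ k))" by (rule E')
      finally have "ennreal (?b ^ Suc k) * emeasure M (E k \<inter> ?N) \<le> ennreal (?b ^ Suc k) * ennreal (Dw * m * (1 / 2 ^ k))"
        by (rule mult_left_mono) simp
      also have "\<dots> = ennreal (?b * Dw * m * (?b ^ k * (1 / 2 ^ k)))"
        using Dw0 m by (simp add: ennreal_mult[symmetric] mult_ac)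
      also have "?b ^ k * (1 / 2 ^ k) = ?q ^ k"
        by (simp add: powr_diff power_divide)
      finally show "ennreal (?b ^ Suc k) * emeasure M (E k \<inter> ?N) \<le> ennreal (?b * Dw * m * ?q ^ k)" .
    qed (use Dw0 m p_lt in auto)
  qed auto
  also have "\<dots> = ennreal (c * (?e * m + ?b * Dw * m / (1 - ?q)))"
    using c0 C0_ge_1 m Dw0 two_powr_neg_less[of "1 - p"] p_lt by (simp add: ennreal_mult ennreal_plus)
  also have "c * (?e * m + ?b * Dw * m / (1 - ?q))
    = Cn powr p * (?e + ?b * Dw / (1 - ?q))"
  proof -
    have "t0 powr p = m powr - 1" using p_pos by (simp only: t0_def powr_powr) simp
    then have "t0 powr p * m = 1" using m by (simp add: powr_minus)
    then have "c * m = Cn powr p" using Cn_pos t0 by (simp add: c_def powr_mult)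
    moreover have "c * (?e * m + ?b * Dw * m / (1 - ?q))
      = (c * m) * (?e + ?b * Dw / (1 - ?q))"
      by (simp add: algebra_simps)
    ultimately show ?thesis by simp
  qed
  finally have fin: "wint G \<le> ennreal ?\<omega> *
    ennreal (Cn powr p * (?e + ?b * Dw / (1 - ?q)))"
    by (simp add: mult_left_mono)
  also have "\<dots> = ennreal (Cnear * V (rad z) powr (p - 1))"
  proof -
    have "0 \<le> Cn powr p * (?e + ?b * Dw / (1 - ?q))"
      using C0_ge_1 Dw0 two_powr_neg_less[of "1 - p"] p_lt by simp
    then show ?thesis using \<omega> by (subst ennreal_mult[symmetric]) (auto simp: Cnear_def mult_ac)
  qed
  finally show ?thesis using Gm maj by blast
qed

definition Cf :: real where "Cf = cv * (C0 * 4 powr n) * 2 powr \<beta>"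

definition Ce :: real where "Ce = Cf * kap (2 * K0) * cv powr s * C0 powr s"

definition Cfar :: real where
  "Cfar = Cb * Ce powr p / (1 - 2 powr - ((\<beta> - n * s) * p))"

text \<open>The estimate of \<open>far_pairing\<close> is nearly constant on dyadic shells about
  \<open>z\<close>, and \<open>wt_ball\<close> controls the weight at every scale, also for balls
  that reach the base point.\<close>

lemma far_majorant:
  assumes a: "atom M p q (qball d z r) a" "1 < q" "r > 0"
  shows "\<exists>G\<in>borel_measurable M.
    (\<forall>x \<phi> \<rho>. 2 * K0 * r \<le> d z x \<longrightarrow> 0 < \<rho> \<longrightarrow> \<phi> \<in> TC \<longrightarrow> unit_test x \<rho> \<phi> \<longrightarrow>
      ennreal (cmod (act a \<phi>) powr p) \<le> G x) \<and>
    wint G \<le> ennreal (Cfar * V (rad z) powr (p - 1))"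
proof -
  define m where "m = vol z r"
  have m: "m > 0" using ball_measure_pos[OF a(3)] by (simp add: m_def)
  define T where "T k = 2 ^ k * (2 * K0 * r)" for k :: nat
  have Kr: "0 < 2 * K0 * r" using K0_ge_1 a(3) by simp
  then have T: "T k > 0" for k by (simp add: T_def)
  have Cf0: "0 \<le> Cf" using cv_pos C0_ge_1 by (simp add: Cf_def)
  define c where "c k = Cf * (1 / 2 ^ k) powr \<beta> / V (T k) * m powr - s" for k
  have c0: "0 \<le> c k" for k using Cf0 by (simp add: c_def)
  define G where "G x = (\<Sum>k. ennreal (c k powr p) * indicator (qball d z (T k)) x)" for x
  have Gm: "G \<in> borel_measurable M" unfolding G_def by measurable
  have maj: "ennreal (cmod (act a \<phi>) powr p) \<le> G x"
    if x: "2 * K0 * r \<le> d z x" and \<phi>: "0 < \<rho>" "\<phi> \<in> TC" "unit_test x \<rho> \<phi>" for x \<phi> \<rho>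
  proof -
    let ?\<delta> = "d z x"
    have \<delta>: "0 < ?\<delta>" using x Kr by linarith
    obtain k where k: "?\<delta> < T k" "T k \<le> 2 * (2 * K0 * r + ?\<delta>)"
      using dyadic_above[OF Kr dist_nonneg[of z x]] unfolding T_def by blast
    have "2 * (2 * K0 * r) \<le> 2 * ?\<delta>" using x by (rule mult_left_mono) simp
    then have k4: "T k \<le> 4 * ?\<delta>" using k(2) by (simp add: distrib_left)
    have "cmod (act a \<phi>) \<le> cv / V ?\<delta> * (r / ?\<delta>) powr \<beta> * m powr - s"
      unfolding m_def by (rule far_pairing[OF a \<phi>(2,3,1) x])
    also have "\<dots> \<le> (cv * (C0 * 4 powr n) / V (T k)) * (2 powr \<beta> * (1 / 2 ^ k) powr \<beta>) * m powr - s"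
    proof (intro mult_right_mono mult_mono[where c = "(r / ?\<delta>) powr \<beta>"])
      have "V (T k) \<le> C0 * 4 powr n * V ?\<delta>"
        using V_mono[OF k4] V_scale[of 4 ?\<delta>] by simp
      then have "1 / V ?\<delta> \<le> C0 * 4 powr n / V (T k)"
        using V_pos[OF \<delta>] V_pos[OF T[of k]] by (simp add: field_simps)
      then have "cv * (1 / V ?\<delta>) \<le> cv * (C0 * 4 powr n / V (T k))" using cv_pos by (intro mult_left_mono) auto
      then show "cv / V ?\<delta> \<le> cv * (C0 * 4 powr n) / V (T k)" by simp
      have "2 ^ k * r \<le> 2 * ?\<delta>"
      proof -
        have "2 ^ k * r * 2 \<le> T k" unfolding T_def using K0_ge_1 a(3) by simp
        then show ?thesis using k4 by linarith
      qed
      then have "r / ?\<delta> \<le> 2 * (1 / 2 ^ k)" using \<delta> by (simp add: field_simps)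
      then have "(r / ?\<delta>) powr \<beta> \<le> (2 * (1 / 2 ^ k)) powr \<beta>"
        using beta_pos a(3) \<delta> by (intro powr_mono2) auto
      also have "\<dots> = 2 powr \<beta> * (1 / 2 ^ k) powr \<beta>" by (subst powr_mult) auto
      finally show "(r / ?\<delta>) powr \<beta> \<le> 2 powr \<beta> * (1 / 2 ^ k) powr \<beta>" .
    qed (use cv_pos C0_ge_1 in auto)
    also have "\<dots> = c k" by (simp add: c_def Cf_def mult_ac)
    finally have "cmod (act a \<phi>) powr p \<le> c k powr p"
      using p_pos by (intro powr_mono2) auto
    then have "ennreal (cmod (act a \<phi>) powr p) \<le> ennreal (c k powr p) * indicator (qball d z (T k)) x"
      using k(1) by (simp add: ennreal_leI)
    also have "\<dots> \<le> G x" unfolding G_def by (rule le_suminf_ennreal)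
    finally show ?thesis .
  qed
  let ?q = "2 powr - ((\<beta> - n * s) * p)"
  \<comment> \<open>As \<open>1 / p = 1 + s\<close>, one factor \<open>V (T k)\<close> cancels the
    volume in \<open>c k\<close>, and \<open>V (T k) powr s\<close> remains. It grows like
    \<open>(2 ^ k) powr (n * s)\<close> against the decay
    \<open>(1 / 2 ^ k) powr \<beta>\<close>.\<close>
  have ck: "c k powr p * V (T k) \<le> Ce powr p * ?q ^ k" for k
  proof -
    have "V (T k) = (V (T k) powr (1 / p)) powr p" using p_pos by (simp add: powr_powr)
    then have "c k powr p * V (T k) = (c k * V (T k) powr (1 / p)) powr p"
      using c0[of k] by (simp add: powr_mult)
    also have "\<dots> \<le> (Ce * (1 / 2 ^ k) powr (\<beta> - n * s)) powr p"
    proof (intro powr_mono2)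
      have "V (T k) powr (1 / p) = V (T k) * V (T k) powr s"
        using V_pos[OF T[of k]] powr_add[of "V (T k)" 1 s] by (simp add: s_def)
      then have "c k * V (T k) powr (1 / p) = Cf * (1 / 2 ^ k) powr \<beta> * (V (T k) powr s * m powr - s)"
        using V_pos[OF T[of k]] by (simp add: c_def)
      also have "\<dots> \<le> Cf * (1 / 2 ^ k) powr \<beta> * (kap (2 ^ k) * kap (2 * K0) * cv powr s)"
      proof (intro mult_left_mono)
        have "V (T k) powr s \<le> kap (2 ^ k) * V (2 * K0 * r) powr s"
          unfolding T_def by (intro V_powr_scale) auto
        also have "\<dots> \<le> kap (2 ^ k) * (kap (2 * K0) * V r powr s)"
          using kap_pos[of "2 ^ k"] K0_ge_1 by (intro mult_left_mono V_powr_scale) auto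
        finally have "V (T k) powr s * m powr - s \<le> kap (2 ^ k) * kap (2 * K0) * (V r powr s * m powr - s)"
          by (simp add: mult.assoc[symmetric] mult_right_mono)
        also have "\<dots> \<le> kap (2 ^ k) * kap (2 * K0) * cv powr s"
          unfolding m_def using kap_pos[of "2 ^ k"] kap_pos[of "2 * K0"] K0_ge_1
          by (intro mult_left_mono V_ball_powr a(3)) auto
        finally show "V (T k) powr s * m powr - s \<le> kap (2 ^ k) * kap (2 * K0) * cv powr s" .
      qed (use Cf0 in auto)
      also have "\<dots> = Cf * kap (2 * K0) * cv powr s * (kap (2 ^ k) * (1 / 2 ^ k) powr \<beta>)"
        by (simp add: mult_ac)
      also have "kap (2 ^ k) * (1 / 2 ^ k) powr \<beta> = C0 powr s * (1 / 2 ^ k) powr (\<beta> - n * s)"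
        by (simp add: kap_eq powr_diff powr_divide)
      finally show "c k * V (T k) powr (1 / p) \<le> Ce * (1 / 2 ^ k) powr (\<beta> - n * s)"
        by (simp add: Ce_def mult.assoc)
    qed (use c0 p_pos in auto)
    also have "\<dots> = Ce powr p * (1 / 2 ^ k) powr ((\<beta> - n * s) * p)"
      by (simp add: powr_mult powr_powr)
    finally show ?thesis unfolding powr_geometric .
  qed
  have "wint G
    = (\<integral>\<^sup>+ x. (\<Sum>k. ennreal (c k powr p) * (ennreal (wt x) * indicator (qball d z (T k)) x)) \<partial>M)"
    unfolding G_def ennreal_suminf_cmult[symmetric] by (simp add: mult_ac)
  also have "\<dots> = (\<Sum>k. ennreal (c k powr p) * wint (indicator (qball d z (T k))))"
    by (simp add: nn_integral_suminf nn_integral_cmult)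
  also have "\<dots> \<le> ennreal ((Cb * Ce powr p * V (rad z) powr (p - 1)) / (1 - ?q))"
  proof (rule suminf_geometric_le)
    fix k
    have "ennreal (c k powr p) * wint (indicator (qball d z (T k)))
      \<le> ennreal (c k powr p) * ennreal (Cb * (V (T k) * V (rad z) powr (p - 1)))"
      by (intro mult_left_mono wt_ball T) auto
    also have "\<dots> = ennreal (Cb * V (rad z) powr (p - 1) * (c k powr p * V (T k)))"
      using Cb_nonneg by (simp add: ennreal_mult[symmetric] mult_ac)
    also have "\<dots> \<le> ennreal (Cb * V (rad z) powr (p - 1) * (Ce powr p * ?q ^ k))"
      using Cb_nonneg by (intro ennreal_leI mult_left_mono ck) auto
    finally show "ennreal (c k powr p) * wint (indicator (qball d z (T k)))
      \<le> ennreal (Cb * Ce powr p * V (rad z) powr (p - 1) * ?q ^ k)"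
      by (simp add: mult_ac)
  qed (use Cb_nonneg ns_beta p_pos in auto)
  also have "(Cb * Ce powr p * V (rad z) powr (p - 1)) / (1 - ?q) = Cfar * V (rad z) powr (p - 1)"
    by (simp add: Cfar_def)
  finally show ?thesis using Gm maj by blast
qed

end

section \<open>The product of a Lipschitz function with a series of atoms\<close>

context hardy_setting
begin

definition Cg :: real where "Cg = Cnear + Cfar"

lemma Cnear_nonneg: "0 \<le> Cnear" and Cfar_nonneg: "0 \<le> Cfar"
proof -
  have "0 \<le> Dw" using C0_ge_1 by (simp add: Dw_def)
  then show "0 \<le> Cnear"
    using Ct_nonneg C0_ge_1 two_powr_neg_less[of "1 - p"] p_lt by (simp add: Cnear_def)
  have "0 < (\<beta> - n * s) * p" using ns_beta p_pos by simp
  then show "0 \<le> Cfar"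
    using Cb_nonneg two_powr_neg_less[of "(\<beta> - n * s) * p"] by (simp add: Cfar_def)
qed

lemma atom_majorant:
  assumes a: "atom M p q (qball d z r) a" "1 < q" "r > 0" and sm: "small z r"
  shows "\<exists>G\<in>borel_measurable M.
    (\<forall>x \<phi> \<rho>. 0 < \<rho> \<longrightarrow> \<phi> \<in> TC \<longrightarrow> unit_test x \<rho> \<phi> \<longrightarrow>
      ennreal (cmod (act a \<phi>) powr p) \<le> G x) \<and>
    wint G \<le> ennreal (Cg * V (rad z) powr (p - 1))"
proof -
  obtain G1 where G1[measurable]: "G1 \<in> borel_measurable M"
    and m1: "\<And>x \<phi> \<rho>. d z x < 2 * K0 * r \<Longrightarrow> 0 < \<rho> \<Longrightarrow> \<phi> \<in> TC \<Longrightarrow> unit_test x \<rho> \<phi> \<Longrightarrow>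
      ennreal (cmod (act a \<phi>) powr p) \<le> G1 x"
    and i1: "wint G1 \<le> ennreal (Cnear * V (rad z) powr (p - 1))"
    using near_majorant[OF a sm] by blast
  obtain G2 where G2[measurable]: "G2 \<in> borel_measurable M"
    and m2: "\<And>x \<phi> \<rho>. 2 * K0 * r \<le> d z x \<Longrightarrow> 0 < \<rho> \<Longrightarrow> \<phi> \<in> TC \<Longrightarrow> unit_test x \<rho> \<phi> \<Longrightarrow>
      ennreal (cmod (act a \<phi>) powr p) \<le> G2 x"
    and i2: "wint G2 \<le> ennreal (Cfar * V (rad z) powr (p - 1))"
    using far_majorant[OF a] by blast
  show ?thesis
  proof (intro bexI[of _ "\<lambda>x. G1 x + G2 x"] conjI allI impI)
    fix x \<phi> \<rho> assume *: "0 < \<rho>" "\<phi> \<in> TC" "unit_test x \<rho> \<phi>"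
    show "ennreal (cmod (act a \<phi>) powr p) \<le> G1 x + G2 x"
    proof (cases "d z x < 2 * K0 * r")
      case True
      then show ?thesis using m1[OF True *] by (simp add: add_increasing2)
    next
      case False
      then show ?thesis using m2[OF _ *] by (simp add: add_increasing)
    qed
  next
    have "(\<integral>\<^sup>+ x. ennreal (wt x) * (G1 x + G2 x) \<partial>M)
      = wint G1 + wint G2"
      by (simp add: distrib_left nn_integral_add)
    also have "\<dots> \<le> ennreal (Cnear * V (rad z) powr (p - 1)) + ennreal (Cfar * V (rad z) powr (p - 1))"
      by (rule add_mono[OF i1 i2])
    also have "\<dots> = ennreal (Cg * V (rad z) powr (p - 1))"
      using Cnear_nonneg Cfar_nonneg by (subst ennreal_plus[symmetric]) (auto simp: Cg_def distrib_right)
    finally show "(\<integral>\<^sup>+ x. ennreal (wt x) * (G1 x + G2 x) \<partial>M) \<le> ennreal (Cg * V (rad z) powr (p - 1))" .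
  qed measurable
qed

lemma test_bound_mono:
  assumes "test_bound d M K0 x r b g \<phi> C" "C \<le> C'" "r > 0"
  shows "test_bound d M K0 x r b g \<phi> C'"
proof -
  have *: "u \<le> C' * w" if "u \<le> C * w" "0 \<le> w" for u w :: real
    using that mult_right_mono[OF assms(2) that(2)] by linarith
  show ?thesis
    unfolding test_bound_def mult.assoc
    by (intro conjI allI impI *) (use assms(1)[unfolded test_bound_def mult.assoc] in auto)
qed

lemma dist_of_fun_add:
  "integrable M u \<Longrightarrow> integrable M v \<Longrightarrow> \<phi> \<in> TC \<Longrightarrow>
    act (\<lambda>x. u x + v x) \<phi> = act u \<phi> + act v \<phi>"
  unfolding dist_of_fun_def distrib_right
  by (intro Bochner_Integration.integral_add integrable_mult_test)

lemma dist_of_fun_cmult: "act (\<lambda>x. c * u x) \<phi> = c * act u \<phi>"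
  unfolding dist_of_fun_def mult.assoc by (rule integral_mult_right_zero)

text \<open>The sum of the L1 norms is finite, so the series converges absolutely almost everywhere;
  on the exceptional null set the value of \<open>suminf\<close> is unspecified and does not affect
  the integrals.\<close>

lemma L1_series:
  assumes b: "\<And>i. integrable M (b i)" and s: "summable (\<lambda>i. LINT x|M. cmod (b i x))"
  shows "integrable M (\<lambda>x. \<Sum>i. b i x)"
    and "\<phi> \<in> TC \<Longrightarrow> act (\<lambda>x. \<Sum>i. b i x) \<phi> = (\<Sum>i. act (b i) \<phi>)"
proof -
  have [measurable]: "b i \<in> borel_measurable M" for i using b by (rule borel_measurable_integrable)
  have ae: "AE x in M. summable (\<lambda>i. norm (b i x))"
  proof -
    have "(\<integral>\<^sup>+ x. (\<Sum>i. ennreal (cmod (b i x))) \<partial>M) = (\<Sum>i. \<integral>\<^sup>+ x. ennreal (cmod (b i x)) \<partial>M)"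
      by (rule nn_integral_suminf) measurable
    also have "\<dots> = (\<Sum>i. ennreal (LINT x|M. cmod (b i x)))"
      using b by (intro suminf_cong nn_integral_eq_integral) auto
    also have "\<dots> = ennreal (\<Sum>i. LINT x|M. cmod (b i x))"
      using s by (intro suminf_ennreal2) auto
    finally have "(\<integral>\<^sup>+ x. (\<Sum>i. ennreal (cmod (b i x))) \<partial>M) \<noteq> \<infinity>" by simp
    then have "AE x in M. (\<Sum>i. ennreal (cmod (b i x))) \<noteq> \<infinity>"
      by (intro nn_integral_noteq_infinite) measurable
    then show ?thesis
      by eventually_elim (auto intro!: summable_suminf_not_top)
  qed
  show int: "integrable M (\<lambda>x. \<Sum>i. b i x)"
    by (rule integrable_suminf[OF b ae s])
  assume \<phi>: "\<phi> \<in> TC"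
  have [measurable]: "\<phi> \<in> borel_measurable M" by (rule test_measurable[OF \<phi>])
  let ?C = "nrm \<phi> * (cv / V 1)"
  have s': "summable (\<lambda>i. LINT x|M. norm (b i x * \<phi> x))"
  proof (rule summable_comparison_test'[OF summable_mult2[OF s, of ?C]])
    fix i
    have "(LINT x|M. norm (b i x * \<phi> x)) \<le> (LINT x|M. cmod (b i x) * ?C)"
    proof (rule integral_mono)
      show "integrable M (\<lambda>x. norm (b i x * \<phi> x))"
        using integrable_mult_test[OF b \<phi>] by (rule integrable_norm)
      show "norm (b i x * \<phi> x) \<le> cmod (b i x) * ?C" for x
        unfolding norm_mult by (intro mult_left_mono test_sup \<phi> norm_ge_zero)
    qed (use b in simp)
    then show "norm (LINT x|M. norm (b i x * \<phi> x)) \<le> (LINT x|M. cmod (b i x)) * ?C" by simp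
  qed
  have ae': "AE x in M. summable (\<lambda>i. norm (b i x * \<phi> x))"
    using ae by eventually_elim (simp add: norm_mult summable_mult2)
  have "act (\<lambda>x. \<Sum>i. b i x) \<phi> = (LINT x|M. (\<Sum>i. b i x * \<phi> x))"
    unfolding dist_of_fun_def
  proof (rule integral_cong_AE)
    show "AE x in M. (\<Sum>i. b i x) * \<phi> x = (\<Sum>i. b i x * \<phi> x)"
      using ae by eventually_elim (rule suminf_mult2[OF summable_norm_cancel])
    show "(\<lambda>x. (\<Sum>i. b i x) * \<phi> x) \<in> borel_measurable M"
      by (rule borel_measurable_integrable[OF integrable_mult_test[OF int \<phi>]])
    show "(\<lambda>x. \<Sum>i. b i x * \<phi> x) \<in> borel_measurable M"
      by (rule borel_measurable_integrable[OF integrable_suminf[OF integrable_mult_test[OF b \<phi>] ae' s']])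
  qed
  also have "\<dots> = (\<Sum>i. act (b i) \<phi>)"
    unfolding dist_of_fun_def by (rule integral_suminf[OF integrable_mult_test[OF b \<phi>] ae' s'])
  finally show "act (\<lambda>x. \<Sum>i. b i x) \<phi> = (\<Sum>i. act (b i) \<phi>)" .
qed

end

section \<open>The product along one decomposition\<close>

locale atomic_series = lip_setting +
  fixes q :: ereal and l :: "nat \<Rightarrow> complex" and a :: "nat \<Rightarrow> 'a \<Rightarrow> complex"
    and z :: "nat \<Rightarrow> 'a" and r :: "nat \<Rightarrow> real"
  assumes atoms: "\<And>i. atom M p q (qball d (z i) (r i)) (a i)" and q_gt: "1 < q"
    and r_pos: "\<And>i. 0 < r i" and l_summable: "summable (\<lambda>i. cmod (l i) powr p)"
begin

definition mn :: "nat \<Rightarrow> complex" where "mn i = mean M (qball d (z i) (r i)) f"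

definition S1 :: "('a \<Rightarrow> complex) \<Rightarrow> complex" where
  "S1 \<phi> = (\<Sum>i. act (\<lambda>x. l i * (f x - mn i) * a i x) \<phi>)"

definition S2 :: "('a \<Rightarrow> complex) \<Rightarrow> complex" where
  "S2 \<phi> = (\<Sum>i. act (\<lambda>x. l i * mn i * a i x) \<phi>)"

text \<open>A splitting of the product that differs from \<open>S1 + S2\<close>: on balls that are not small the
  whole product is integrable, so only the small balls are left for the Hardy space part.\<close>

definition cn :: "nat \<Rightarrow> complex" where "cn i = (if small (z i) (r i) then mn i else 0)"

abbreviation "loc_term i \<equiv> \<lambda>x. l i * (f x - mn i) * a i x"
abbreviation "mean_term i \<equiv> \<lambda>x. l i * mn i * a i x"
abbreviation "prod_term i \<equiv> \<lambda>x. l i * f x * a i x"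
abbreviation "rest_term i \<equiv> \<lambda>x. l i * ((f x - cn i) * a i x)"
abbreviation "small_term i \<equiv> \<lambda>x. l i * cn i * a i x"

lemma l_abs_summable: "summable (\<lambda>i. cmod (l i))"
  by (rule summable_powr_le_1(1)[OF p_pos p_lt _ l_summable]) simp

lemma a_integrable: "integrable M (a i)"
  by (rule atom_L1(1)[OF atoms q_gt refl r_pos])

lemma loc_integrable: "integrable M (\<lambda>x. (f x - mn i) * a i x)"
  and loc_bound: "(LINT x|M. cmod ((f x - mn i) * a i x)) \<le> A1 * cv powr s"
  unfolding mn_def using local_product[OF atoms q_gt r_pos] by auto

lemma term1_integrable: "integrable M (loc_term i)"
  unfolding mult.assoc by (intro integrable_mult_right loc_integrable)

lemma term2_integrable: "integrable M (mean_term i)"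
  by (intro integrable_mult_right a_integrable)

definition K1 :: real where "K1 = cv / V 1 * (A1 * cv powr s)"
definition K2 :: real where
  "K2 = (F + A1) * (cv / V 1 * (C0 * cv) powr s) + cv / V 1 * (F1 * cv powr s)"

lemma term1_bound:
  "\<phi> \<in> TC \<Longrightarrow> cmod (act (loc_term i) \<phi>) \<le> cmod (l i) * K1 * nrm \<phi>"
proof -
  assume \<phi>: "\<phi> \<in> TC"
  have "cmod (act (\<lambda>x. (f x - mn i) * a i x) \<phi>) \<le> cv / V 1 * (LINT x|M. cmod ((f x - mn i) * a i x)) * nrm \<phi>"
    by (rule dist_of_fun_bound[OF loc_integrable \<phi>])
  also have "\<dots> \<le> K1 * nrm \<phi>"
    unfolding K1_def using nrm_nonneg[OF \<phi>] cv_pos by (intro mult_right_mono mult_left_mono loc_bound) auto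
  finally show ?thesis
    unfolding mult.assoc dist_of_fun_cmult norm_mult by (intro mult_left_mono) auto
qed

lemma term2_bound:
  "\<phi> \<in> TC \<Longrightarrow> cmod (act (mean_term i) \<phi>) \<le> cmod (l i) * K2 * nrm \<phi>"
  unfolding dist_of_fun_cmult norm_mult mult.assoc K2_def mn_def
  by (intro mult_left_mono mean_pairing[OF atoms q_gt r_pos]) auto

lemma sums_S1: "dsums (\<lambda>i x. l i * (f x - mn i) * a i x) S1"
  unfolding S1_def by (intro distribution_sum[OF term1_integrable term1_bound] summable_mult2 l_abs_summable)

lemma sums_S2: "dsums (\<lambda>i x. l i * mn i * a i x) S2"
  unfolding S2_def by (intro distribution_sum[OF term2_integrable term2_bound] summable_mult2 l_abs_summable)

lemma product_eq: "l i * f x * a i x = l i * (f x - mn i) * a i x + l i * mn i * a i x"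
  by (simp add: algebra_simps)

lemma product_integrable: "integrable M (prod_term i)"
  unfolding product_eq by (intro Bochner_Integration.integrable_add term1_integrable term2_integrable)

lemma product_dist:
  "\<phi> \<in> TC \<Longrightarrow> act (prod_term i) \<phi> =
    act (loc_term i) \<phi> + act (mean_term i) \<phi>"
  unfolding product_eq by (intro dist_of_fun_add term1_integrable term2_integrable)

text \<open>The means have dropped out, so this form of the product no longer mentions the balls and
  can be compared between decompositions.\<close>

definition P :: "('a \<Rightarrow> complex) \<Rightarrow> complex" where
  "P \<phi> = (\<Sum>i. act (prod_term i) \<phi>)"

lemma sums_P: "dsums (\<lambda>i x. l i * f x * a i x) P"
  unfolding P_def
proof (rule distribution_sum[OF product_integrable])
  fix i \<phi> assume \<phi>: "\<phi> \<in> TC"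
  show "cmod (act (prod_term i) \<phi>) \<le> cmod (l i) * (K1 + K2) * nrm \<phi>"
    unfolding product_dist[OF \<phi>]
    using norm_triangle_mono[OF term1_bound[OF \<phi>] term2_bound[OF \<phi>]] by (simp add: algebra_simps)
qed (intro summable_mult2 l_abs_summable)

lemma P_eq: "\<phi> \<in> TC \<Longrightarrow> P \<phi> = S1 \<phi> + S2 \<phi>"
proof -
  assume \<phi>: "\<phi> \<in> TC"
  have "(\<lambda>i. act (prod_term i) \<phi>) sums (S1 \<phi> + S2 \<phi>)"
    unfolding product_dist[OF \<phi>] using sums_S1 sums_S2 \<phi>
    by (intro sums_add) (auto simp: sums_in_distributions_def)
  then show ?thesis by (simp add: P_def sums_iff)
qed

text \<open>On a small ball this is the local product, on any other ball the whole product; adding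
  both constants makes the bound independent of the case.\<close>

lemma rest_integrable: "integrable M (\<lambda>x. (f x - cn i) * a i x)"
  and rest_bound: "(LINT x|M. cmod ((f x - cn i) * a i x)) \<le> F1 * cv powr s + A1 * cv powr s"
proof -
  have pos: "0 \<le> F1 * cv powr s" "0 \<le> A1 * cv powr s" using F1_nonneg A1_nonneg by auto
  have "integrable M (\<lambda>x. (f x - cn i) * a i x) \<and>
    (LINT x|M. cmod ((f x - cn i) * a i x)) \<le> F1 * cv powr s + A1 * cv powr s"
  proof (cases "small (z i) (r i)")
    case True
    then show ?thesis using loc_integrable[of i] loc_bound[of i] pos by (simp add: cn_def)
  next
    case False
    then show ?thesis using big_product[OF atoms q_gt r_pos False] pos by (simp add: cn_def)
  qed
  then show "integrable M (\<lambda>x. (f x - cn i) * a i x)"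
    "(LINT x|M. cmod ((f x - cn i) * a i x)) \<le> F1 * cv powr s + A1 * cv powr s" by auto
qed

definition u :: "'a \<Rightarrow> complex" where "u x = (\<Sum>i. l i * ((f x - cn i) * a i x))"

definition v :: "('a \<Rightarrow> complex) \<Rightarrow> complex" where
  "v \<phi> = (\<Sum>i. act (small_term i) \<phi>)"

lemma u_integrable: "integrable M u"
  and u_dist: "\<phi> \<in> TC \<Longrightarrow> act u \<phi> = (\<Sum>i. act (rest_term i) \<phi>)"
  and u_summable: "\<phi> \<in> TC \<Longrightarrow> summable (\<lambda>i. act (rest_term i) \<phi>)"
proof -
  have b: "integrable M (rest_term i)" for i
    by (intro integrable_mult_right rest_integrable)
  have n: "(LINT x|M. cmod (l i * ((f x - cn i) * a i x))) \<le> cmod (l i) * (F1 * cv powr s + A1 * cv powr s)" for i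
    unfolding norm_mult[of "l i"] by (simp only: integral_mult_right_zero) (intro mult_left_mono rest_bound norm_ge_zero)
  have s: "summable (\<lambda>i. LINT x|M. cmod (l i * ((f x - cn i) * a i x)))"
    using n by (intro summable_comparison_test'[OF summable_mult2[OF l_abs_summable, of "F1 * cv powr s + A1 * cv powr s"]]) auto
  show "integrable M u" unfolding u_def by (rule L1_series(1)[OF b s])
  show "act u \<phi> = (\<Sum>i. act (rest_term i) \<phi>)" if "\<phi> \<in> TC" for \<phi>
    unfolding u_def by (rule L1_series(2)[OF b s that])
  show "summable (\<lambda>i. act (rest_term i) \<phi>)" if "\<phi> \<in> TC" for \<phi>
  proof (rule summable_norm_cancel, rule summable_comparison_test'[OF summable_mult2[OF summable_mult[OF s, of "cv / V 1"], of "nrm \<phi>"]])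
    show "norm (norm (act (rest_term i) \<phi>))
      \<le> cv / V 1 * (LINT x|M. cmod (l i * ((f x - cn i) * a i x))) * nrm \<phi>" for i
      using dist_of_fun_bound[OF b that] by simp
  qed
qed

lemma v_term_bound:
  assumes \<phi>: "\<phi> \<in> TC"
  shows "cmod (act (small_term i) \<phi>) \<le> cmod (l i) * K2 * nrm \<phi>"
proof (cases "small (z i) (r i)")
  case True
  then have "cn i = mn i" by (simp add: cn_def)
  then show ?thesis using term2_bound[OF \<phi>] by simp
next
  case False
  then have "act (small_term i) \<phi> = 0" by (simp add: cn_def dist_of_fun_def)
  moreover have "0 \<le> K2" using F_nonneg A1_nonneg F1_nonneg cv_pos by (simp add: K2_def)
  ultimately show ?thesis using nrm_nonneg[OF \<phi>] by simp
qed

lemma sums_v: "dsums (\<lambda>i x. l i * cn i * a i x) v"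
  unfolding v_def
  by (intro distribution_sum[OF _ v_term_bound] summable_mult2 l_abs_summable integrable_mult_right a_integrable)

text \<open>Only small balls contribute, as \<open>cn\<close> vanishes on the others. There
  \<open>cmod (cn i) powr p\<close> is at most a multiple of
  \<open>V (rad (z i)) powr (1 - p)\<close>, the inverse of the factor in
  \<open>atom_majorant\<close>, so all \<open>G i\<close> have uniformly bounded integrals. The
  inequality between the sum and the sum of p-th powers then bounds every pairing of
  \<open>v\<close> by \<open>w\<close>.\<close>

lemma v_Hardy: "v \<in> Hardy_space d M K0 x0 \<epsilon> \<beta> \<gamma> p (tau d M K0 C0 x0 p)"
proof -
  define Q where "Q i G \<longleftrightarrow> G \<in> borel_measurable M \<and>
    (\<forall>x \<phi> \<rho>. 0 < \<rho> \<longrightarrow> \<phi> \<in> TC \<longrightarrow> unit_test x \<rho> \<phi> \<longrightarrow>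
      ennreal ((cmod (cn i) * cmod (act (a i) \<phi>)) powr p) \<le> G x) \<and>
    wint G \<le> ennreal ((F + A1) powr p * Cg)" for i G
  have FA: "0 \<le> F + A1" using F_nonneg A1_nonneg by simp
  have "\<exists>G. Q i G" for i
  proof (cases "small (z i) (r i)")
    case True
    obtain G where [measurable]: "G \<in> borel_measurable M"
      and G: "\<And>x \<phi> \<rho>. 0 < \<rho> \<Longrightarrow> \<phi> \<in> TC \<Longrightarrow> unit_test x \<rho> \<phi> \<Longrightarrow>
        ennreal (cmod (act (a i) \<phi>) powr p) \<le> G x"
      "wint G \<le> ennreal (Cg * V (rad (z i)) powr (p - 1))"
      using atom_majorant[OF atoms q_gt r_pos True] by blast
    let ?V = "V (rad (z i))"
    let ?c = "cmod (cn i) powr p"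
    have "Q i (\<lambda>x. ennreal ?c * G x)"
      unfolding Q_def
    proof (intro conjI allI impI)
      fix x \<phi> \<rho> assume "0 < \<rho>" "\<phi> \<in> TC" "unit_test x \<rho> \<phi>"
      then show "ennreal ((cmod (cn i) * cmod (act (a i) \<phi>)) powr p) \<le> ennreal ?c * G x"
        using G(1) by (simp add: powr_mult ennreal_mult mult_left_mono)
    next
      have "cmod (cn i) \<le> (F + A1) * ?V powr s"
        using mean_small[OF r_pos True] True by (simp add: cn_def mn_def)
      then have "?c \<le> ((F + A1) * ?V powr s) powr p"
        using p_pos by (intro powr_mono2) auto
      also have "\<dots> = (F + A1) powr p * ?V powr (1 - p)"
        using FA p_pos by (simp add: powr_mult powr_powr s_def left_diff_distrib)
      finally have c: "?c \<le> (F + A1) powr p * ?V powr (1 - p)" .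
      have one: "?V powr (1 - p) * ?V powr (p - 1) = 1"
        using V_pos[OF rad_pos, of "z i"] by (simp add: powr_add[symmetric])
      have "(\<integral>\<^sup>+ x. ennreal (wt x) * (ennreal ?c * G x) \<partial>M) = ennreal ?c * wint G"
        by (simp add: nn_integral_cmult[symmetric] mult_ac)
      also have "\<dots> \<le> ennreal ((F + A1) powr p * ?V powr (1 - p)) * ennreal (Cg * ?V powr (p - 1))"
        by (intro mult_mono ennreal_leI c G(2)) auto
      also have "\<dots> = ennreal ((F + A1) powr p * Cg * (?V powr (1 - p) * ?V powr (p - 1)))"
        using Cnear_nonneg Cfar_nonneg by (simp add: ennreal_mult[symmetric] Cg_def mult_ac)
      finally show "(\<integral>\<^sup>+ x. ennreal (wt x) * (ennreal ?c * G x) \<partial>M) \<le> ennreal ((F + A1) powr p * Cg)"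
        unfolding one by simp
    qed measurable
    then show ?thesis by blast
  next
    case False
    then have "Q i (\<lambda>x. 0)" by (simp add: Q_def cn_def)
    then show ?thesis by blast
  qed
  then have "\<exists>G. \<forall>i. Q i (G i)" by (intro choice allI)
  then obtain G where G: "\<And>i. G i \<in> borel_measurable M"
    and maj: "\<And>i x \<phi> \<rho>. 0 < \<rho> \<Longrightarrow> \<phi> \<in> TC \<Longrightarrow> unit_test x \<rho> \<phi> \<Longrightarrow>
      ennreal ((cmod (cn i) * cmod (act (a i) \<phi>)) powr p) \<le> G i x"
    and int: "\<And>i. wint (G i) \<le> ennreal ((F + A1) powr p * Cg)"
    unfolding Q_def by blast
  note [measurable] = G
  let ?N = "tau d M K0 C0 x0 p"
  define H where "H x = (\<Sum>i. ennreal (cmod (l i) powr p) * G i x)" for x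
  have Hm[measurable]: "H \<in> borel_measurable M" unfolding H_def by measurable
  have Cg0: "0 \<le> Cg" using Cnear_nonneg Cfar_nonneg by (simp add: Cg_def)
  have "(\<integral>\<^sup>+ x. H x \<partial>?N) = wint H"
    unfolding tau_eq by (rule nn_integral_density) measurable
  also have "\<dots> = (\<integral>\<^sup>+ x. (\<Sum>i. ennreal (cmod (l i) powr p) * (ennreal (wt x) * G i x)) \<partial>M)"
    unfolding H_def ennreal_suminf_cmult[symmetric] by (simp add: mult_ac)
  also have "\<dots> = (\<Sum>i. ennreal (cmod (l i) powr p) * wint (G i))"
    by (simp add: nn_integral_suminf nn_integral_cmult)
  also have "\<dots> \<le> (\<Sum>i. ennreal (cmod (l i) powr p * ((F + A1) powr p * Cg)))"
  proof (intro suminf_le)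
    show "ennreal (cmod (l i) powr p) * wint (G i)
      \<le> ennreal (cmod (l i) powr p * ((F + A1) powr p * Cg))" for i
      using Cg0 by (subst ennreal_mult) (auto intro: mult_left_mono int)
  qed auto
  also have "\<dots> = ennreal (\<Sum>i. cmod (l i) powr p * ((F + A1) powr p * Cg))"
    using Cg0 by (intro suminf_ennreal2 summable_mult2 l_summable) auto
  finally have Hint: "(\<integral>\<^sup>+ x. H x \<partial>?N) < \<infinity>"
    by (rule le_less_trans) simp
  have [measurable]: "H \<in> borel_measurable ?N" unfolding tau_eq by simp
  have Hfin: "AE x in ?N. H x \<noteq> \<infinity>"
    using Hint by (intro nn_integral_noteq_infinite) auto
  \<comment> \<open>\<open>enn2real\<close> sends infinity to 0, so the bound by \<open>w\<close> is
    claimed only where \<open>H\<close> is finite, which is almost everywhere.\<close>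
  define w where "w x = enn2real (H x) powr (1 / p)" for x
  have wp: "w x powr p = enn2real (H x)" for x
    using p_pos by (simp add: w_def powr_powr)
  have vdist: "v \<in> dists"
    using sums_v by (simp add: sums_in_distributions_def)
  have "in_Lp ?N p (gmax v)"
    unfolding in_Lp_def
  proof (intro exI[of _ w] conjI allI)
    show "w \<in> borel_measurable ?N" unfolding w_def by measurable
    show "0 \<le> w x" for x by (simp add: w_def)
    show "integrable ?N (\<lambda>x. w x powr p)"
      unfolding wp
    proof (rule integrableI_nonneg)
      have "(\<integral>\<^sup>+ x. ennreal (enn2real (H x)) \<partial>?N) \<le> (\<integral>\<^sup>+ x. H x \<partial>?N)"
        by (intro nn_integral_mono) (simp add: ennreal_enn2real_if)
      then show "(\<integral>\<^sup>+ x. ennreal (enn2real (H x)) \<partial>?N) < \<infinity>" using Hint by (rule le_less_trans)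
    qed auto
    show "AE x in ?N. gmax v x \<le> ennreal (w x)"
      using Hfin
    proof eventually_elim
      fix x assume Hx: "H x \<noteq> \<infinity>"
      have "cmod (v \<phi>) \<le> w x"
        if \<phi>: "\<phi> \<in> TC" "\<rho> > 0" "unit_test x \<rho> \<phi>" for \<phi> \<rho>
      proof -
        define t where "t i = cmod (l i) * (cmod (cn i) * cmod (act (a i) \<phi>))" for i
        have t0: "0 \<le> t i" for i by (simp add: t_def)
        have "ennreal (t i powr p) \<le> ennreal (cmod (l i) powr p) * G i x" for i
          using maj[OF \<phi>(2,1,3), of i] by (simp add: t_def powr_mult ennreal_mult mult_left_mono)
        then have le: "(\<Sum>i. ennreal (t i powr p)) \<le> H x"
          unfolding H_def by (intro suminf_le) auto
        then have ne: "(\<Sum>i. ennreal (t i powr p)) \<noteq> top" using Hx by (auto simp: top_unique)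
        have sm: "summable (\<lambda>i. t i powr p)"
          by (rule summable_suminf_not_top[OF _ ne]) simp
        have "ennreal (\<Sum>i. t i powr p) \<le> H x"
          using le sm by (simp add: suminf_ennreal2)
        then have "(\<Sum>i. t i powr p) \<le> enn2real (H x)"
          using enn2real_mono[of "ennreal (\<Sum>i. t i powr p)" "H x"] Hx suminf_nonneg[OF sm] by (simp add: less_top)
        then have "(\<Sum>i. t i powr p) powr (1 / p) \<le> w x"
          unfolding w_def using p_pos sm by (intro powr_mono2 suminf_nonneg) auto
        moreover have "(\<Sum>i. t i) \<le> (\<Sum>i. t i powr p) powr (1 / p)"
          by (rule summable_powr_le_1(2)[OF p_pos p_lt t0 sm])
        moreover have "cmod (v \<phi>) \<le> (\<Sum>i. t i)"
        proof -
          have eq: "norm (act (small_term i) \<phi>) = t i" for i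
            unfolding dist_of_fun_cmult by (simp add: t_def norm_mult)
          show ?thesis
            unfolding v_def eq[symmetric] using summable_powr_le_1(1)[OF p_pos p_lt t0 sm] eq
            by (intro summable_norm) simp
        qed
        ultimately show ?thesis by linarith
      qed
      \<comment> \<open>The members of the supremum have norm at most 1; since the norm is an
        admissible constant, they satisfy \<open>unit_test\<close>.\<close>
      then show "gmax v x \<le> ennreal (w x)"
        unfolding grand_maximal_def
        by (intro SUP_least) (auto intro!: ennreal_leI dest: test_bound_mono[OF test_norm_attained])
    qed
  qed
  then show ?thesis using vdist by (simp add: Hardy_space_def)
qed

text \<open>The terms of the product are regrouped with \<open>cn\<close> in place of
  \<open>mn\<close>, which moves the means over balls that are not small into the integrable
  part.\<close>

lemma P_L1_plus_Hardy: "P \<in> product_space"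
  unfolding L1_plus_Hardy_def
proof (intro CollectI conjI exI ballI)
  show "P \<in> dists"
    using sums_P by (simp add: sums_in_distributions_def)
  show "integrable M u" by (rule u_integrable)
  show "acts_as_distribution d M K0 x0 \<epsilon> \<beta> \<gamma> u" by (rule integrable_acts[OF u_integrable])
  show "v \<in> Hardy_space d M K0 x0 \<epsilon> \<beta> \<gamma> p (tau d M K0 C0 x0 p)" by (rule v_Hardy)
  fix \<phi> assume \<phi>: "\<phi> \<in> TC"
  have eq: "act (prod_term i) \<phi> =
    act (rest_term i) \<phi> + act (small_term i) \<phi>" for i
  proof -
    have "(prod_term i) = (\<lambda>x. l i * ((f x - cn i) * a i x) + l i * cn i * a i x)"
      by (simp add: algebra_simps)
    then show ?thesis
      by (simp only:) (intro dist_of_fun_add integrable_mult_right rest_integrable a_integrable \<phi>)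
  qed
  have "(\<lambda>i. act (prod_term i) \<phi>) sums (act u \<phi> + v \<phi>)"
    unfolding eq u_dist[OF \<phi>]
    using sums_v \<phi> u_summable[OF \<phi>] by (intro sums_add summable_sums) (auto simp: sums_in_distributions_def)
  then show "P \<phi> = act u \<phi> + v \<phi>" by (simp add: P_def sums_iff)
qed

end

section \<open>Independence of the decomposition\<close>

context hardy_setting
begin

section \<open>Compactly supported Holder functions as test functions\<close>

lemma V_powr_growth:
  assumes "0 < r" "r \<le> R"
  shows "V R powr s \<le> C0 powr s * (R / r) powr (n * s) * V r powr s"
proof -
  have "V R powr s \<le> kap (R / r) * V r powr s"
    using assms by (intro V_powr_le) auto
  also have "kap (R / r) = C0 powr s * (R / r) powr (n * s)"
    using assms by (intro kap_eq) auto
  finally show ?thesis .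
qed

lemma rad_div_le: "rad x / (2 * K0) \<le> rad x"
  using K0_ge_1 rad_pos[of x] by (simp add: field_simps)

text \<open>Where \<open>rad x \<le> P\<close> the weights of the test space are bounded below and
  the Holder order drops from \<open>\<theta>\<close> to \<open>\<epsilon>\<close> at the cost of a
  power of \<open>P\<close>; elsewhere \<open>h\<close> vanishes at both points to be
  compared.\<close>

lemma smooth_test_space:
  fixes h :: "'a \<Rightarrow> complex"
  assumes B: "\<And>x. cmod (h x) \<le> B" and supp: "\<And>x. \<rho> \<le> d x0 x \<Longrightarrow> h x = 0" and \<rho>: "0 \<le> \<rho>"
    and H: "\<And>x y. cmod (h x - h y) \<le> H * d x y powr \<theta>" "0 \<le> H"
  shows "h \<in> test_space d M K0 x0 1 \<epsilon> \<epsilon>"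
proof -
  \<comment> \<open>If \<open>d x0 y < \<rho>\<close> and
    \<open>d x y \<le> rad x / (2 * K0)\<close>, then
    \<open>d x0 x \<le> K0 * \<rho> + rad x / 2\<close>, and solving for \<open>rad x\<close> gives
    this bound.\<close>
  define P where "P = 2 * K0 * \<rho> + 2"
  have P1: "1 \<le> P" using \<rho> K0_ge_1 by (simp add: P_def)
  have B0: "0 \<le> B" using B[of x0] norm_ge_zero order_trans by blast
  let ?w = "cv * V P * P powr \<epsilon>"
  define W where "W x = (1 / vol x (1 + d x x0)) * (1 / (1 + d x0 x)) powr \<epsilon>" for x
  have W: "1 \<le> ?w * W x" if "rad x \<le> P" for x
  proof -
    have m: "0 < vol x (rad x)" by (rule ball_measure_pos[OF rad_pos])
    have "vol x (rad x) \<le> cv * V P"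
      using ball_le_V[of x "rad x"] V_mono[OF that] cv_pos by (meson mult_left_mono less_imp_le order_trans)
    then have 1: "1 \<le> cv * V P * (1 / vol x (rad x))"
      using m by (simp add: pos_le_divide_eq)
    have "1 \<le> (P * (1 / rad x)) powr \<epsilon>"
      using that rad_pos[of x] eps by (intro ge_one_powr_ge_zero) (auto simp: pos_le_divide_eq)
    then have 2: "1 \<le> P powr \<epsilon> * (1 / rad x) powr \<epsilon>"
      using P1 rad_pos[of x] by (subst powr_mult[symmetric]) auto
    have "1 * 1 \<le> (cv * V P * (1 / vol x (rad x))) * (P powr \<epsilon> * (1 / rad x) powr \<epsilon>)"
      using 1 2 by (intro mult_mono) auto
    also have "\<dots> = ?w * W x"
      by (simp add: W_def rad_def dist_sym[of x x0])
    finally show ?thesis by simp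
  qed
  have W0: "0 \<le> W x" for x by (simp add: W_def)
  have rad_x: "rad x \<le> P" if "d x0 x < \<rho>" for x
  proof -
    have "1 * \<rho> \<le> 2 * K0 * \<rho>" using K0_ge_1 \<rho> by (intro mult_right_mono) auto
    then show ?thesis using that by (simp add: rad_def P_def)
  qed
  let ?C = "(B + H * P powr \<theta>) * ?w"
  have CB: "B * ?w \<le> ?C" and CH: "H * P powr \<theta> * ?w \<le> ?C"
  proof -
    have "0 \<le> ?w" using cv_pos by simp
    then show "B * ?w \<le> ?C" "H * P powr \<theta> * ?w \<le> ?C"
      by (rule mult_right_mono[rotated], use B0 H(2) in simp)+
  qed
  have "test_bound d M K0 x0 1 \<epsilon> \<epsilon> h ?C"
    unfolding test_bound_def
  proof (intro conjI allI impI)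
    fix x
    have "cmod (h x) \<le> ?C * W x"
    proof (cases "d x0 x < \<rho>")
      case True
      have "cmod (h x) \<le> B * 1" using B by simp
      also have "\<dots> \<le> B * (?w * W x)"
        using B0 W[OF rad_x[OF True]] by (rule mult_left_mono[rotated])
      also have "\<dots> \<le> ?C * W x"
        using mult_right_mono[OF CB W0[of x]] by (simp only: mult.assoc)
      finally show ?thesis .
    next
      case False
      then show ?thesis using supp[of x] W0[of x] B0 H(2) cv_pos by simp
    qed
    then show "cmod (h x) \<le> ?C * (1 / vol x (1 + d x x0)) * (1 / (1 + d x0 x)) powr \<epsilon>"
      by (simp add: W_def mult.assoc)
    fix y assume y: "d x y \<le> (1 + d x0 x) / (2 * K0)"
    let ?q = "(d x y / rad x) powr \<epsilon>"
    have "cmod (h x - h y) \<le> ?C * ?q * W x"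
    proof (cases "d x0 x < \<rho> \<or> d x0 y < \<rho>")
      case True
      have rP: "rad x \<le> P"
      proof (cases "d x0 x < \<rho>")
        case False
        then have *: "d x0 y < \<rho>" using True by simp
        have "d x0 x \<le> K0 * (d x0 y + d y x)" by (rule quasi_triangle)
        also have "\<dots> \<le> K0 * (\<rho> + rad x / (2 * K0))"
          using * y K0_ge_1 by (intro mult_left_mono) (auto simp: dist_sym[of y x] rad_def)
        also have "\<dots> = K0 * \<rho> + rad x / 2" using K0_ge_1 by (simp add: field_simps)
        finally have "d x0 x \<le> K0 * \<rho> + rad x / 2" .
        then have "rad x \<le> 2 * (K0 * \<rho>) + 2" unfolding rad_def add_divide_distrib by linarith
        then show ?thesis by (simp only: P_def mult.assoc)
      qed (rule rad_x)
      have dP: "d x y \<le> P"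
      proof -
        show ?thesis using rad_div_le[of x] y rP by (simp add: rad_def)
      qed
      have "d x y powr \<theta> = d x y powr \<epsilon> * d x y powr (\<theta> - \<epsilon>)"
        using dist_nonneg[of x y] by (simp add: powr_add[symmetric])
      also have "\<dots> \<le> d x y powr \<epsilon> * P powr (\<theta> - \<epsilon>)"
        using dP eps dist_nonneg by (intro mult_left_mono powr_mono2) auto
      also have "d x y powr \<epsilon> = ?q * rad x powr \<epsilon>"
        using rad_pos[of x] dist_nonneg[of x y] by (simp add: powr_divide)
      also have "\<dots> * P powr (\<theta> - \<epsilon>) \<le> ?q * P powr \<epsilon> * P powr (\<theta> - \<epsilon>)"
        using rP rad_pos[of x] eps by (intro mult_right_mono mult_left_mono powr_mono2) auto
      also have "\<dots> = ?q * P powr \<theta>"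
        by (simp add: mult.assoc powr_add[symmetric])
      finally have "H * d x y powr \<theta> \<le> H * (?q * P powr \<theta>)"
        by (rule mult_left_mono[OF _ H(2)])
      then have "cmod (h x - h y) \<le> H * P powr \<theta> * ?q * 1"
        using H(1)[of x y] by (simp add: mult_ac)
      also have "\<dots> \<le> H * P powr \<theta> * ?q * (?w * W x)"
        using W[OF rP] H(2) by (intro mult_left_mono) auto
      also have "\<dots> = H * P powr \<theta> * ?w * (?q * W x)"
        by (simp add: mult_ac)
      also have "\<dots> \<le> ?C * (?q * W x)"
        using W0[of x] by (intro mult_right_mono[OF CH]) auto
      finally show ?thesis by (simp add: mult.assoc)
    next
      case False
      then show ?thesis using supp[of x] supp[of y] W0[of x] B0 H(2) cv_pos by simp
    qed
    then show "cmod (h x - h y) \<le> ?C * (d x y / (1 + d x0 x)) powr \<epsilon> * (1 / vol x (1 + d x x0))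
      * (1 / (1 + d x0 x)) powr \<epsilon>"
      by (simp add: W_def rad_def mult.assoc)
  qed
  then show ?thesis by (auto simp: test_space_def)
qed

text \<open>All bases of powers lie between 0 and 1, where lowering the exponent increases the
  power; then \<open>h\<close> approximates itself.\<close>

lemma test_space_closure: "test_space d M K0 x0 1 \<epsilon> \<epsilon> \<subseteq> TC"
proof
  fix h assume h: "h \<in> test_space d M K0 x0 1 \<epsilon> \<epsilon>"
  then obtain C where C: "test_bound d M K0 x0 1 \<epsilon> \<epsilon> h C" by (auto simp: test_space_def)
  have C0: "0 \<le> C" by (rule test_bound_nonneg[OF _ C]) simp
  have "test_bound d M K0 x0 1 \<beta> \<gamma> h C"
    unfolding test_bound_def
  proof (intro conjI allI impI)
    fix x
    let ?m = "1 / vol x (1 + d x x0)"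
    have g: "(1 / (1 + d x0 x)) powr \<epsilon> \<le> (1 / (1 + d x0 x)) powr \<gamma>"
      using gamma dist_nonneg[of x0 x] by (intro powr_mono') auto
    have "cmod (h x) \<le> C * ?m * (1 / (1 + d x0 x)) powr \<epsilon>"
      using C by (simp add: test_bound_def)
    also have "\<dots> \<le> C * ?m * (1 / (1 + d x0 x)) powr \<gamma>"
      using C0 by (intro mult_left_mono g) auto
    finally show "cmod (h x) \<le> C * ?m * (1 / (1 + d x0 x)) powr \<gamma>" .
    fix y assume y: "d x y \<le> (1 + d x0 x) / (2 * K0)"
    have "d x y / (1 + d x0 x) \<le> 1" using rad_div_le[of x] y rad_pos[of x] by (simp add: rad_def)
    then have b: "(d x y / (1 + d x0 x)) powr \<epsilon> \<le> (d x y / (1 + d x0 x)) powr \<beta>"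
      using beta dist_nonneg[of x y] rad_pos[of x] by (intro powr_mono') (auto simp: rad_def)
    have "cmod (h x - h y) \<le> C * (d x y / (1 + d x0 x)) powr \<epsilon> * ?m
        * (1 / (1 + d x0 x)) powr \<epsilon>"
      using C y by (simp add: test_bound_def)
    also have "\<dots> \<le> C * (d x y / (1 + d x0 x)) powr \<beta> * ?m
        * (1 / (1 + d x0 x)) powr \<gamma>"
      using C0 by (intro mult_mono[OF mult_right_mono[OF mult_left_mono[OF b]] g]) auto
    finally show "cmod (h x - h y) \<le> C * (d x y / (1 + d x0 x)) powr \<beta> * ?m
        * (1 / (1 + d x0 x)) powr \<gamma>" .
  qed
  moreover have "test_norm d M K0 x0 1 \<beta> \<gamma> (\<lambda>x. h x - h x) \<le> 0"
    unfolding test_norm_def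
  proof (rule cInf_lower)
    show "bdd_below {C. test_bound d M K0 x0 1 \<beta> \<gamma> (\<lambda>x. h x - h x) C}"
      by (intro bdd_belowI[of _ 0]) (auto intro: test_bound_nonneg[of 1])
  qed (simp add: test_bound_def)
  ultimately show "h \<in> TC"
    using h unfolding test_closure_def test_space_def by (auto intro!: bexI[of _ h] elim: le_less_trans)
qed

section \<open>Regularization by sup-convolution\<close>

lemma ns_lt_1: "n * s < 1"
  using ns_beta beta_lt_1 by linarith

text \<open>The solution of \<open>C0 powr s * w powr (n * s) = w\<close>. Beyond it a linear
  penalty exceeds the growth of a Lipschitz function, which is sublinear because
  \<open>n * s < 1\<close>.\<close>

definition wid :: real where "wid = (C0 powr s) powr (1 / (1 - n * s))"

lemma wid_ge_1: "1 \<le> wid"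
  using C0_ge_1 s_pos ns_lt_1 by (simp add: wid_def ge_one_powr_ge_zero)

lemma wid: "wid \<le> w \<Longrightarrow> C0 powr s * w powr (n * s) \<le> w"
proof -
  assume w: "wid \<le> w"
  then have w1: "1 \<le> w" using wid_ge_1 by linarith
  have "wid powr (1 - n * s) = C0 powr s"
    using ns_lt_1 C0_ge_1 by (simp add: wid_def powr_powr)
  then have "C0 powr s \<le> w powr (1 - n * s)"
    using w wid_ge_1 ns_lt_1 powr_mono2[of "1 - n * s" wid w] by simp
  then have "C0 powr s * w powr (n * s) \<le> w powr (1 - n * s) * w powr (n * s)"
    by (rule mult_right_mono) simp
  also have "\<dots> = w" using w1 by (simp add: powr_add[symmetric])
  finally show ?thesis .
qed

text \<open>\<open>R1\<close> is the regularity bound for distances up to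
  \<open>K0 * (1 + wid)\<close>, in units of the scale. In \<open>R2\<close> below,
  \<open>1 + 2 * kap wid\<close> serves pairs farther apart than the scale and
  \<open>R1 * C0 powr s\<close> closer ones.\<close>

definition R1 :: real where "R1 = Ar * (2 * (K0 * (1 + wid))) powr (1 - \<theta>)"
definition R2 :: real where "R2 = 1 + 2 * kap wid + R1 * C0 powr s"

lemma R1_nonneg: "0 \<le> R1" and kap_wid_nonneg: "0 \<le> kap wid" and R2_ge_1: "1 \<le> R2"
proof -
  show 1: "0 \<le> R1" using Ar_pos by (simp add: R1_def)
  show 2: "0 \<le> kap wid" using kap_pos[of wid] wid_ge_1 by simp
  show "1 \<le> R2" using 1 2 by (simp add: R2_def)
qed

text \<open>Compared with averaging at scale \<open>t\<close>, no integrals occur,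
  and the Lipschitz constant is controlled uniformly in \<open>t\<close>.\<close>

lemma sup_convolution:
  fixes \<psi> :: "'a \<Rightarrow> real"
  assumes lip: "lip \<psi> A" and A: "0 < A" and \<rho>: "0 \<le> \<rho>"
    and supp: "\<And>x. \<rho> \<le> d x0 x \<Longrightarrow> \<psi> x = 0" and t: "0 < t" "t \<le> 1"
  shows "\<exists>\<psi>'. (\<forall>x. \<bar>\<psi>' x - \<psi> x\<bar> \<le> A * kap wid * V t powr s) \<and> lip \<psi>' (A * R2) \<and>
    (\<lambda>x. complex_of_real (\<psi>' x)) \<in> TC"
proof -
  have le: "\<bar>\<psi> x - \<psi> y\<bar> \<le> A * V (d x y) powr s" for x y
    using lip by (simp add: lip_def)
  define B where "B = \<bar>\<psi> x0\<bar> + A * V \<rho> powr s"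
  have B0: "0 \<le> B" using A by (simp add: B_def)
  have B: "\<bar>\<psi> x\<bar> \<le> B" for x
  proof (cases "d x0 x < \<rho>")
    case True
    have "A * V (d x0 x) powr s \<le> A * V \<rho> powr s"
      using A True by (intro mult_left_mono V_powr_mono) auto
    then show ?thesis using le[of x0 x] unfolding B_def by linarith
  qed (use supp[of x] B0 in auto)
  \<comment> \<open>The slope for which the penalty at distance \<open>t\<close> equals
    \<open>A * V t powr s\<close>, the oscillation allowed there.\<close>
  define L where "L = A * V t powr s / t"
  have L: "0 < L" using A t V_pos[OF t(1)] by (simp add: L_def)
  define g where "g x y = \<psi> y - L * d x y" for x y
  define \<psi>' where "\<psi>' x = (SUP y. g x y)" for x
  have gB: "g x y \<le> B" for x y
    using B[of y] L dist_nonneg[of x y] unfolding g_def by (smt (verit) mult_nonneg_nonneg)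
  have bdd: "bdd_above (range (g x))" for x
    using gB by (intro bdd_aboveI[of _ B]) auto
  have up: "g x y \<le> \<psi>' x" for x y
    unfolding \<psi>'_def using bdd by (intro cSUP_upper) auto
  have least: "(\<And>y. g x y \<le> c) \<Longrightarrow> \<psi>' x \<le> c" for x c
    unfolding \<psi>'_def by (intro cSUP_least) auto
  have ge: "\<psi> x \<le> \<psi>' x" for x using up[of x x] by (simp add: g_def)
  \<comment> \<open>Points beyond \<open>wid * t\<close> do not improve on \<open>y = x\<close>, so
    the supremum is effectively local.\<close>
  have far: "g x y \<le> \<psi> x" if "wid * t \<le> d x y" for x y
  proof -
    have "t \<le> wid * t" using wid_ge_1 t by simp
    then have "t \<le> d x y" using that by linarith
    then have "V (d x y) powr s \<le> C0 powr s * (d x y / t) powr (n * s) * V t powr s"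
      using t by (intro V_powr_growth) auto
    also have "\<dots> \<le> (d x y / t) * V t powr s"
      using that t by (intro mult_right_mono wid) (auto simp: pos_le_divide_eq)
    finally have "A * V (d x y) powr s \<le> A * ((d x y / t) * V t powr s)"
      using A by (intro mult_left_mono) auto
    also have "\<dots> = L * d x y" by (simp add: L_def)
    finally show ?thesis using le[of y x] unfolding g_def by (simp add: dist_sym[of y x])
  qed
  define E where "E = A * kap wid * V t powr s"
  have E0: "0 \<le> E" using A kap_wid_nonneg by (simp add: E_def)
  have close: "\<psi>' x \<le> \<psi> x + E" for x
  proof (rule least)
    fix y
    show "g x y \<le> \<psi> x + E"
    proof (cases "wid * t \<le> d x y")
      case True
      then show ?thesis using far[of x y] E0 by linarith
    next
      case False
      then have "A * V (d x y) powr s \<le> A * (kap wid * V t powr s)"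
        using A wid_ge_1 by (intro mult_left_mono V_powr_le) auto
      then have "\<psi> y - \<psi> x \<le> E" using le[of y x] by (simp add: E_def dist_sym[of y x] mult.assoc)
      moreover have "0 \<le> L * d x y" using L dist_nonneg[of x y] by simp
      ultimately show ?thesis unfolding g_def by linarith
    qed
  qed
  let ?r = "A * R1 * V t powr s"
  let ?q = "\<lambda>x y. (d x y / t) powr \<theta>"
  \<comment> \<open>Only points within \<open>wid * t\<close> of \<open>x\<close> compete. For
    these, replacing \<open>x\<close> by \<open>y\<close> changes just the penalty, so the Holder
    order \<open>\<theta>\<close> comes from the regularity of \<open>d\<close> and not from
    \<open>\<psi>\<close>.\<close>
  have hold1: "\<psi>' x \<le> \<psi>' y + ?r * ?q x y" if xy: "d x y \<le> t" for x y
  proof -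
    let ?D = "?r * ?q x y"
    have near: "g x w \<le> \<psi>' y + ?D" if w: "d x w < wid * t" for w
    proof -
      let ?R = "K0 * (1 + wid) * t"
      have "d y w \<le> K0 * (d y x + d x w)" by (rule quasi_triangle)
      also have "\<dots> \<le> K0 * (t + wid * t)"
        using xy w K0_ge_1 by (intro mult_left_mono) (auto simp: dist_sym[of y x])
      finally have 1: "d y w \<le> ?R" by (simp add: algebra_simps)
      have "1 * (wid * t) \<le> K0 * ((1 + wid) * t)"
        using K0_ge_1 t wid_ge_1 by (intro mult_mono) auto
      then have 2: "d x w \<le> ?R" using w by simp
      have "d y w - d x w \<le> Ar * d x y powr \<theta> * (2 * ?R) powr (1 - \<theta>)"
        using dist_holder[OF 2 1] by linarith
      also have "(2 * ?R) powr (1 - \<theta>) = (2 * (K0 * (1 + wid))) powr (1 - \<theta>) * t powr (1 - \<theta>)"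
        using K0_ge_1 wid_ge_1 t by (simp add: powr_mult[symmetric] mult.assoc)
      also have "t powr (1 - \<theta>) = t / t powr \<theta>" using t by (simp add: powr_diff)
      finally have "d y w - d x w \<le> R1 * ?q x y * t"
        using t dist_nonneg[of x y] by (simp add: R1_def powr_divide mult_ac)
      then have "L * (d y w - d x w) \<le> L * (R1 * ?q x y * t)"
        using L by (intro mult_left_mono) auto
      also have "\<dots> = ?D" using t by (simp add: L_def)
      finally have "g x w \<le> g y w + ?D" unfolding g_def by (simp add: algebra_simps)
      then show ?thesis using up[of y w] by linarith
    qed
    show ?thesis
    proof (rule least)
      fix w
      show "g x w \<le> \<psi>' y + ?D"
      proof (cases "d x w < wid * t")
        case True
        then show ?thesis by (rule near)
      next
        case False
        have "g x x \<le> \<psi>' y + ?D" using wid_ge_1 t by (intro near) simp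
        then show ?thesis using far[of x w] False by (simp add: g_def)
      qed
    qed
  qed
  have hold: "\<bar>\<psi>' x - \<psi>' y\<bar> \<le> ?r * ?q x y" if "d x y \<le> t" for x y
    using hold1[OF that] hold1[of y x] that by (simp add: dist_sym[of y x] abs_le_iff algebra_simps)
  have lip': "lip \<psi>' (A * R2)"
    unfolding lip_def
  proof (intro allI)
    fix x y
    show "norm (\<psi>' x - \<psi>' y) \<le> A * R2 * V (d x y) powr s"
    proof (cases "d x y \<le> t")
      case True
      show ?thesis
      proof (cases "x = y")
        case False
        then have pos: "0 < d x y" by (rule dist_pos)
        \<comment> \<open>Going down from scale \<open>t\<close> to \<open>d x y\<close> costs
          \<open>(t / d x y) powr (n * s)\<close>, which the Holder factor of order
          \<open>\<theta>\<close> outweighs. This makes the Lipschitz constant independent of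
          \<open>t\<close>.\<close>
        have "V t powr s * ?q x y \<le> (C0 powr s * (t / d x y) powr (n * s) * V (d x y) powr s) * ?q x y"
          using pos True by (intro mult_right_mono V_powr_growth) auto
        also have "(t / d x y) powr (n * s) = (d x y / t) powr (- (n * s))"
          using pos t by (simp add: powr_minus powr_divide)
        also have "(C0 powr s * (d x y / t) powr (- (n * s)) * V (d x y) powr s) * ?q x y
          = C0 powr s * V (d x y) powr s * (d x y / t) powr (\<theta> - n * s)"
          by (simp add: powr_add[symmetric] mult_ac)
        also have "\<dots> \<le> C0 powr s * V (d x y) powr s * 1"
          using pos t True ns_lt_theta by (intro mult_left_mono powr_le1) auto
        finally have *: "V t powr s * ?q x y \<le> C0 powr s * V (d x y) powr s" by simp
        have "\<bar>\<psi>' x - \<psi>' y\<bar> \<le> A * R1 * (V t powr s * ?q x y)"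
          using hold[OF True] by (simp add: mult.assoc)
        also have "\<dots> \<le> A * R1 * (C0 powr s * V (d x y) powr s)"
          using A R1_nonneg by (intro mult_left_mono *) auto
        also have "\<dots> = A * (R1 * C0 powr s) * V (d x y) powr s" by (simp add: mult_ac)
        also have "\<dots> \<le> A * R2 * V (d x y) powr s"
          using A kap_wid_nonneg by (intro mult_right_mono mult_left_mono) (auto simp: R2_def)
        finally show ?thesis by simp
      qed simp
    next
      case False
      have "E \<le> A * kap wid * V (d x y) powr s"
        unfolding E_def using False A kap_wid_nonneg by (intro mult_left_mono V_powr_mono) auto
      moreover have "\<bar>\<psi>' x - \<psi>' y\<bar> \<le> \<bar>\<psi> x - \<psi> y\<bar> + 2 * E"
        using close[of x] close[of y] ge[of x] ge[of y] E0 by (simp add: abs_le_iff) linarith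
      ultimately have "\<bar>\<psi>' x - \<psi>' y\<bar> \<le> A * V (d x y) powr s + 2 * (A * kap wid * V (d x y) powr s)"
        using le[of x y] by linarith
      also have "\<dots> = A * (1 + 2 * kap wid) * V (d x y) powr s" by (simp add: algebra_simps)
      also have "\<dots> \<le> A * R2 * V (d x y) powr s"
        using A R1_nonneg by (intro mult_right_mono mult_left_mono) (auto simp: R2_def)
      finally show ?thesis by simp
    qed
  qed
  \<comment> \<open>Values of \<open>\<psi>\<close> farther than \<open>wid * t\<close>, hence
    farther than \<open>wid\<close>, do not compete, so the support grows only by a bounded
    amount.\<close>
  let ?\<rho> = "K0 * (\<rho> + wid)"
  have \<rho>': "\<rho> \<le> ?\<rho>" "0 \<le> ?\<rho>"
  proof -
    have "1 * \<rho> \<le> ?\<rho>" using K0_ge_1 \<rho> wid_ge_1 by (intro mult_mono) auto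
    then show "\<rho> \<le> ?\<rho>" "0 \<le> ?\<rho>" using \<rho> by auto
  qed
  have supp': "\<psi>' x = 0" if x: "?\<rho> \<le> d x0 x" for x
  proof -
    have \<psi>x: "\<psi> x = 0" using x \<rho>' by (intro supp) linarith
    have "\<psi>' x \<le> 0"
    proof (rule least)
      fix y
      show "g x y \<le> 0"
      proof (cases "wid * t \<le> d x y")
        case True
        then show ?thesis using far[of x y] \<psi>x by simp
      next
        case False
        moreover have "wid * t \<le> wid * 1" using t wid_ge_1 by (intro mult_left_mono) auto
        ultimately have "d y x < wid" by (simp add: dist_sym[of y x])
        have "\<rho> \<le> d x0 y"
        proof (rule ccontr)
          assume "\<not> \<rho> \<le> d x0 y"
          then have "K0 * (d x0 y + d y x) < ?\<rho>"
            using \<open>d y x < wid\<close> K0_ge_1 by (intro mult_strict_left_mono) auto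
          then show False using quasi_triangle[of x0 x y] x by linarith
        qed
        then show ?thesis using supp[of y] L dist_nonneg[of x y] by (simp add: g_def)
      qed
    qed
    then show ?thesis using ge[of x] \<psi>x by simp
  qed
  \<comment> \<open>The first summand serves distances up to \<open>t\<close>; beyond
    \<open>t\<close> twice the supremum bound suffices, since \<open>?q x y\<close> is then at least
    1.\<close>
  let ?H = "?r + 2 * (B + E)"
  have "(\<lambda>x. complex_of_real (\<psi>' x)) \<in> test_space d M K0 x0 1 \<epsilon> \<epsilon>"
  proof (rule smooth_test_space[where B = "B + E" and \<rho> = ?\<rho> and H = "?H / t powr \<theta>"])
    have bd: "\<bar>\<psi>' x\<bar> \<le> B + E" for x
      using ge[of x] close[of x] B[of x] E0 by linarith
    then show "cmod (complex_of_real (\<psi>' x)) \<le> B + E" for x by simp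
    show "?\<rho> \<le> d x0 x \<Longrightarrow> complex_of_real (\<psi>' x) = 0" for x using supp' by simp
    show "0 \<le> ?\<rho>" by (rule \<rho>')
    show "0 \<le> ?H / t powr \<theta>" using A R1_nonneg B0 E0 by simp
    fix x y
    have "\<bar>\<psi>' x - \<psi>' y\<bar> \<le> ?H * ?q x y"
    proof (cases "d x y \<le> t")
      case True
      have "?r * ?q x y \<le> ?H * ?q x y"
        using B0 E0 by (intro mult_right_mono) auto
      then show ?thesis using hold[OF True] by linarith
    next
      case False
      have "\<bar>\<psi>' x - \<psi>' y\<bar> \<le> ?H * 1"
      proof -
        have "0 \<le> ?r" using A R1_nonneg by simp
        then show ?thesis using bd[of x] bd[of y] unfolding mult_1_right distrib_left by linarith
      qed
      also have "\<dots> \<le> ?H * ?q x y"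
        using False t theta A R1_nonneg B0 E0 by (intro mult_left_mono ge_one_powr_ge_zero) auto
      finally show ?thesis .
    qed
    then show "cmod (complex_of_real (\<psi>' x) - complex_of_real (\<psi>' y))
      \<le> ?H / t powr \<theta> * d x y powr \<theta>"
      using t dist_nonneg[of x y] by (simp add: of_real_diff[symmetric] powr_divide del: of_real_diff)
  qed
  then have "(\<lambda>x. complex_of_real (\<psi>' x)) \<in> TC" using test_space_closure by blast
  moreover have "\<bar>\<psi>' x - \<psi> x\<bar> \<le> A * kap wid * V t powr s" for x
    using ge[of x] close[of x] by (simp add: E_def)
  ultimately show ?thesis using lip' by blast
qed

section \<open>Series of atoms against Lipschitz functions\<close>

definition atomic :: "ereal \<Rightarrow> (nat \<Rightarrow> complex) \<Rightarrow> (nat \<Rightarrow> 'a \<Rightarrow> complex) \<Rightarrow> bool" where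
  "atomic q l a \<longleftrightarrow> 1 < q \<and> (\<forall>i. \<exists>z r. 0 < r \<and> atom M p q (qball d z r) (a i)) \<and>
     summable (\<lambda>i. cmod (l i) powr p)"

text \<open>The termwise extension of \<open>g\<close> to Lipschitz functions that are not test
  functions; whether it depends on the decomposition is the question of this part.\<close>

definition pairing :: "(nat \<Rightarrow> complex) \<Rightarrow> (nat \<Rightarrow> 'a \<Rightarrow> complex) \<Rightarrow> ('a \<Rightarrow> complex) \<Rightarrow> complex" where
  "pairing l a h = (\<Sum>i. l i * (LINT x|M. a i x * h x))"

lemma lip_pairing:
  fixes h :: "'a \<Rightarrow> complex"
  assumes a: "atom M p q (qball d z r) a" "1 < q" "r > 0" and h: "lip h A" "0 \<le> A"
  shows "integrable M (\<lambda>x. a x * h x)" and "cmod (LINT x|M. a x * h x) \<le> A * kap (2 * K0) * cv powr s"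
proof -
  let ?K = "A * kap (2 * K0) * V r powr s"
  have K0: "0 \<le> ?K" using h(2) kap_pos[of "2 * K0"] K0_ge_1 by simp
  have osc: "d z x < r \<Longrightarrow> cmod (h z - h x) \<le> ?K" for x
    using a(3) by (intro lip_ball[OF h]) auto
  have bd: "d z x < r \<Longrightarrow> cmod (h x) \<le> cmod (h z) + ?K" for x
    using osc[of x] norm_triangle_sub[of "h x" "h z"] by (simp add: norm_minus_commute)
  have "integrable M (\<lambda>x. h x * a x)"
    using K0 by (intro atom_mult_bound(1)[OF a lip_measurable[OF h(1)] bd]) auto
  then show "integrable M (\<lambda>x. a x * h x)" by (simp add: mult.commute)
  have "cmod (LINT x|M. a x * h x) \<le> ?K * vol z r powr - s"
    by (rule atom_cancel[OF a lip_measurable[OF h(1)] osc K0])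
  also have "\<dots> = A * kap (2 * K0) * (V r powr s * vol z r powr - s)" by simp
  also have "\<dots> \<le> A * kap (2 * K0) * cv powr s"
    using h(2) kap_pos[of "2 * K0"] K0_ge_1 by (intro mult_left_mono V_ball_powr a(3)) auto
  finally show "cmod (LINT x|M. a x * h x) \<le> A * kap (2 * K0) * cv powr s" .
qed

lemma atomic_pairing:
  fixes h :: "'a \<Rightarrow> complex"
  assumes "atomic q l a" "lip h A" "0 \<le> A"
  shows "integrable M (a i)" "integrable M (\<lambda>x. a i x * h x)"
    "cmod (LINT x|M. a i x * h x) \<le> A * kap (2 * K0) * cv powr s"
proof -
  obtain z r where zr: "0 < r" "atom M p q (qball d z r) (a i)" and q: "1 < q"
    using assms(1) unfolding atomic_def by blast
  show "integrable M (a i)" by (rule atom_L1(1)[OF zr(2) q refl zr(1)])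
  show "integrable M (\<lambda>x. a i x * h x)" "cmod (LINT x|M. a i x * h x) \<le> A * kap (2 * K0) * cv powr s"
    by (rule lip_pairing[OF zr(2) q zr(1) assms(2,3)])+
qed

lemma atomic_summable: "atomic q l a \<Longrightarrow> summable (\<lambda>i. cmod (l i))"
  by (rule summable_powr_le_1(1)[OF p_pos p_lt]) (auto simp: atomic_def)

lemma pairing_summable:
  fixes h :: "'a \<Rightarrow> complex"
  assumes "atomic q l a" "lip h A" "0 \<le> A"
  shows "summable (\<lambda>i. l i * (LINT x|M. a i x * h x))"
proof (rule summable_norm_cancel, rule summable_comparison_test'[OF summable_mult2[OF atomic_summable[OF assms(1)]]])
  fix i
  show "norm (norm (l i * (LINT x|M. a i x * h x))) \<le> cmod (l i) * (A * kap (2 * K0) * cv powr s)"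
    using atomic_pairing(3)[OF assms] by (simp add: norm_mult mult_left_mono)
qed

text \<open>Each term converges because \<open>hk\<close> does so uniformly and the atom is
  integrable. Uniform convergence alone does not control the series, as the L1 norms of the atoms
  need not be bounded; the common Lipschitz constant bounds all the integrals, and Tannery's theorem
  applies with dominating terms proportional to \<open>cmod (l i)\<close>.\<close>

lemma pairing_limit:
  fixes h :: "'a \<Rightarrow> complex"
  assumes at: "atomic q l a" and A: "0 \<le> A" and h: "lip h A" "\<And>k. lip (hk k) A"
    and e: "\<And>k x. cmod (hk k x - h x) \<le> e k" "e \<longlonglongrightarrow> 0"
  shows "(\<lambda>k. pairing l a (hk k)) \<longlonglongrightarrow> pairing l a h"
proof -
  have lim: "(\<lambda>k. l i * (LINT x|M. a i x * hk k x)) \<longlonglongrightarrow> l i * (LINT x|M. a i x * h x)" for i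
  proof (intro tendsto_mult_left)
    have ia: "integrable M (a i)" by (rule atomic_pairing(1)[OF at h(1) A])
    have b: "cmod ((LINT x|M. a i x * hk k x) - (LINT x|M. a i x * h x)) \<le> (LINT x|M. cmod (a i x)) * e k" for k
    proof -
      have i1: "integrable M (\<lambda>x. a i x * hk k x)" by (rule atomic_pairing(2)[OF at h(2) A])
      have i2: "integrable M (\<lambda>x. a i x * h x)" by (rule atomic_pairing(2)[OF at h(1) A])
      have "(LINT x|M. a i x * hk k x) - (LINT x|M. a i x * h x) = (LINT x|M. a i x * hk k x - a i x * h x)"
        by (rule Bochner_Integration.integral_diff[OF i1 i2, symmetric])
      also have "cmod \<dots> \<le> (LINT x|M. cmod (a i x * hk k x - a i x * h x))"
        by (rule integral_norm_bound)
      also have "\<dots> \<le> (LINT x|M. cmod (a i x) * e k)"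
      proof (rule integral_mono)
        show "integrable M (\<lambda>x. cmod (a i x * hk k x - a i x * h x))"
          using i1 i2 by (intro integrable_norm Bochner_Integration.integrable_diff)
        show "cmod (a i x * hk k x - a i x * h x) \<le> cmod (a i x) * e k" for x
          unfolding right_diff_distrib[symmetric] norm_mult by (intro mult_left_mono e(1)) auto
      qed (use ia in simp)
      finally show ?thesis by simp
    qed
    have "(\<lambda>k. (LINT x|M. cmod (a i x)) * e k) \<longlonglongrightarrow> 0"
      using tendsto_mult_left[OF e(2), of "LINT x|M. cmod (a i x)"] by simp
    then have "(\<lambda>k. (LINT x|M. a i x * hk k x) - (LINT x|M. a i x * h x)) \<longlonglongrightarrow> 0"
      by (rule Lim_null_comparison[rotated]) (use b in auto)
    then show "(\<lambda>k. LINT x|M. a i x * hk k x) \<longlonglongrightarrow> (LINT x|M. a i x * h x)"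
      by (rule LIM_zero_cancel)
  qed
  have "norm (l i * (LINT x|M. a i x * hk k x)) \<le> cmod (l i) * (A * kap (2 * K0) * cv powr s)" for i k
    using atomic_pairing(3)[OF at h(2) A] by (simp add: norm_mult mult_left_mono)
  then have bound: "eventually (\<lambda>(i, k). norm (l i * (LINT x|M. a i x * hk k x)) \<le> cmod (l i) * (A * kap (2 * K0) * cv powr s))
    (at_top \<times>\<^sub>F sequentially)"
    by (intro always_eventually) auto
  show ?thesis
    unfolding pairing_def
    using tannerys_theorem[OF lim bound summable_mult2[OF atomic_summable[OF at]]] by simp
qed

lemma lip_of_real: "lip \<psi> A \<Longrightarrow> lip (\<lambda>x. complex_of_real (\<psi> x)) A"
  by (simp add: lip_def flip: of_real_diff)

lemma lip_mono: "lip \<psi> A \<Longrightarrow> A \<le> A' \<Longrightarrow> lip \<psi> A'"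
  unfolding lip_def by (meson mult_right_mono order_trans powr_ge_zero)

lemma pairing_distribution:
  assumes "dsums (\<lambda>i x. l i * a i x) g" "\<phi> \<in> TC"
  shows "pairing l a \<phi> = g \<phi>"
proof -
  have "(\<lambda>i. act (\<lambda>x. l i * a i x) \<phi>) sums g \<phi>"
    using assms by (simp add: sums_in_distributions_def)
  then show ?thesis
    unfolding dist_of_fun_cmult by (simp add: pairing_def dist_of_fun_def sums_iff)
qed

lemma V_powr_tendsto: "(\<lambda>k. V (inverse (real (Suc k))) powr s) \<longlonglongrightarrow> 0"
proof (rule Lim_null_comparison)
  show "\<forall>\<^sub>F k in sequentially. norm (V (inverse (real (Suc k))) powr s)
    \<le> (cr * V 1) powr s * inverse (real (Suc k)) powr (\<kappa> * s)"
  proof (intro always_eventually allI)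
    fix k
    let ?t = "inverse (real (Suc k))"
    have t: "0 < ?t" "?t \<le> 1" by (auto simp: inverse_le_1_iff)
    have "V ?t \<le> cr * ?t powr \<kappa> * V 1" using V_reverse[OF t] by simp
    then have "V ?t powr s \<le> (cr * ?t powr \<kappa> * V 1) powr s"
      using s_pos by (intro powr_mono2) auto
    also have "\<dots> = (cr * V 1) powr s * ?t powr (\<kappa> * s)"
      using cr_pos by (simp add: powr_mult powr_powr)
    finally show "norm (V ?t powr s) \<le> (cr * V 1) powr s * ?t powr (\<kappa> * s)" by simp
  qed
  have "(\<lambda>k. inverse (real (Suc k)) powr (\<kappa> * s)) \<longlonglongrightarrow> 0 powr (\<kappa> * s)"
    using kappa_pos s_pos by (intro tendsto_powr' LIMSEQ_inverse_real_of_nat tendsto_const disjI2) auto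
  then have "(\<lambda>k. (cr * V 1) powr s * inverse (real (Suc k)) powr (\<kappa> * s)) \<longlonglongrightarrow> (cr * V 1) powr s * 0"
    by (intro tendsto_mult_left) simp
  then show "(\<lambda>k. (cr * V 1) powr s * inverse (real (Suc k)) powr (\<kappa> * s)) \<longlonglongrightarrow> 0" by simp
qed

section \<open>Two decompositions of the same distribution\<close>

context
  fixes q q' l l' a a' g
  assumes at: "atomic q l a" "dsums (\<lambda>i x. l i * a i x) g"
    and at': "atomic q' l' a'" "dsums (\<lambda>i x. l' i * a' i x) g"
begin

lemma determined_limit:
  fixes h :: "'a \<Rightarrow> complex"
  assumes "0 \<le> A" "lip h A" "\<And>k. lip (hk k) A" "\<And>k x. cmod (hk k x - h x) \<le> e k" "e \<longlonglongrightarrow> 0"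
    and "\<And>k. pairing l a (hk k) = pairing l' a' (hk k)"
  shows "pairing l a h = pairing l' a' h"
  using LIMSEQ_unique pairing_limit[OF at(1) assms(1-5)] pairing_limit[OF at'(1) assms(1-5)] assms(6) by simp

text \<open>The sup-convolutions at scales tending to 0 are test functions, on which both series
  return the value of \<open>g\<close>; their Lipschitz constants do not depend on the
  scale.\<close>

lemma determined_support:
  fixes \<psi> :: "'a \<Rightarrow> real"
  assumes lip: "lip \<psi> A" and A: "0 < A" and \<rho>: "0 \<le> \<rho>"
    and supp: "\<And>x. \<rho> \<le> d x0 x \<Longrightarrow> \<psi> x = 0"
  shows "pairing l a (\<lambda>x. of_real (\<psi> x)) = pairing l' a' (\<lambda>x. of_real (\<psi> x))"
proof -
  let ?t = "\<lambda>k. inverse (real (Suc k))"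
  have "\<exists>\<psi>'. (\<forall>x. \<bar>\<psi>' x - \<psi> x\<bar> \<le> A * kap wid * V (?t k) powr s) \<and> lip \<psi>' (A * R2) \<and>
    (\<lambda>x. complex_of_real (\<psi>' x)) \<in> TC" for k
    by (rule sup_convolution[OF lip A \<rho> supp]) (auto simp: inverse_le_1_iff)
  then obtain \<psi>k where \<psi>k: "\<And>k x. \<bar>\<psi>k k x - \<psi> x\<bar> \<le> A * kap wid * V (?t k) powr s"
    "\<And>k. lip (\<psi>k k) (A * R2)" "\<And>k. (\<lambda>x. complex_of_real (\<psi>k k x)) \<in> TC"
    by metis
  show ?thesis
  proof (rule determined_limit)
    show "0 \<le> A * R2" using A R2_ge_1 by simp
    have "A * 1 \<le> A * R2" using A R2_ge_1 by (intro mult_left_mono) auto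
    then show "lip (\<lambda>x. complex_of_real (\<psi> x)) (A * R2)"
      using lip by (intro lip_of_real lip_mono[OF lip]) simp
    show "lip (\<lambda>x. complex_of_real (\<psi>k k x)) (A * R2)" for k by (rule lip_of_real[OF \<psi>k(2)])
    show "cmod (complex_of_real (\<psi>k k x) - complex_of_real (\<psi> x)) \<le> A * kap wid * V (?t k) powr s" for k x
      using \<psi>k(1)[of k x] by (simp flip: of_real_diff)
    show "(\<lambda>k. A * kap wid * V (?t k) powr s) \<longlonglongrightarrow> 0"
      using tendsto_mult_left[OF V_powr_tendsto, of "A * kap wid"] by simp
    show "pairing l a (\<lambda>x. of_real (\<psi>k k x)) = pairing l' a' (\<lambda>x. of_real (\<psi>k k x))" for k
      using pairing_distribution[OF at(2) \<psi>k(3)] pairing_distribution[OF at'(2) \<psi>k(3)] by simp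
  qed
qed

text \<open>A function vanishing at infinity is reduced to bounded support by acting on its values
  instead of multiplying by a cutoff.\<close>

lemma determined_vanishing:
  fixes \<psi> :: "'a \<Rightarrow> real"
  assumes lip: "lip \<psi> A" and A: "0 < A"
    and van: "\<And>\<delta>. 0 < \<delta> \<Longrightarrow> \<exists>\<rho>\<ge>0. \<forall>x. \<rho> \<le> d x0 x \<longrightarrow> \<bar>\<psi> x\<bar> \<le> \<delta>"
  shows "pairing l a (\<lambda>x. of_real (\<psi> x)) = pairing l' a' (\<lambda>x. of_real (\<psi> x))"
proof -
  let ?t = "\<lambda>k. inverse (real (Suc k))"
  \<comment> \<open>Soft thresholding: it is 0 where the modulus of \<open>\<psi>\<close> is at most
    the threshold, differs from \<open>\<psi>\<close> by no more than the threshold, and does not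
    increase the Lipschitz constant.\<close>
  define \<psi>k where "\<psi>k k x = \<psi> x - max (- ?t k) (min (?t k) (\<psi> x))" for k x
  have lk: "lip (\<psi>k k) A" for k
  proof -
    have "\<bar>\<psi>k k x - \<psi>k k y\<bar> \<le> \<bar>\<psi> x - \<psi> y\<bar>" for x y
      unfolding \<psi>k_def by (auto simp: max_def min_def abs_if)
    then show ?thesis using lip unfolding lip_def real_norm_def by (meson order_trans)
  qed
  show ?thesis
  proof (rule determined_limit)
    show "0 \<le> A" using A by simp
    show "lip (\<lambda>x. complex_of_real (\<psi> x)) A" by (rule lip_of_real[OF lip])
    show "lip (\<lambda>x. complex_of_real (\<psi>k k x)) A" for k by (rule lip_of_real[OF lk])
    show "cmod (complex_of_real (\<psi>k k x) - complex_of_real (\<psi> x)) \<le> ?t k" for k x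
    proof -
      have "0 < ?t k" by simp
      then have "\<bar>\<psi>k k x - \<psi> x\<bar> \<le> ?t k" unfolding \<psi>k_def by (auto simp: max_def min_def abs_if)
      then show ?thesis by (simp flip: of_real_diff)
    qed
    show "?t \<longlonglongrightarrow> 0" by (rule LIMSEQ_inverse_real_of_nat)
    show "pairing l a (\<lambda>x. of_real (\<psi>k k x)) = pairing l' a' (\<lambda>x. of_real (\<psi>k k x))" for k
    proof -
      have "0 < ?t k" by simp
      then obtain \<rho> where \<rho>: "0 \<le> \<rho>" "\<And>x. \<rho> \<le> d x0 x \<Longrightarrow> \<bar>\<psi> x\<bar> \<le> ?t k"
        using van[of "?t k"] by blast
      show ?thesis
      proof (rule determined_support[OF lk A \<rho>(1)])
        fix x assume "\<rho> \<le> d x0 x"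
        then have "\<bar>\<psi> x\<bar> \<le> ?t k" by (rule \<rho>(2))
        then show "\<psi>k k x = 0" unfolding \<psi>k_def by (auto simp: max_def min_def abs_if split: if_splits)
      qed
    qed
  qed
qed

text \<open>Sup-convolution and thresholding need real values, so real and imaginary parts are
  treated separately; both inherit the Lipschitz constant and the decay.\<close>

lemma determined:
  fixes h :: "'a \<Rightarrow> complex"
  assumes lip: "lip h A" and A: "0 < A"
    and van: "\<And>\<delta>. 0 < \<delta> \<Longrightarrow> \<exists>\<rho>\<ge>0. \<forall>x. \<rho> \<le> d x0 x \<longrightarrow> cmod (h x) \<le> \<delta>"
  shows "pairing l a h = pairing l' a' h"
proof -
  have split: "pairing m b h = pairing m b (\<lambda>x. of_real (Re (h x))) + \<i> * pairing m b (\<lambda>x. of_real (Im (h x)))"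
    and re: "lip (\<lambda>x. Re (h x)) A" and im: "lip (\<lambda>x. Im (h x)) A" if "atomic w m b" for w m b
  proof -
    show re: "lip (\<lambda>x. Re (h x)) A"
      using lip abs_Re_le_cmod unfolding lip_def real_norm_def minus_complex.sel(1)[symmetric] by (meson order_trans)
    show im: "lip (\<lambda>x. Im (h x)) A"
      using lip abs_Im_le_cmod unfolding lip_def real_norm_def minus_complex.sel(2)[symmetric] by (meson order_trans)
    note re' = lip_of_real[OF re] and im' = lip_of_real[OF im]
    have A': "0 \<le> A" using A by simp
    have "m i * (LINT x|M. b i x * h x) =
      m i * (LINT x|M. b i x * of_real (Re (h x))) + \<i> * (m i * (LINT x|M. b i x * of_real (Im (h x))))" for i
    proof -
      have "(LINT x|M. b i x * h x) = (LINT x|M. b i x * of_real (Re (h x)) + \<i> * (b i x * of_real (Im (h x))))"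
        by (intro Bochner_Integration.integral_cong refl) (metis complex_eq distrib_left mult.left_commute)
      also have "\<dots> = (LINT x|M. b i x * of_real (Re (h x))) + (LINT x|M. \<i> * (b i x * of_real (Im (h x))))"
        by (intro Bochner_Integration.integral_add integrable_mult_right atomic_pairing(2)[OF that re' A'] atomic_pairing(2)[OF that im' A'])
      finally show ?thesis by (simp add: algebra_simps)
    qed
    then show "pairing m b h = pairing m b (\<lambda>x. of_real (Re (h x))) + \<i> * pairing m b (\<lambda>x. of_real (Im (h x)))"
      unfolding pairing_def
      using suminf_add[OF pairing_summable[OF that re' A'] summable_mult[OF pairing_summable[OF that im' A'], of \<i>]]
        suminf_mult[OF pairing_summable[OF that im' A'], of \<i>] by simp
  qed
  have vr: "0 < \<delta> \<Longrightarrow> \<exists>\<rho>\<ge>0. \<forall>x. \<rho> \<le> d x0 x \<longrightarrow> \<bar>Re (h x)\<bar> \<le> \<delta>"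
    and vi: "0 < \<delta> \<Longrightarrow> \<exists>\<rho>\<ge>0. \<forall>x. \<rho> \<le> d x0 x \<longrightarrow> \<bar>Im (h x)\<bar> \<le> \<delta>" for \<delta>
    using van[of \<delta>] abs_Re_le_cmod abs_Im_le_cmod by (meson order_trans)+
  show ?thesis
    unfolding split[OF at(1)] split[OF at'(1)]
    using determined_vanishing[OF re[OF at(1)] A vr] determined_vanishing[OF im[OF at(1)] A vi] by simp
qed

end

end

section \<open>The product of a Lipschitz function with a test function\<close>

context lip_setting
begin

definition G0 :: "('a \<Rightarrow> complex) \<Rightarrow> real" where
  "G0 \<phi> = F * (C0 powr s * V 1 powr s) * (nrm \<phi> * (cv / V 1))"

text \<open>\<open>f\<close> grows at most like \<open>rad x powr (n * s)\<close>, while the test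
  function decays at least like \<open>rad x powr - \<gamma>\<close>;
  \<open>n * s < \<gamma>\<close> makes the exponent negative.\<close>

lemma product_decay:
  assumes \<phi>: "\<phi> \<in> TC"
  shows "cmod (f x * \<phi> x) \<le> G0 \<phi> * rad x powr (n * s - \<gamma>)"
proof -
  have "cmod (f x * \<phi> x) \<le> (F * V (rad x) powr s) * (nrm \<phi> * (cv / V (rad x)) * rad x powr - \<gamma>)"
    unfolding norm_mult using F_nonneg by (intro mult_mono f_growth test_decay[OF \<phi>]) auto
  also have "\<dots> \<le> (F * (C0 powr s * (rad x / 1) powr (n * s) * V 1 powr s)) * (nrm \<phi> * (cv / V 1) * rad x powr - \<gamma>)"
    using F_nonneg nrm_nonneg[OF \<phi>] cv_pos
    by (intro mult_mono[OF mult_left_mono[OF V_powr_growth] mult_right_mono[OF mult_left_mono]] rad_ge_1 cv_div_V_le) auto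
  also have "\<dots> = G0 \<phi> * (rad x powr (n * s) * rad x powr - \<gamma>)" by (simp add: G0_def mult_ac)
  also have "rad x powr (n * s) * rad x powr - \<gamma> = rad x powr (n * s - \<gamma>)"
    by (simp add: powr_add[symmetric])
  finally show ?thesis .
qed

lemma G0_nonneg: "\<phi> \<in> TC \<Longrightarrow> 0 \<le> G0 \<phi>"
  using F_nonneg nrm_nonneg[of \<phi>] cv_pos by (simp add: G0_def)

lemma product_vanishing:
  assumes \<phi>: "\<phi> \<in> TC" and \<delta>: "0 < \<delta>"
  shows "\<exists>\<rho>\<ge>0. \<forall>x. \<rho> \<le> d x0 x \<longrightarrow> cmod (f x * \<phi> x) \<le> \<delta>"
proof (intro exI conjI allI impI)
  let ?e = "\<gamma> - n * s"
  let ?\<rho> = "((G0 \<phi> + 1) / \<delta>) powr (1 / ?e)"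
  have e: "0 < ?e" using ns_gamma by simp
  have G: "0 \<le> G0 \<phi>" by (rule G0_nonneg[OF \<phi>])
  have \<rho>: "0 < ?\<rho>" using G \<delta> by simp
  show "0 \<le> ?\<rho>" by simp
  fix x assume "?\<rho> \<le> d x0 x"
  then have "?\<rho> \<le> rad x" by (simp add: rad_def)
  then have "rad x powr (n * s - \<gamma>) \<le> ?\<rho> powr (n * s - \<gamma>)"
    using \<rho> e by (intro powr_mono2') auto
  also have "\<dots> = ((G0 \<phi> + 1) / \<delta>) powr - 1"
  proof -
    have "1 / ?e * (n * s - \<gamma>) = - 1" using e by (simp add: field_simps)
    then show ?thesis by (simp only: powr_powr)
  qed
  also have "\<dots> = \<delta> / (G0 \<phi> + 1)" using G \<delta> by (simp add: powr_minus)
  finally have "G0 \<phi> * rad x powr (n * s - \<gamma>) \<le> G0 \<phi> * (\<delta> / (G0 \<phi> + 1))"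
    using G by (rule mult_left_mono)
  also have "\<dots> \<le> \<delta>" using G \<delta> by (simp add: field_simps)
  finally show "cmod (f x * \<phi> x) \<le> \<delta>" using product_decay[OF \<phi>, of x] by linarith
qed

text \<open>For close points the product rule applies, and although \<open>f\<close> is unbounded,
  \<open>small_V\<close> turns its growth times the oscillation of the test function into
  \<open>V (d x y) powr s\<close>. For other points the distance is at least
  \<open>1 / (2 * K0)\<close>, and boundedness of the product suffices.\<close>

lemma product_lip:
  assumes \<phi>: "\<phi> \<in> TC"
  shows "\<exists>A'>0. lip (\<lambda>x. f x * \<phi> x) A'"
proof -
  let ?D = "nrm \<phi> * (cv / V 1)"
  let ?v = "V (1 / (2 * K0)) powr s"
  have D: "0 \<le> ?D" using nrm_nonneg[OF \<phi>] cv_pos by simp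
  have v: "0 < ?v" using V_pos[of "1 / (2 * K0)"] K0_ge_1 by simp
  have G: "0 \<le> G0 \<phi>" by (rule G0_nonneg[OF \<phi>])
  have parts: "0 \<le> A * ?D" "0 \<le> F * C0 powr s * ?D" "0 \<le> 2 * G0 \<phi> / ?v"
    using A_nonneg F_nonneg nrm_nonneg[OF \<phi>] cv_pos G v by auto
  \<comment> \<open>The final 1 makes the constant strictly positive, as \<open>determined\<close>
    requires.\<close>
  define A' where "A' = A * ?D + F * C0 powr s * ?D + 2 * G0 \<phi> / ?v + 1"
  have "lip (\<lambda>x. f x * \<phi> x) A'"
    unfolding lip_def
  proof (intro allI)
    fix x y
    let ?\<delta> = "d x y" and ?R = "rad x"
    show "cmod (f x * \<phi> x - f y * \<phi> y) \<le> A' * V (d x y) powr s"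
    proof (cases "?\<delta> \<le> ?R / (2 * K0)")
      case True
      show ?thesis
      proof (cases "x = y")
        case False
        then have pos: "0 < ?\<delta>" by (rule dist_pos)
        have le: "?\<delta> \<le> ?R" using True rad_div_le[of x] by linarith
        have "cmod (f x * \<phi> x - f y * \<phi> y) = cmod ((f x - f y) * \<phi> y + f x * (\<phi> x - \<phi> y))"
          by (simp add: algebra_simps)
        also have "\<dots> \<le> cmod (f x - f y) * cmod (\<phi> y) + cmod (f x) * cmod (\<phi> x - \<phi> y)"
          by (rule order_trans[OF norm_triangle_ineq]) (simp add: norm_mult)
        also have "\<dots> \<le> (A * V ?\<delta> powr s) * ?D + (F * V ?R powr s) * (nrm \<phi> * (cv / V ?R) * (?\<delta> / ?R) powr \<beta>)"
          using f_lip A_nonneg F_nonneg unfolding lip_def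
          by (intro add_mono mult_mono test_sup[OF \<phi>] f_growth test_oscillation[OF \<phi> True]) auto
        also have "(F * V ?R powr s) * (nrm \<phi> * (cv / V ?R) * (?\<delta> / ?R) powr \<beta>)
          = F * (nrm \<phi> * (cv / V ?R)) * ((?\<delta> / ?R) powr \<beta> * V ?R powr s)" by (simp add: mult_ac)
        also have "\<dots> \<le> F * ?D * (C0 powr s * V ?\<delta> powr s)"
        proof (rule mult_mono[OF _ small_V[OF pos le]])
          show "F * (nrm \<phi> * (cv / V ?R)) \<le> F * ?D"
            by (intro mult_left_mono F_nonneg nrm_nonneg[OF \<phi>] cv_div_V_le)
          show "0 \<le> F * ?D" by (intro mult_nonneg_nonneg F_nonneg D)
        qed simp
        finally have "cmod (f x * \<phi> x - f y * \<phi> y) \<le> (A * ?D + F * C0 powr s * ?D) * V ?\<delta> powr s"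
          by (simp add: algebra_simps)
        also have "\<dots> \<le> A' * V ?\<delta> powr s"
          unfolding A'_def using parts by (intro mult_right_mono) (linarith, simp)
        finally show ?thesis .
      qed simp
    next
      case False
      have b: "cmod (f w * \<phi> w) \<le> G0 \<phi>" for w
      proof -
        have "rad w powr (n * s - \<gamma>) \<le> rad w powr 0"
          using rad_ge_1[of w] ns_gamma by (intro powr_mono) auto
        then have "G0 \<phi> * rad w powr (n * s - \<gamma>) \<le> G0 \<phi> * 1"
          using G rad_pos[of w] by (intro mult_left_mono) auto
        then show ?thesis using product_decay[OF \<phi>, of w] by linarith
      qed
      have "1 / (2 * K0) \<le> ?R / (2 * K0)" using rad_ge_1[of x] K0_ge_1 by (intro divide_right_mono) auto
      then have "1 / (2 * K0) \<le> ?\<delta>" using False by linarith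
      then have vle: "?v \<le> V ?\<delta> powr s" by (rule V_powr_mono)
      have "cmod (f x * \<phi> x - f y * \<phi> y) \<le> 2 * G0 \<phi>"
        using norm_triangle_ineq4[of "f x * \<phi> x" "f y * \<phi> y"] b[of x] b[of y] by linarith
      also have "\<dots> = 2 * G0 \<phi> / ?v * ?v" using v by simp
      also have "\<dots> \<le> 2 * G0 \<phi> / ?v * V ?\<delta> powr s"
        using vle G v by (intro mult_left_mono) auto
      also have "\<dots> \<le> A' * V ?\<delta> powr s"
        unfolding A'_def using parts by (intro mult_right_mono) (linarith, simp)
      finally show ?thesis .
    qed
  qed
  moreover have "0 < A'" unfolding A'_def using parts by linarith
  ultimately show ?thesis by blast
qed

text \<open>Moving \<open>f\<close> from the atoms to the test function expresses the product as a
  \<open>pairing\<close> with \<open>f x * \<phi> x\<close>, the form to which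
  \<open>determined\<close> applies.\<close>

lemma product_of_decomposition:
  assumes q: "1 < q" and dec: "atomic_decomposition d M K0 x0 \<epsilon> \<beta> \<gamma> p q l a B g"
  shows "\<exists>P\<in>product_space.
    (\<exists>S1 S2. dsums (\<lambda>i x. l i * (f x - mean M (B i) f) * a i x) S1 \<and>
       dsums (\<lambda>i x. l i * mean M (B i) f * a i x) S2 \<and>
       (\<forall>\<phi>\<in>TC. P \<phi> = S1 \<phi> + S2 \<phi>)) \<and>
    (\<forall>\<phi>\<in>TC. P \<phi> = pairing l a (\<lambda>x. f x * \<phi> x))"
    and "atomic q l a" "dsums (\<lambda>i x. l i * a i x) g"
proof -
  have "\<forall>i. \<exists>zr. B i = qball d (fst zr) (snd zr) \<and> 0 < snd zr"
    using dec unfolding atomic_decomposition_def qballs_def by fastforce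
  then obtain zr where zr: "\<And>i. B i = qball d (fst (zr i)) (snd (zr i))" "\<And>i. 0 < snd (zr i)"
    by metis
  define z where "z i = fst (zr i)" for i
  define r where "r i = snd (zr i)" for i
  have B: "B i = qball d (z i) (r i)" and r: "0 < r i" for i using zr by (auto simp: z_def r_def)
  have as: "atom M p q (qball d (z i) (r i)) (a i)" "summable (\<lambda>i. cmod (l i) powr p)" for i
    using dec B by (auto simp: atomic_decomposition_def)
  interpret S: atomic_series d M K0 C0 \<theta> x0 cv \<kappa> cr Ar \<epsilon> \<beta> \<gamma> p f A q l a z r
    by unfold_locales (use as q r in auto)
  have mn: "mean M (B i) f = S.mn i" for i by (simp add: B S.mn_def)
  have "S.P \<phi> = pairing l a (\<lambda>x. f x * \<phi> x)" for \<phi>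
  proof -
    have "act (\<lambda>x. l i * f x * a i x) \<phi> = l i * (LINT x|M. a i x * (f x * \<phi> x))" for i
      unfolding dist_of_fun_def by (subst integral_mult_right_zero[symmetric]) (simp add: mult_ac)
    then show ?thesis by (simp add: S.P_def pairing_def)
  qed
  then show "\<exists>P\<in>product_space.
    (\<exists>S1 S2. dsums (\<lambda>i x. l i * (f x - mean M (B i) f) * a i x) S1 \<and>
       dsums (\<lambda>i x. l i * mean M (B i) f * a i x) S2 \<and>
       (\<forall>\<phi>\<in>TC. P \<phi> = S1 \<phi> + S2 \<phi>)) \<and>
    (\<forall>\<phi>\<in>TC. P \<phi> = pairing l a (\<lambda>x. f x * \<phi> x))"
    unfolding mn using S.sums_S1 S.sums_S2 S.P_eq S.P_L1_plus_Hardy by blast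
  show "atomic q l a" unfolding atomic_def using q as r by blast
  show "dsums (\<lambda>i x. l i * a i x) g"
    using dec by (simp add: atomic_decomposition_def)
qed

text \<open>Supplies the distribution in the case that \<open>g\<close> has no atomic decomposition,
  where only membership in the sum space is left to prove.\<close>

lemma zero_L1_plus_Hardy:
  "(\<lambda>\<phi>. 0) \<in> L1_plus_Hardy d M K0 x0 \<epsilon> \<beta> \<gamma> p N"
proof -
  have D: "(\<lambda>\<phi>. 0) \<in> dists"
    by (auto simp: distributions_def intro!: exI[of _ 0])
  have "gmax (\<lambda>\<phi>. 0) x \<le> ennreal 0" for x
    unfolding grand_maximal_def by (rule SUP_least) simp
  then have "in_Lp N p (gmax (\<lambda>\<phi>. 0))"
    unfolding in_Lp_def by (intro exI[of _ "\<lambda>x. 0"]) simp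
  then have H: "(\<lambda>\<phi>. 0) \<in> Hardy_space d M K0 x0 \<epsilon> \<beta> \<gamma> p N" using D by (simp add: Hardy_space_def)
  show ?thesis
    unfolding L1_plus_Hardy_def
    using D H integrable_acts[of "\<lambda>x. 0"]
    by (intro CollectI conjI exI[of _ "\<lambda>x. 0"] exI[of _ "\<lambda>\<phi>. 0"]) (auto simp: dist_of_fun_def)
qed

end

text \<open>\<open>P\<close> is quantified before \<open>q\<close> and the decomposition, so the
  statement includes that the product does not depend on either.\<close>

theorem theorem4p2:
  fixes d :: "'a \<Rightarrow> 'a \<Rightarrow> real" and M :: "'a measure"
    and K0 C0 \<theta> \<epsilon> \<beta> \<gamma> p :: real and x0 :: 'a
    and f :: "'a \<Rightarrow> complex" and g :: "('a \<Rightarrow> complex) \<Rightarrow> complex"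
  assumes "homogeneous_space d M K0 C0 \<theta>"
    and "0 < \<epsilon>" and "\<epsilon> \<le> \<theta>"
    and "hom_dim C0 / (hom_dim C0 + \<epsilon>) < p" and "p < 1"
    and "hom_dim C0 * (1 / p - 1) < \<beta>" and "\<beta> < \<epsilon>"
    and "hom_dim C0 * (1 / p - 1) < \<gamma>" and "\<gamma> < \<epsilon>"
    and "f \<in> Lipschitz_space d M (1 / p - 1)"
    and "g \<in> Hardy_space d M K0 x0 \<epsilon> \<beta> \<gamma> p M"
  shows "\<exists>P \<in> L1_plus_Hardy d M K0 x0 \<epsilon> \<beta> \<gamma> p (tau d M K0 C0 x0 p).
    \<forall>(q::ereal) (l :: nat \<Rightarrow> complex) (a :: nat \<Rightarrow> 'a \<Rightarrow> complex) (B :: nat \<Rightarrow> 'a set).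
      1 < q \<longrightarrow> atomic_decomposition d M K0 x0 \<epsilon> \<beta> \<gamma> p q l a B g \<longrightarrow>
      (\<exists>S\<^sub>1 S\<^sub>2.
         sums_in_distributions d M K0 x0 \<epsilon> \<beta> \<gamma>
           (\<lambda>i x. l i * (f x - mean M (B i) f) * a i x) S\<^sub>1 \<and>
         sums_in_distributions d M K0 x0 \<epsilon> \<beta> \<gamma>
           (\<lambda>i x. l i * mean M (B i) f * a i x) S\<^sub>2 \<and>
         (\<forall>\<phi> \<in> test_closure d M K0 x0 \<epsilon> \<beta> \<gamma>. P \<phi> = S\<^sub>1 \<phi> + S\<^sub>2 \<phi>))"
proof -
  interpret homogeneous_space d M K0 C0 \<theta> by (rule assms(1))
  obtain cv \<kappa> cr Ar where "based_space d M K0 C0 \<theta> x0 cv \<kappa> cr Ar"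
    using based_space_exists by blast
  then interpret hardy_setting d M K0 C0 \<theta> x0 cv \<kappa> cr Ar \<epsilon> \<beta> \<gamma> p
    using assms(2-9) by (intro hardy_setting.intro hardy_setting_axioms.intro)
  obtain A where "0 \<le> A" "lip f A"
    using Lipschitz_space_lip[of f] assms(10) unfolding s_def by blast
  then interpret lip_setting d M K0 C0 \<theta> x0 cv \<kappa> cr Ar \<epsilon> \<beta> \<gamma> p f A
    by unfold_locales
  show ?thesis
  proof (cases "\<exists>q l a B. 1 < q \<and> atomic_decomposition d M K0 x0 \<epsilon> \<beta> \<gamma> p q l a B g")
    case False
    then show ?thesis using zero_L1_plus_Hardy by blast
  next
    case True
    \<comment> \<open>One decomposition is fixed to produce \<open>P\<close>; every other one,
      possibly with another exponent, is compared with it on the functions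
      \<open>f x * \<phi> x\<close>.\<close>
    then obtain q l a B where dec: "1 < q" "atomic_decomposition d M K0 x0 \<epsilon> \<beta> \<gamma> p q l a B g" by blast
    note D = product_of_decomposition[OF dec]
    obtain P where P: "P \<in> L1_plus_Hardy d M K0 x0 \<epsilon> \<beta> \<gamma> p (tau d M K0 C0 x0 p)"
      "\<And>\<phi>. \<phi> \<in> TC \<Longrightarrow> P \<phi> = pairing l a (\<lambda>x. f x * \<phi> x)"
      using D(1) by blast
    show ?thesis
    proof (intro bexI[of _ P] allI impI)
      fix q' l' a' B'
      assume "1 < q'" "atomic_decomposition d M K0 x0 \<epsilon> \<beta> \<gamma> p q' l' a' B' g"
      note D' = product_of_decomposition[OF this]
      obtain P' T1 T2 where T: "dsums (\<lambda>i x. l' i * (f x - mean M (B' i) f) * a' i x) T1"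
         "dsums (\<lambda>i x. l' i * mean M (B' i) f * a' i x) T2"
         "\<And>\<phi>. \<phi> \<in> TC \<Longrightarrow> P' \<phi> = T1 \<phi> + T2 \<phi>"
         "\<And>\<phi>. \<phi> \<in> TC \<Longrightarrow> P' \<phi> = pairing l' a' (\<lambda>x. f x * \<phi> x)"
        using D'(1) by blast
      have "P \<phi> = T1 \<phi> + T2 \<phi>" if \<phi>: "\<phi> \<in> TC" for \<phi>
      proof -
        obtain A' where A': "A' > 0" "lip (\<lambda>x. f x * \<phi> x) A'" using product_lip[OF \<phi>] by blast
        have "pairing l a (\<lambda>x. f x * \<phi> x) = pairing l' a' (\<lambda>x. f x * \<phi> x)"
          by (rule determined[OF D(2,3) D'(2,3) A'(2,1) product_vanishing[OF \<phi>]])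
        then show ?thesis using P(2) T(3,4) \<phi> by simp
      qed
      then show "\<exists>S\<^sub>1 S\<^sub>2.
           dsums (\<lambda>i x. l' i * (f x - mean M (B' i) f) * a' i x) S\<^sub>1 \<and>
           dsums (\<lambda>i x. l' i * mean M (B' i) f * a' i x) S\<^sub>2 \<and>
           (\<forall>\<phi> \<in> TC. P \<phi> = S\<^sub>1 \<phi> + S\<^sub>2 \<phi>)"
        using T(1,2) by blast
    qed (rule P(1))
  qed
qed

end
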